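(* Under the standing setup below, let $\hat r=r_{\rm eff}$ and, for $1\le i\le\hat r$, define $$\hat w^{\rm opt}_{i,\hat r}=-2\,\frac{\widehat D(\hat\sigma_i;\widehat\Sigma_{\hat r})}{\widehat D'(\hat\sigma_i;\widehat\Sigma_{\hat r})}.$$ Then for each $1\le i\le\hat r$, as $n,m\to\infty$ with $n/m\to c$, $$\hat w^{\rm opt}_{i,\hat r}\to-2\,\frac{D_{\mu_X}(\rho_i)}{D'_{\mu_X}(\rho_i)}\quad\text{almost surely},\qquad \rho_i=D^{-1}_{\mu_X}(1/\theta_i^2).$$
   Context: Standing setup. Let $\mathbb{K}\in\{\mathbb{R},\mathbb{C}\}$ and $^H$ denote conjugate transpose. For each $n$ let $m=m(n)\ge n$ with $n/m\to c$ as $n\to\infty$. Let $X_n$ be an $n\times m$ random matrix over $\mathbb{K}$ with singular values $\sigma_1(X_n)\ge\cdots\ge\sigma_n(X_n)$, and assume its empirical singular value distribution $\mu_{X_n}=\frac1n\sum_{i=1}^n\delta_{\sigma_i(X_n)}$ converges almost surely weakly to a deterministic compactly supported probability measure $\mu_X$ supported on $[a,b]$ (with $b$ the right endpoint of the support), and that $\sigma_1(X_n)\to b$ almost surely. Assume $X_n$ is bi-unitarily (resp. bi-orthogonally) invariant: its distribution is invariant under multiplication on the left and on the right by unitary (resp. orthogonal) matrices. Fix $r\ge1$ and deterministic reals $\theta_1>\cdots>\theta_r>0$ independent of $n$; let $S_n=\sum_{i=1}^r\theta_iu_iv_i^H$ be a deterministic $n\times m$ matrix with $u_1,\dots,u_r$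 orthonormal in $\mathbb{K}^n$ and $v_1,\dots,v_r$ orthonormal in $\mathbb{K}^m$, with $X_n$ independent of $S_n$. Observe $\widetilde X_n=S_n+X_n$, with SVD $\widetilde X_n=\sum_{i=1}^{q}\hat\sigma_i\hat u_i\hat v_i^H$, $q=\min(n,m)$, $\hat\sigma_1\ge\hat\sigma_2\ge\cdots$. For a probability measure $\mu$ let $\phi_\mu(z)=\int\frac{z}{z^2-t^2}\,d\mu(t)$. The $D$-transform of $\mu_X$ is $D_{\mu_X}(z)=\phi_{\mu_X}(z)\cdot\big[c\,\phi_{\mu_X}(z)+\frac{1-c}{z}\big]$ for $z>b$; $D_{\mu_X}(b^+)=\lim_{z\downarrow b}D_{\mu_X}(z)$, $D'_{\mu_X}$ is its derivative, and $D^{-1}_{\mu_X}$ is its functional inverse on $(b,\infty)$. The effective rank $r_{\rm eff}$ is the number of $i\in\{1,\dots,r\}$ with $\theta_i^2>1/D_{\mu_X}(b^+)$. Let $\widehat\Sigma_{\hat r}$ be the $(n-\hat r)\times(m-\hat r)$ rectangular diagonal matrix with diagonal entries $\hat\sigma_{\hat r+1},\dots,\hat\sigma_q$. For an $N\times M$ matrix $Y$ and real $z$ with $z^2$ not an eigenvalue of $YY^H$, define $\widehat D(z;Y)=\frac1N\mathrm{Tr}\big(z(z^2I-YY^H)^{-1}\big)\cdot\frac1M\mathrm{Tr}\big(z(z^2I-Y^HY)^{-1}\big)$ and $\widehat D'(z;Y)=\frac1N\mathrm{Tr}\big[z(z^2I-YY^H)^{-1}\big]\cdot\frac1M\mathrm{Tr}\big[-2z^2(z^2I-Y^HY)^{-2}+(z^2I-Y^HY)^{-1}\big]+\frac1M\mathrm{Tr}\big[z(z^2I-Y^HY)^{-1}\big]\cdot\frac1N\mathrm{Tr}\big[-2z^2(z^2I-YY^H)^{-2}+(z^2I-YY^H)^{-1}\big]$.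 *)

theory Defs
  imports "HOL-Probability.Probability" "Jordan_Normal_Form.Gauss_Jordan_Elimination"
    "Jordan_Normal_Form.Char_Poly"
begin

section \<open>Matrices over K (K = R or C), represented as complex matrices\<close>

definition adj :: "complex mat \<Rightarrow> complex mat" where
  "adj A = mat (dim_col A) (dim_row A) (\<lambda>(i,j). cnj (A $$ (j,i)))"

definition tr :: "complex mat \<Rightarrow> complex" where
  "tr A = (\<Sum>i<dim_row A. A $$ (i,i))"

(* matrix inverse (only meaningful for invertible square matrices) *)
definition minv :: "complex mat \<Rightarrow> complex mat" where
  "minv A = (case mat_inverse A of Some B \<Rightarrow> B | None \<Rightarrow> 0\<^sub>m (dim_row A) (dim_row A))"

(* entries of a matrix lie in K: realK = True means K = R, False means K = C *)
definition K_mat :: "bool \<Rightarrow> complex mat \<Rightarrow> bool" where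
  "K_mat realK A = (realK \<longrightarrow> (\<forall>i<dim_row A. \<forall>j<dim_col A. Im (A $$ (i,j)) = 0))"

definition K_vec :: "bool \<Rightarrow> complex vec \<Rightarrow> bool" where
  "K_vec realK x = (realK \<longrightarrow> (\<forall>i<dim_vec x. Im (x $ i) = 0))"

definition K_unitary :: "bool \<Rightarrow> nat \<Rightarrow> complex mat \<Rightarrow> bool" where
  "K_unitary realK k U = (U \<in> carrier_mat k k \<and> K_mat realK U \<and> U * adj U = 1\<^sub>m k)"

definition eig_mset :: "complex mat \<Rightarrow> complex multiset" where
  "eig_mset A = (THE E. char_poly A = (\<Prod>z\<in>#E. [:-z, 1:]))"

(* singular values of an N x M matrix A with N \<le> M, in non-increasing order:
   square roots of the eigenvalues of A A^H; the list has length N = min(N,M) *)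
definition sing_vals :: "complex mat \<Rightarrow> real list" where
  "sing_vals A = rev (sorted_list_of_multiset (image_mset (\<lambda>z. sqrt (Re z)) (eig_mset (A * adj A))))"

definition sval :: "complex mat \<Rightarrow> nat \<Rightarrow> real" where
  "sval A i = sing_vals A ! (i - 1)"

definition trunc_Sigma :: "complex mat \<Rightarrow> nat \<Rightarrow> complex mat" where
  "trunc_Sigma A k = mat (dim_row A - k) (dim_col A - k)
     (\<lambda>(i,j). if i = j then complex_of_real (sval A (k + 1 + i)) else 0)"

definition Dhat :: "real \<Rightarrow> complex mat \<Rightarrow> complex" where
  "Dhat z Y = (let N = dim_row Y; M = dim_col Y; w = complex_of_real z in
     (1 / of_nat N) * tr (w \<cdot>\<^sub>m minv ((w^2) \<cdot>\<^sub>m 1\<^sub>m N - Y * adj Y)) *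
     ((1 / of_nat M) * tr (w \<cdot>\<^sub>m minv ((w^2) \<cdot>\<^sub>m 1\<^sub>m M - adj Y * Y))))"

definition Dhat' :: "real \<Rightarrow> complex mat \<Rightarrow> complex" where
  "Dhat' z Y = (let N = dim_row Y; M = dim_col Y; w = complex_of_real z;
       RN = minv ((w^2) \<cdot>\<^sub>m 1\<^sub>m N - Y * adj Y);
       RM = minv ((w^2) \<cdot>\<^sub>m 1\<^sub>m M - adj Y * Y) in
     (1 / of_nat N) * tr (w \<cdot>\<^sub>m RN) *
       ((1 / of_nat M) * tr ((- 2 * w^2) \<cdot>\<^sub>m (RM * RM) + RM))
   + (1 / of_nat M) * tr (w \<cdot>\<^sub>m RM) *
       ((1 / of_nat N) * tr ((- 2 * w^2) \<cdot>\<^sub>m (RN * RN) + RN)))"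

definition w_opt_hat :: "complex mat \<Rightarrow> nat \<Rightarrow> nat \<Rightarrow> complex" where
  "w_opt_hat Xt rh i = - 2 * Dhat (sval Xt i) (trunc_Sigma Xt rh) / Dhat' (sval Xt i) (trunc_Sigma Xt rh)"

definition phi_tr :: "real measure \<Rightarrow> real \<Rightarrow> real" where
  "phi_tr mu z = (\<integral>t. z / (z^2 - t^2) \<partial>mu)"

definition D_tr :: "real \<Rightarrow> real measure \<Rightarrow> real \<Rightarrow> real" where
  "D_tr c mu z = phi_tr mu z * (c * phi_tr mu z + (1 - c) / z)"

(* D(b^+), as an extended real (it may be +infinity) *)
definition D_bplus :: "real \<Rightarrow> real measure \<Rightarrow> real \<Rightarrow> ereal" where
  "D_bplus c mu b = Lim (at_right b) (\<lambda>z. ereal (D_tr c mu z))"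

(* effective rank: number of i with theta_i^2 > 1 / D(b^+)  (with 1/\<infinity> = 0) *)
definition r_eff :: "real \<Rightarrow> real measure \<Rightarrow> real \<Rightarrow> nat \<Rightarrow> (nat \<Rightarrow> real) \<Rightarrow> nat" where
  "r_eff c mu b r \<theta> = card {i \<in> {1..r}. ereal ((\<theta> i)^2) > inverse (D_bplus c mu b)}"

definition signal :: "nat \<Rightarrow> nat \<Rightarrow> nat \<Rightarrow> (nat \<Rightarrow> real) \<Rightarrow> (nat \<Rightarrow> complex vec) \<Rightarrow> (nat \<Rightarrow> complex vec) \<Rightarrow> complex mat" where
  "signal n m r \<theta> u v = mat n m (\<lambda>(k,l). \<Sum>i\<in>{1..r}. complex_of_real (\<theta> i) * (u i $ k) * cnj (v i $ l))"

(* the entries of an n x m matrix, as an element of the product space used for distributions *)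
definition entries :: "nat \<Rightarrow> nat \<Rightarrow> complex mat \<Rightarrow> (nat \<times> nat \<Rightarrow> complex)" where
  "entries n m A = (\<lambda>p \<in> {..<n} \<times> {..<m}. A $$ p)"

definition mat_space :: "nat \<Rightarrow> nat \<Rightarrow> (nat \<times> nat \<Rightarrow> complex) measure" where
  "mat_space n m = PiM ({..<n} \<times> {..<m}) (\<lambda>_. borel)"

end

theory Submission
  imports Defs "HOL-Real_Asymp.Real_Asymp"
begin

text \<open>Write \<open>H\<close> for the Hermitian matrix with off-diagonal blocks \<open>X\<close> and \<open>X\<^sup>H\<close>, and \<open>w = (x, y)\<close> for a
  vector built from two \<open>K\<close>-vectors of fixed norms. Bi-unitary invariance allows \<open>x\<close> and \<open>y\<close> to be replaced by
  rescaled vectors of signs, for every choice of signs; averaging over all choices turns the deviation of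
  \<open>w\<^sup>H H\<^sup>p w\<close> from a combination of normalised traces into an off-diagonal quadratic form in random signs,
  whose fourth moment is \<open>O(1/n\<^sup>2)\<close>. Borel--Cantelli then gives almost sure convergence, and a Neumann
  expansion carries it over to the resolvent \<open>(z I - H)\<^sup>-\<^sup>1\<close> compressed to the singular vectors of the
  signal. The number of singular values of \<open>S + X\<close> beyond \<open>z > b\<close> is the negative index of a Hermitian form
  which is controlled by this \<open>2r \<times> 2r\<close> compression, and it tends to the number of \<open>i\<close> with
  \<open>\<theta>\<^sub>i\<^sup>2 D(z) > 1\<close>; so the \<open>i\<close>-th singular value tends to \<open>\<rho>\<^sub>i\<close> and the remaining ones are eventually below
  every \<open>z > b\<close>. Interlacing shows that these have the same limiting distribution as the singular
  values of \<open>X\<close>, which identifies the limits of the traces in the weights.\<close>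

text \<open>The obstacle is that X_n has neither a prescribed law nor moments: only invariance and
  two almost sure limits are available. Hence the truncation in \<open>dev4\<close>, which makes the
  fourth moment bound hold for each single matrix and is eventually inactive almost surely, and the
  use of fixed unitaries carrying the given vectors to sign vectors, so that all averages over
  directions are finite. Powers of H come before the resolvent because their entries are polynomials
  in the entries of X_n and conjugates, defined and measurable everywhere, whereas z I - H is known
  to be invertible only for n large depending on the sample point. The dilation treats
  \<open>u\<close> and \<open>v\<close> together: even powers carry A A^H and A^H A, odd ones the
  cross terms. Let \<phi> and \<psi> be the limits of the compressed resolvent on the u and v side,
  so D = \<phi> \<psi>. In the limit each spike contributes |p|^2/\<phi> + |q|^2/\<psi> - 2 \<theta>
  Re(conj(q) p) to the form of z I minus the dilation of S + X; this has a negative direction, and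
  then just one, exactly if \<theta>^2 D > 1. Bounding the number of such directions from both sides
  replaces a determinant equation for the outliers.\<close>

section \<open>Unitary diagonalisation and singular values\<close>

lemma adj_carrier [simp]: "A \<in> carrier_mat n k \<Longrightarrow> adj A \<in> carrier_mat k n"
  by (auto simp: adj_def)

lemma dim_adj [simp]: "dim_row (adj A) = dim_col A" "dim_col (adj A) = dim_row A"
  by (auto simp: adj_def)

lemma adj_index [simp]: "i < dim_col A \<Longrightarrow> j < dim_row A \<Longrightarrow> adj A $$ (i,j) = cnj (A $$ (j,i))"
  by (auto simp: adj_def)

lemma adj_adj [simp]: "adj (adj A) = A"
  by (rule eq_matI) auto

lemma mult_index:
  assumes "A \<in> carrier_mat n k" "B \<in> carrier_mat k l" "i < n" "j < l"
  shows "(A * B) $$ (i,j) = (\<Sum>p<k. A $$ (i,p) * B $$ (p,j))"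
  using assms by (auto simp: scalar_prod_def lessThan_atLeast0 intro!: sum.cong)

lemma mult_carrier_square: "A \<in> carrier_mat n n \<Longrightarrow> B \<in> carrier_mat n n \<Longrightarrow> A * B \<in> carrier_mat n n"
  by simp

lemma assoc_square:
  "A \<in> carrier_mat n n \<Longrightarrow> B \<in> carrier_mat n n \<Longrightarrow> C \<in> carrier_mat n n \<Longrightarrow> A * B * C = A * (B * C)"
  by (rule assoc_mult_mat)

lemma adj_mult:
  assumes A: "A \<in> carrier_mat n k" and B: "B \<in> carrier_mat k l"
  shows "adj (A * B) = adj B * adj A"
proof (rule eq_matI)
  fix i j assume "i < dim_row (adj B * adj A)" "j < dim_col (adj B * adj A)"
  then have ij: "i < l" "j < n" using A B by auto
  have "adj (A * B) $$ (i,j) = cnj ((A * B) $$ (j,i))"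
    using A B ij by auto
  also have "\<dots> = (\<Sum>p<k. cnj (A $$ (j,p)) * cnj (B $$ (p,i)))"
    by (simp add: mult_index[OF A B ij(2,1)])
  also have "\<dots> = (\<Sum>p<k. adj B $$ (i,p) * adj A $$ (p,j))"
    using A B ij by (auto intro!: sum.cong simp: mult.commute)
  also have "\<dots> = (adj B * adj A) $$ (i,j)"
    using mult_index[OF adj_carrier[OF B] adj_carrier[OF A] ij] by simp
  finally show "adj (A * B) $$ (i,j) = (adj B * adj A) $$ (i,j)" .
qed (use A B in auto)

lemma adj_one [simp]: "adj (1\<^sub>m n) = 1\<^sub>m n"
  by (rule eq_matI) auto

lemma unitary_left:
  assumes "U \<in> carrier_mat n n" "U * adj U = 1\<^sub>m n"
  shows "adj U * U = 1\<^sub>m n"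
  using mat_mult_left_right_inverse[OF assms(1) adj_carrier[OF assms(1)] assms(2)] .

text \<open>Vectors are functions on the naturals with the dimension passed separately, so values
  beyond the dimension are irrelevant and no carrier conditions arise.\<close>

definition nsq :: "nat \<Rightarrow> (nat \<Rightarrow> complex) \<Rightarrow> real" where
  "nsq n x = (\<Sum>i<n. (cmod (x i))\<^sup>2)"

lemma nsq_nonneg [simp]: "0 \<le> nsq n x"
  by (auto simp: nsq_def intro!: sum_nonneg)

lemma nsq_eq_0: "nsq n x = 0 \<longleftrightarrow> (\<forall>i<n. x i = 0)"
  by (auto simp: nsq_def sum_nonneg_eq_0_iff)

lemma of_real_nsq: "complex_of_real (nsq n x) = (\<Sum>i<n. cnj (x i) * x i)"
  by (simp add: nsq_def complex_norm_square mult.commute[of "cnj _"] del: of_real_power)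

text \<open>The generalised Householder reflection \<open>I - p p\<^sup>H / (p\<^sup>H w)\<close> with \<open>p = w - u\<close> is unitary even
  when \<open>u\<^sup>H w\<close> is not real; if \<open>p = 0\<close>, division by zero makes it the identity.\<close>

lemma householder:
  assumes eq: "nsq n u = nsq n w"
  shows "\<exists>U \<in> carrier_mat n n. U * adj U = 1\<^sub>m n \<and> (\<forall>i<n. (\<Sum>j<n. U $$ (i,j) * w j) = u i)
     \<and> ((\<forall>i<n. Im (u i) = 0 \<and> Im (w i) = 0) \<longrightarrow> (\<forall>i<n. \<forall>j<n. Im (U $$ (i,j)) = 0))"
proof -
  define p where "p i = w i - u i" for i
  define s where "s = (\<Sum>j<n. cnj (p j) * w j)"
  define d :: "nat \<Rightarrow> nat \<Rightarrow> complex" where "d i j = (if i = j then 1 else 0)" for i j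
  define U where "U = mat n n (\<lambda>(i,j). d i j - p i * cnj (p j) / s)"
  have U: "U \<in> carrier_mat n n" by (simp add: U_def)
  \<comment> \<open>Equal norms give p^H p = 2 Re s, hence p^H p / |s|^2 = 1/s + 1/cnj s; this
    cancels the linear terms in \<open>U * adj U\<close>.\<close>
  have pp: "(\<Sum>j<n. cnj (p j) * p j) = s + cnj s"
  proof -
    have "(\<Sum>j<n. cnj (p j) * p j) = s - (\<Sum>j<n. cnj (p j) * u j)"
      by (simp add: s_def p_def algebra_simps flip: sum_subtractf)
    also have "(\<Sum>j<n. cnj (p j) * u j) = (\<Sum>j<n. cnj (w j) * u j) - (\<Sum>j<n. cnj (u j) * u j)"
      by (simp add: p_def algebra_simps flip: sum_subtractf)
    also have "(\<Sum>j<n. cnj (u j) * u j) = (\<Sum>j<n. cnj (w j) * w j)"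
      using eq by (metis of_real_nsq)
    also have "(\<Sum>j<n. cnj (w j) * u j) - (\<Sum>j<n. cnj (w j) * w j) = - cnj s"
      by (simp add: s_def p_def algebra_simps flip: sum_subtractf sum_negf)
    finally show ?thesis by simp
  qed
  have p0: "p i = 0" if "s = 0" "i < n" for i
  proof -
    have "complex_of_real (nsq n p) = 0" using pp that by (simp add: of_real_nsq)
    then show ?thesis using that nsq_eq_0[of n p] by simp
  qed
  have dsum: "(\<Sum>k<n. d i k * f k) = f i" "(\<Sum>k<n. f k * d k i) = f i" 
       "(\<Sum>k<n. f k * d i k) = f i" if "i < n" for i and f :: "nat \<Rightarrow> complex"
    using that by (auto simp: d_def if_distrib if_distribR sum.delta cong: if_cong)
  have ev: "(\<Sum>j<n. U $$ (i,j) * w j) = u i" if i: "i < n" for i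
  proof -
    have "(\<Sum>j<n. U $$ (i,j) * w j) = (\<Sum>j<n. d i j * w j) - p i / s * (\<Sum>j<n. cnj (p j) * w j)"
      using i by (simp add: U_def sum_distrib_left algebra_simps flip: sum_subtractf)
    also have "\<dots> = w i - p i / s * s" by (simp add: dsum[OF i] s_def)
    also have "\<dots> = u i" using p0[OF _ i] by (cases "s = 0") (auto simp: p_def)
    finally show ?thesis .
  qed
  have un: "U * adj U = 1\<^sub>m n"
  proof (rule eq_matI)
    fix i j assume "i < dim_row (1\<^sub>m n)" "j < dim_col (1\<^sub>m n)"
    then have i: "i < n" and j: "j < n" by auto
    have "(U * adj U) $$ (i,j) = (\<Sum>k<n. (d i k - p i * cnj (p k) / s) * (d j k - cnj (p j) * p k / cnj s))"
      unfolding mult_index[OF U adj_carrier[OF U] i j] using U i j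
      by (intro sum.cong) (auto simp: U_def d_def)
    also have "\<dots> = (\<Sum>k<n. d i k * d j k) - (\<Sum>k<n. d i k * (cnj (p j) * p k / cnj s)) 
        - (\<Sum>k<n. d j k * (p i * cnj (p k) / s)) + p i * cnj (p j) / (s * cnj s) * (\<Sum>k<n. cnj (p k) * p k)"
      by (simp add: sum_distrib_left sum_divide_distrib algebra_simps flip: sum_subtractf sum.distrib)
    also have "\<dots> = d j i - cnj (p j) * p i / cnj s - p i * cnj (p j) / s + p i * cnj (p j) / (s * cnj s) * (s + cnj s)"
      by (simp only: dsum[OF i] dsum[OF j] pp)
    also have "\<dots> = d j i"
      by (cases "s = 0") (auto simp: field_simps)
    finally show "(U * adj U) $$ (i,j) = 1\<^sub>m n $$ (i,j)" using i j by (auto simp: d_def)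
  qed (use U in auto)
  have re: "Im (U $$ (i,j)) = 0" if h: "\<forall>i<n. Im (u i) = 0 \<and> Im (w i) = 0" and i: "i < n" and j: "j < n" for i j
  proof -
    have "p k \<in> \<real>" if "k < n" for k using h that by (auto simp: p_def complex_is_Real_iff)
    moreover have "w k \<in> \<real>" if "k < n" for k using h that by (auto simp: complex_is_Real_iff)
    ultimately have "s \<in> \<real>" "p i \<in> \<real>" "p j \<in> \<real>" using i j
      unfolding s_def by (auto intro!: sum_in_Reals Reals_mult simp: Reals_cnj_iff)
    then have "d i j - p i * cnj (p j) / s \<in> \<real>"
      by (auto simp: d_def Reals_cnj_iff intro!: Reals_diff Reals_divide Reals_mult)
    then show ?thesis using i j by (simp add: U_def complex_is_Real_iff)
  qed
  show ?thesis using U un ev re by blast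
qed

definition diagm :: "nat \<Rightarrow> (nat \<Rightarrow> complex) \<Rightarrow> complex mat" where
  "diagm n f = mat n n (\<lambda>(i,j). if i = j then f i else 0)"

lemma diagm_carrier [simp]: "diagm n f \<in> carrier_mat n n"
  by (simp add: diagm_def)

lemma block_diag_mult:
  assumes "A \<in> carrier_mat n n" "B \<in> carrier_mat n n" "C \<in> carrier_mat k k" "D \<in> carrier_mat k k"
  shows "four_block_mat A (0\<^sub>m n k) (0\<^sub>m k n) C * four_block_mat B (0\<^sub>m n k) (0\<^sub>m k n) D
    = four_block_mat (A * B) (0\<^sub>m n k) (0\<^sub>m k n) (C * (D :: 'a :: comm_ring_1 mat))"
proof -
  note z = left_mult_zero_mat[OF assms(2), of k] left_mult_zero_mat[OF assms(4), of n]
    right_mult_zero_mat[OF assms(1), of k] right_mult_zero_mat[OF assms(3), of n]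
  show ?thesis
    by (subst mult_four_block_mat[OF assms(1) _ _ assms(3) assms(2) _ _ assms(4)])
       (use assms in \<open>simp_all add: z right_add_zero_mat left_add_zero_mat\<close>)
qed

lemma conj_unitary_assoc:
  assumes U: "U \<in> carrier_mat n n" and V: "V \<in> carrier_mat n n" and D: "D \<in> carrier_mat n n"
  shows "(U * V) * D * adj (U * V) = U * (V * D * adj V) * adj U"
proof -
  have c: "adj U \<in> carrier_mat n n" "adj V \<in> carrier_mat n n" using U V by auto
  note [simp] = assoc_square[where n=n] mult_carrier_square[where n=n]
  show ?thesis using U V D c by (simp add: adj_mult[OF U V])
qed

text \<open>Deflation: a reflection whose first column is an eigenvector for the first listed
  eigenvalue splits off a 1 x 1 block, and the remaining factors form the characteristic polynomial
  of the rest. The order of \<open>es\<close> is arbitrary, which later allows a diagonalisation in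
  sorted order.\<close>

lemma hermitian_spectral:
  assumes "A \<in> carrier_mat n n" "adj A = A" "char_poly A = (\<Prod>x\<leftarrow>es. [:-x, 1:])"
  shows "\<exists>U \<in> carrier_mat n n. U * adj U = 1\<^sub>m n \<and> A = U * diagm n ((!) es) * adj U"
  using assms
proof (induction n arbitrary: A es)
  case 0
  show ?case by (rule bexI[of _ "1\<^sub>m 0"]) (use 0 in auto)
next
  case (Suc n)
  note A = Suc.prems(1) and H = Suc.prems(2) and cp = Suc.prems(3)
  have len: "length es = Suc n"
    using degree_monic_char_poly[OF A] degree_linear_factors[of uminus es] cp by simp
  then obtain e es' where es: "es = e # es'" by (cases es) auto
  have "poly (char_poly A) e = 0" by (simp add: cp es)
  then have "eigenvalue A e" using eigenvalue_root_char_poly[OF A] by simp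
  then obtain vv where vv: "eigenvector A vv e" by (auto simp: eigenvalue_def)
  define x where "x = vec_index vv"
  have xdim: "dim_vec vv = Suc n" and x0: "vv \<noteq> 0\<^sub>v (Suc n)" and xe: "A *\<^sub>v vv = e \<cdot>\<^sub>v vv"
    using vv A by (auto simp: eigenvector_def)
  have xev: "(\<Sum>j<Suc n. A $$ (i,j) * x j) = e * x i" if i: "i < Suc n" for i
  proof -
    have "vec_index (A *\<^sub>v vv) i = e * x i" using xe i xdim by (simp add: x_def)
    moreover have "vec_index (A *\<^sub>v vv) i = (\<Sum>j<Suc n. A $$ (i,j) * x j)" using i xdim A
      by (auto simp: scalar_prod_def x_def lessThan_atLeast0 simp del: sum.op_ivl_Suc intro!: sum.cong)
    ultimately show ?thesis by simp
  qed
  have "\<exists>i<Suc n. x i \<noteq> 0" using x0 xdim by (metis x_def eq_vecI index_zero_vec carrier_vecI dim_vec carrier_vecD)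
  then have npos: "nsq (Suc n) x \<noteq> 0" by (auto simp: nsq_eq_0)
  define t where "t = sqrt (nsq (Suc n) x)"
  have t: "t > 0" using npos by (simp add: t_def less_le)
  \<comment> \<open>The first basis vector scaled to the norm of the eigenvector, so that the first
    column of the reflection is the normalised eigenvector.\<close>
  define w :: "nat \<Rightarrow> complex" where "w i = (if i = 0 then of_real t else 0)" for i
  have "nsq (Suc n) w = t\<^sup>2"
    by (simp add: nsq_def w_def if_distrib lessThan_Suc_eq_insert_0 sum.reindex)
  then have "nsq (Suc n) x = nsq (Suc n) w" by (simp add: t_def)
  then obtain U where U: "U \<in> carrier_mat (Suc n) (Suc n)" and UU: "U * adj U = 1\<^sub>m (Suc n)"
    and Uw: "\<And>i. i < Suc n \<Longrightarrow> (\<Sum>j<Suc n. U $$ (i,j) * w j) = x i"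
    using householder by blast
  have Ux: "x i = t * U $$ (i,0)" if "i < Suc n" for i
    using Uw[OF that] by (simp add: w_def mult.commute sum.lessThan_Suc_shift del: sum.lessThan_Suc)
  have Uev: "(\<Sum>j<Suc n. A $$ (i,j) * U $$ (j,0)) = e * U $$ (i,0)" if i: "i < Suc n" for i
  proof -
    have "of_real t * (\<Sum>j<Suc n. A $$ (i,j) * U $$ (j,0)) = (\<Sum>j<Suc n. A $$ (i,j) * x j)"
      unfolding sum_distrib_left using Ux by (intro sum.cong) auto
    also have "\<dots> = of_real t * (e * U $$ (i,0))" using xev[OF i] Ux[OF i] by simp
    finally show ?thesis using t by simp
  qed
  have UU': "adj U * U = 1\<^sub>m (Suc n)" using unitary_left[OF U UU] .
  have aU: "adj U \<in> carrier_mat (Suc n) (Suc n)" using U by simp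
  note [simp] = assoc_square[where n="Suc n"] mult_carrier_square[where n="Suc n"]
  define B where "B = adj U * (A * U)"
  have AU: "A * U \<in> carrier_mat (Suc n) (Suc n)" using A U by simp
  have B: "B \<in> carrier_mat (Suc n) (Suc n)" using A U by (simp add: B_def)
  have BH: "adj B = B"
    using U A aU by (simp add: B_def adj_mult[OF aU AU] adj_mult[OF A U] H)
  have AUB: "A = U * B * adj U"
  proof -
    have "U * B * adj U = (U * adj U) * A * (U * adj U)" using U A aU by (simp add: B_def)
    then show ?thesis using A by (simp add: UU)
  qed
  have B0: "B $$ (i,0) = (if i = 0 then e else 0)" if i: "i < Suc n" for i
  proof -
    have "B $$ (i,0) = (\<Sum>k<Suc n. adj U $$ (i,k) * (A * U) $$ (k,0))"
      unfolding B_def by (rule mult_index[OF aU AU i]) simp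
    also have "\<dots> = (\<Sum>k<Suc n. adj U $$ (i,k) * (e * U $$ (k,0)))"
    proof (intro sum.cong refl)
      fix k assume "k \<in> {..<Suc n}"
      then have k: "k < Suc n" by simp
      have "(A * U) $$ (k,0) = e * U $$ (k,0)"
        using mult_index[OF A U k, of 0] Uev[OF k] by simp
      then show "adj U $$ (i,k) * (A * U) $$ (k,0) = adj U $$ (i,k) * (e * U $$ (k,0))" by simp
    qed
    also have "\<dots> = e * (\<Sum>k<Suc n. adj U $$ (i,k) * U $$ (k,0))"
      by (simp only: sum_distrib_left mult_ac)
    also have "(\<Sum>k<Suc n. adj U $$ (i,k) * U $$ (k,0)) = (1\<^sub>m (Suc n)) $$ (i,0)"
      unfolding UU'[symmetric] by (rule mult_index[OF aU U i, symmetric]) simp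
    finally show ?thesis using i by simp
  qed
  \<comment> \<open>Hermitian symmetry transfers the zeros of the first column to the first row and
    makes \<open>e\<close> real.\<close>
  have B0': "B $$ (0,i) = (if i = 0 then e else 0)" if i: "i < Suc n" for i
  proof -
    have "B $$ (0,i) = cnj (B $$ (i,0))" using BH B i by (metis adj_index carrier_matD zero_less_Suc)
    moreover have "cnj e = e" using B0[of 0] BH B by (metis adj_index carrier_matD zero_less_Suc)
    ultimately show ?thesis using B0[OF i] by auto
  qed
  define C where "C = mat n n (\<lambda>(i,j). B $$ (Suc i, Suc j))"
  have C: "C \<in> carrier_mat n n" by (simp add: C_def)
  have CH: "adj C = C"
  proof (rule eq_matI)
    fix i j assume "i < dim_row C" "j < dim_col C"
    then have "i < n" "j < n" using C by auto
    then show "adj C $$ (i,j) = C $$ (i,j)" 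
      using arg_cong[OF BH, of "\<lambda>M. M $$ (Suc i, Suc j)"] B by (auto simp: C_def)
  qed (use C in auto)
  have Bf: "B = four_block_mat (mat 1 1 (\<lambda>_. e)) (0\<^sub>m 1 n) (0\<^sub>m n 1) C"
    by (rule eq_matI) (use B B0 B0' in \<open>auto simp: C_def\<close>)
  have "similar_mat A B" unfolding similar_mat_def similar_mat_wit_def
    using A U aU B AUB UU UU' by (intro exI[of _ U] exI[of _ "adj U"]) (simp add: Let_def)
  then have "char_poly A = char_poly B" by (rule char_poly_similar)
  also have "\<dots> = char_poly (mat 1 1 (\<lambda>_. e)) * char_poly C"
    unfolding Bf by (rule char_poly_four_block_zeros_col) (use C in auto)
  also have "char_poly (mat 1 1 (\<lambda>_. e)) = [:-e, 1:]"
    by (subst char_poly_upper_triangular[of _ 1]) (auto simp: diag_mat_def)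
  finally have "[:-e, 1:] * char_poly C = [:-e, 1:] * (\<Prod>x\<leftarrow>es'. [:-x, 1:])"
    using cp by (simp add: es del: mult_pCons_left)
  then have "char_poly C = (\<Prod>x\<leftarrow>es'. [:-x, 1:])"
    by (subst (asm) mult_cancel_left) auto
  from Suc.IH[OF C CH this] obtain V where V: "V \<in> carrier_mat n n" and VV: "V * adj V = 1\<^sub>m n"
    and CV: "C = V * diagm n ((!) es') * adj V" by blast
  define W where "W = four_block_mat (1\<^sub>m 1) (0\<^sub>m 1 n) (0\<^sub>m n 1) V"
  have W: "W \<in> carrier_mat (Suc n) (Suc n)" using V by (auto simp: W_def)
  have aW: "adj W = four_block_mat (1\<^sub>m 1) (0\<^sub>m 1 n) (0\<^sub>m n 1) (adj V)"
    by (rule eq_matI) (use V in \<open>auto simp: W_def\<close>)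
  have aV: "adj V \<in> carrier_mat n n" using V by simp
  have WW: "W * adj W = 1\<^sub>m (Suc n)"
    unfolding aW unfolding W_def
    by (subst mult_four_block_mat[where ?nr1.0=1 and ?n1.0=1 and ?n2.0=n and ?nr2.0=n and ?nc1.0=1 and ?nc2.0=n])
       (use V aV VV in \<open>auto intro!: eq_matI\<close>)
  have D: "diagm (Suc n) ((!) es) = four_block_mat (mat 1 1 (\<lambda>_. e)) (0\<^sub>m 1 n) (0\<^sub>m n 1) (diagm n ((!) es'))"
    by (rule eq_matI) (auto simp: diagm_def es nth_Cons')
  have WDW: "W * diagm (Suc n) ((!) es) * adj W = B"
  proof -
    have "W * diagm (Suc n) ((!) es) = four_block_mat (mat 1 1 (\<lambda>_. e)) (0\<^sub>m 1 n) (0\<^sub>m n 1) (V * diagm n ((!) es'))"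
      unfolding W_def D by (subst block_diag_mult[where n=1 and k=n]) (use V in auto)
    also have "\<dots> * adj W = B" unfolding aW Bf CV
      by (subst block_diag_mult[where n=1 and k=n]) (use V aV in auto)
    finally show ?thesis .
  qed
  have UW: "U * W \<in> carrier_mat (Suc n) (Suc n)" using U W by simp
  show ?case
  proof (intro bexI conjI)
    show "(U * W) * adj (U * W) = 1\<^sub>m (Suc n)"
    proof -
      have "(U * W) * adj (U * W) = U * (W * adj W) * adj U"
        using U W by (simp add: adj_mult[OF U W])
      then show ?thesis using U by (simp add: WW UU)
    qed
    show "A = (U * W) * diagm (Suc n) ((!) es) * adj (U * W)"
      using conj_unitary_assoc[OF U W diagm_carrier] WDW AUB by simp
  qed (rule UW)
qed

text \<open>Uniqueness for the \<open>THE\<close> in \<open>eig_mset\<close>: \<open>proots\<close>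
  recovers the multiset from the product.\<close>

lemma prod_linear_inj:
  fixes E F :: "complex multiset"
  assumes "(\<Prod>z\<in>#E. [:-z, 1:]) = (\<Prod>z\<in>#F. [:-z, 1:])"
  shows "E = F"
proof -
  have "proots (\<Prod>z\<in>#E. [:-z, 1:]) = E \<and> (\<Prod>z\<in>#E. [:-z, 1:]) \<noteq> 0" for E :: "complex multiset"
  proof (induction E)
    case (add x E)
    then show ?case using proots_mult[of "[:-x, 1:]" "\<Prod>z\<in>#E. [:-z, 1:]"] by (simp del: mult_pCons_left)
  qed auto
  then show ?thesis using assms by metis
qed

lemma eig_mset_eqI:
  assumes "char_poly A = (\<Prod>x\<leftarrow>es. [:-x, 1:])"
  shows "eig_mset A = mset es"
proof -
  have "char_poly A = (\<Prod>z\<in>#mset es. [:-z, 1:])"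
    using assms by (simp flip: prod_mset_prod_list mset_map)
  then show ?thesis unfolding eig_mset_def by (intro the_equality) (auto intro!: prod_linear_inj)
qed

text \<open>The eigenvalues are squared row norms of U^H A, hence nonnegative reals, so squaring the
  entries of the sorted list of square roots reproduces them. The spectral theorem is then applied a
  second time, with the factors in that sorted order.\<close>

lemma sing_vals_decomposition:
  assumes A: "A \<in> carrier_mat n k"
  shows "length (sing_vals A) = n" "\<And>i j. i \<le> j \<Longrightarrow> j < n \<Longrightarrow> sing_vals A ! j \<le> sing_vals A ! i"
    "\<And>i. i < n \<Longrightarrow> 0 \<le> sing_vals A ! i"
    "\<exists>U \<in> carrier_mat n n. U * adj U = 1\<^sub>m n \<and>
       A * adj A = U * diagm n (\<lambda>i. of_real ((sing_vals A ! i)\<^sup>2)) * adj U"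
proof -
  let ?P = "A * adj A"
  have aA: "adj A \<in> carrier_mat k n" using A by simp
  have P: "?P \<in> carrier_mat n n" using A by simp
  have H: "adj ?P = ?P" using adj_mult[OF A aA] by simp
  obtain as where as: "char_poly ?P = (\<Prod>x\<leftarrow>as. [:-x, 1:])" "length as = n"
    using char_poly_factorized[OF P] by blast
  obtain U where U: "U \<in> carrier_mat n n" "U * adj U = 1\<^sub>m n" "?P = U * diagm n ((!) as) * adj U"
    using hermitian_spectral[OF P H as(1)] by blast
  have asr: "\<exists>s\<ge>0. as ! i = of_real s" if i: "i < n" for i
  proof -
    have aU: "adj U \<in> carrier_mat n n" using U by simp
    have UU': "adj U * U = 1\<^sub>m n" using unitary_left[OF U(1,2)] .
    note [simp] = assoc_square[where n=n] mult_carrier_square[where n=n]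
    define V where "V = adj U * A"
    have V: "V \<in> carrier_mat n k" using A aU by (simp add: V_def)
    have "adj U * ?P * U = (adj U * U) * diagm n ((!) as) * (adj U * U)"
      unfolding U(3) using U(1) aU diagm_carrier by simp
    then have "diagm n ((!) as) = adj U * ?P * U" 
      by (simp add: UU' left_mult_one_mat[OF diagm_carrier] right_mult_one_mat[OF diagm_carrier])
    also have "\<dots> = adj U * (?P * U)" by (rule assoc_mult_mat[OF aU P U(1)])
    also have "?P * U = A * (adj A * U)" by (rule assoc_mult_mat[OF A aA U(1)])
    also have "adj U * (A * (adj A * U)) = V * (adj A * U)"
      unfolding V_def by (rule assoc_mult_mat[OF aU A mult_carrier_mat[OF aA U(1)], symmetric])
    also have "adj A * U = adj V" unfolding V_def adj_mult[OF aU A] by simp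
    finally have "diagm n ((!) as) $$ (i,i) = (V * adj V) $$ (i,i)" by simp
    then have "as ! i = (V * adj V) $$ (i,i)" using i by (simp add: diagm_def)
    also have "\<dots> = of_real (\<Sum>p<k. (cmod (V $$ (i,p)))\<^sup>2)"
      unfolding mult_index[OF V adj_carrier[OF V] i i] using V i
      by (auto simp: complex_norm_square simp del: of_real_power intro!: sum.cong)
    finally show ?thesis by (intro exI[of _ "\<Sum>p<k. (cmod (V $$ (i,p)))\<^sup>2"] conjI sum_nonneg) simp_all
  qed
  have asr': "0 \<le> Re z \<and> z = of_real (Re z)" if z: "z \<in> set as" for z
  proof -
    obtain i where "i < n" "z = as ! i" using z by (auto simp: in_set_conv_nth as(2))
    then show ?thesis using asr by force
  qed
  have es: "eig_mset ?P = mset as" using eig_mset_eqI[OF as(1)] .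
  define L where "L = sing_vals A"
  have Lm: "mset L = image_mset (\<lambda>z. sqrt (Re z)) (mset as)"
    by (simp add: L_def sing_vals_def es)
  have len: "length L = n" using arg_cong[OF Lm, of size] as(2) by simp
  then show "length (sing_vals A) = n" by (simp add: L_def)
  have "sorted (rev L)" by (simp add: L_def sing_vals_def)
  then show mono: "sing_vals A ! j \<le> sing_vals A ! i" if "i \<le> j" "j < n" for i j
    using that len by (auto simp: sorted_rev_nth_mono L_def)
  show nn: "0 \<le> sing_vals A ! i" if "i < n" for i
  proof -
    have "sing_vals A ! i \<in># mset L" using that len by (simp add: L_def)
    then obtain z where "z \<in> set as" "sing_vals A ! i = sqrt (Re z)" unfolding Lm by auto
    then show ?thesis using asr' by auto
  qed
  define es where "es = map (\<lambda>s. complex_of_real (s\<^sup>2)) L"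
  have "mset es = image_mset (\<lambda>z. complex_of_real ((sqrt (Re z))\<^sup>2)) (mset as)"
    by (simp add: es_def Lm image_mset.compositionality comp_def)
  also have "\<dots> = image_mset (\<lambda>z. z) (mset as)"
    by (rule image_mset_cong) (use asr' in \<open>simp del: of_real_power\<close>)
  finally have me: "mset es = mset as" by simp
  have "char_poly ?P = (\<Prod>x\<leftarrow>es. [:-x, 1:])"
    using as(1) me by (metis (no_types, lifting) mset_map prod_mset_prod_list)
  from hermitian_spectral[OF P H this] obtain V where V: "V \<in> carrier_mat n n" "V * adj V = 1\<^sub>m n"
    "?P = V * diagm n ((!) es) * adj V" by blast
  have "diagm n ((!) es) = diagm n (\<lambda>i. of_real ((sing_vals A ! i)\<^sup>2))"
    by (rule eq_matI) (use len in \<open>auto simp: diagm_def es_def L_def\<close>)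
  then show "\<exists>U \<in> carrier_mat n n. U * adj U = 1\<^sub>m n \<and>
       A * adj A = U * diagm n (\<lambda>i. of_real ((sing_vals A ! i)\<^sup>2)) * adj U" using V by auto
qed

section \<open>Variational bounds for singular values\<close>

text \<open>The vector A^H y. Its squared norm is the quadratic form of A A^H at y, through which
  all singular values are reached.\<close>

definition adj_app :: "nat \<Rightarrow> complex mat \<Rightarrow> (nat \<Rightarrow> complex) \<Rightarrow> nat \<Rightarrow> complex" where
  "adj_app n A y j = (\<Sum>i<n. cnj (A $$ (i,j)) * y i)"

text \<open>The norm of B^H y depends on B only through the Gram matrix of its rows. This allows A
  to be exchanged for an n x n matrix with the same A A^H, although the number of columns
  changes.\<close>

lemma nsq_gram:
  "complex_of_real (nsq k (\<lambda>j. \<Sum>i<n. cnj (B i j) * y i)) =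
     (\<Sum>i<n. \<Sum>i'<n. cnj (y i) * y i' * (\<Sum>j<k. B i j * cnj (B i' j)))"
proof -
  have "complex_of_real (nsq k (\<lambda>j. \<Sum>i<n. cnj (B i j) * y i)) =
     (\<Sum>j<k. \<Sum>i<n. \<Sum>i'<n. cnj (y i) * y i' * (B i j * cnj (B i' j)))"
    unfolding of_real_nsq cnj_sum sum_product by (intro sum.cong refl) (simp add: mult_ac)
  also have "\<dots> = (\<Sum>i<n. \<Sum>j<k. \<Sum>i'<n. cnj (y i) * y i' * (B i j * cnj (B i' j)))"
    by (rule sum.swap)
  also have "\<dots> = (\<Sum>i<n. \<Sum>i'<n. \<Sum>j<k. cnj (y i) * y i' * (B i j * cnj (B i' j)))"
    by (intro sum.cong refl sum.swap)
  finally show ?thesis by (simp add: sum_distrib_left)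
qed

text \<open>The columns of \<open>U\<close> are eigenvectors of A A^H. The last clause is U^H U = I
  and allows vectors with prescribed coordinates to be chosen.\<close>

lemma sing_vals_coords:
  assumes A: "A \<in> carrier_mat n k"
  shows "\<exists>U :: nat \<Rightarrow> nat \<Rightarrow> complex.
    (\<forall>y. nsq n y = nsq n (\<lambda>l. \<Sum>i<n. cnj (U i l) * y i)) \<and>
    (\<forall>y. nsq k (adj_app n A y) = (\<Sum>l<n. (sing_vals A ! l)\<^sup>2 * (cmod (\<Sum>i<n. cnj (U i l) * y i))\<^sup>2)) \<and>
    (\<forall>d l. l < n \<longrightarrow> (\<Sum>i<n. cnj (U i l) * (\<Sum>j<n. U i j * d j)) = d l)"
proof -
  obtain V where V: "V \<in> carrier_mat n n" and VV: "V * adj V = 1\<^sub>m n" and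
    AV: "A * adj A = V * diagm n (\<lambda>i. of_real ((sing_vals A ! i)\<^sup>2)) * adj V"
    using sing_vals_decomposition(4)[OF A] by blast
  note VV' = unitary_left[OF V VV]
  define U where "U i j = V $$ (i,j)" for i j
  define s where "s l = sing_vals A ! l" for l
  have g1: "(\<Sum>j<n. U i j * cnj (U i' j)) = (if i = i' then 1 else 0)" if "i < n" "i' < n" for i i'
    using mult_index[OF V adj_carrier[OF V] that] V that by (simp add: VV U_def)
  have g2: "(\<Sum>j<n. cnj (U j i) * U j i') = (if i = i' then 1 else 0)" if "i < n" "i' < n" for i i'
    using mult_index[OF adj_carrier[OF V] V that] V that by (simp add: VV' U_def)
  have g3: "(\<Sum>j<k. A $$ (i,j) * cnj (A $$ (i',j))) = (\<Sum>j<n. (U i j * s j) * cnj (U i' j * s j))" 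
    if i: "i < n" "i' < n" for i i'
  proof -
    have aA: "adj A \<in> carrier_mat k n" using A by simp
    have VD: "V * diagm n f \<in> carrier_mat n n" for f using V by simp
    have VDi: "(V * diagm n f) $$ (i,j) = U i j * f j" if "j < n" for f j
    proof -
      have "(V * diagm n f) $$ (i,j) = (\<Sum>p<n. if p = j then U i j * f j else 0)"
        unfolding mult_index[OF V diagm_carrier i(1) that]
        by (intro sum.cong) (use that in \<open>auto simp: diagm_def U_def\<close>)
      then show ?thesis using that by simp
    qed
    have "(\<Sum>j<k. A $$ (i,j) * cnj (A $$ (i',j))) = (A * adj A) $$ (i,i')"
      unfolding mult_index[OF A aA i] using A i by (intro sum.cong) auto
    also have "\<dots> = (\<Sum>j<n. (U i j * s j) * cnj (U i' j * s j))"
      unfolding AV mult_index[OF VD adj_carrier[OF V] i] using V i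
      by (intro sum.cong) (auto simp: VDi U_def s_def power2_eq_square)
    finally show ?thesis .
  qed
  show ?thesis
  proof (intro exI[of _ U] conjI allI impI)
    fix y
    have "complex_of_real (nsq n (\<lambda>l. \<Sum>i<n. cnj (U i l) * y i)) = 
       (\<Sum>i<n. \<Sum>i'<n. if i = i' then cnj (y i) * y i' else 0)"
      unfolding nsq_gram by (intro sum.cong refl) (simp add: g1)
    also have "\<dots> = complex_of_real (nsq n y)" by (simp add: of_real_nsq)
    finally show "nsq n y = nsq n (\<lambda>l. \<Sum>i<n. cnj (U i l) * y i)" by simp
    have "complex_of_real (nsq k (adj_app n A y)) = complex_of_real (nsq n (\<lambda>j. \<Sum>i<n. cnj (U i j * s j) * y i))"
      unfolding nsq_gram adj_app_def[abs_def] by (intro sum.cong refl) (simp add: g3)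
    then have "nsq k (adj_app n A y) = nsq n (\<lambda>j. \<Sum>i<n. cnj (U i j * s j) * y i)" by simp
    also have "\<dots> = (\<Sum>l<n. (sing_vals A ! l)\<^sup>2 * (cmod (\<Sum>i<n. cnj (U i l) * y i))\<^sup>2)"
      unfolding nsq_def
    proof (intro sum.cong refl)
      fix l
      have "(\<Sum>i<n. cnj (U i l * s l) * y i) = s l * (\<Sum>i<n. cnj (U i l) * y i)"
        by (simp add: sum_distrib_left mult_ac)
      then show "(cmod (\<Sum>i<n. cnj (U i l * s l) * y i))\<^sup>2 = (sing_vals A ! l)\<^sup>2 * (cmod (\<Sum>i<n. cnj (U i l) * y i))\<^sup>2"
        by (simp add: norm_mult power_mult_distrib s_def)
    qed
    finally show "nsq k (adj_app n A y) = (\<Sum>l<n. (sing_vals A ! l)\<^sup>2 * (cmod (\<Sum>i<n. cnj (U i l) * y i))\<^sup>2)" .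
  next
    fix d :: "nat \<Rightarrow> complex" and l assume l: "l < n"
    have "(\<Sum>i<n. cnj (U i l) * (\<Sum>j<n. U i j * d j)) = (\<Sum>j<n. \<Sum>i<n. cnj (U i l) * (U i j * d j))"
      unfolding sum_distrib_left by (rule sum.swap)
    also have "\<dots> = (\<Sum>j<n. (\<Sum>i<n. cnj (U i l) * U i j) * d j)"
      unfolding sum_distrib_right mult.assoc ..
    also have "\<dots> = (\<Sum>j<n. if l = j then d j else 0)"
      by (intro sum.cong refl) (use l in \<open>simp add: g2\<close>)
    also have "\<dots> = d l" using l by simp
    finally show "(\<Sum>i<n. cnj (U i l) * (\<Sum>j<n. U i j * d j)) = d l" .
  qed
qed

text \<open>The system is padded with zero rows to a square one; as p < q, row p is zero and the
  determinant vanishes.\<close>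

lemma homogeneous_system:
  fixes f :: "nat \<Rightarrow> nat \<Rightarrow> complex"
  assumes "p < q"
  shows "\<exists>c. (\<exists>i<q. c i \<noteq> 0) \<and> (\<forall>e<p. (\<Sum>i<q. f e i * c i) = 0)"
proof -
  define F where "F = mat q q (\<lambda>(e,i). if e < p then f e i else 0)"
  have F: "F \<in> carrier_mat q q" by (simp add: F_def)
  have "F = mat\<^sub>r q q (\<lambda>i. if i = p then 0\<^sub>v q else row F i)"
    by (rule eq_matI) (use assms in \<open>auto simp: F_def\<close>)
  moreover have "det (mat\<^sub>r q q (\<lambda>i. if i = p then 0\<^sub>v q else row F i)) = 0"
    by (rule det_row_0[OF assms]) (use F in auto)
  ultimately have "det F = 0" by simp
  then obtain v where v: "v \<in> carrier_vec q" "v \<noteq> 0\<^sub>v q" "F *\<^sub>v v = 0\<^sub>v q"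
    using det_0_iff_vec_prod_zero_field[OF F] by auto
  have "(\<Sum>i<q. f e i * vec_index v i) = 0" if e: "e < p" for e
  proof -
    have "vec_index (F *\<^sub>v v) e = (\<Sum>i<q. f e i * vec_index v i)"
      using e assms v(1) F by (auto simp: scalar_prod_def lessThan_atLeast0 F_def intro!: sum.cong)
    then show ?thesis using v e assms by simp
  qed
  moreover have "\<exists>i<q. vec_index v i \<noteq> 0"
    using v by (metis eq_vecI index_zero_vec carrier_vecD)
  ultimately show ?thesis by blast
qed

text \<open>Courant-Fischer from below: p - 1 linear conditions on p coefficients remove the
  coordinates along the top p - 1 eigenvectors, and there the form is at most the squared p-th
  singular value. The strict inequality for nonzero coefficients also forces the trial vectors to be
  independent.\<close>

lemma sval_gt_if:
  assumes A: "A \<in> carrier_mat n k" and p: "1 \<le> p" "p \<le> n" and t: "0 \<le> t"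
    and gt: "\<And>c. \<exists>i<p. c i \<noteq> 0 \<Longrightarrow> 
      t\<^sup>2 * nsq n (\<lambda>j. \<Sum>i<p. c i * x i j) < nsq k (adj_app n A (\<lambda>j. \<Sum>i<p. c i * x i j))"
  shows "t < sval A p"
proof (rule ccontr)
  assume "\<not> t < sval A p"
  then have le: "sval A p \<le> t" by simp
  obtain U where U1: "\<And>y. nsq n y = nsq n (\<lambda>l. \<Sum>i<n. cnj (U i l) * y i)" and 
    U2: "\<And>y. nsq k (adj_app n A y) = (\<Sum>l<n. (sing_vals A ! l)\<^sup>2 * (cmod (\<Sum>i<n. cnj (U i l) * y i))\<^sup>2)" and
    "\<And>d l. l < n \<Longrightarrow> (\<Sum>i<n. cnj (U i l) * (\<Sum>j<n. U i j * d j)) = d l"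
    using sing_vals_coords[OF A] by blast
  obtain c where c: "\<exists>i<p. c i \<noteq> 0" and 
    c0: "\<And>e. e < p - 1 \<Longrightarrow> (\<Sum>i<p. (\<Sum>j<n. cnj (U j e) * x i j) * c i) = 0"
    using homogeneous_system[of "p - 1" p "\<lambda>e i. \<Sum>j<n. cnj (U j e) * x i j"] p by auto
  define y where "y j = (\<Sum>i<p. c i * x i j)" for j
  have co: "(\<Sum>j<n. cnj (U j l) * y j) = 0" if l: "l < p - 1" for l
  proof -
    have "(\<Sum>j<n. cnj (U j l) * y j) = (\<Sum>i<p. \<Sum>j<n. cnj (U j l) * (c i * x i j))"
      unfolding y_def sum_distrib_left by (rule sum.swap)
    also have "\<dots> = (\<Sum>i<p. (\<Sum>j<n. cnj (U j l) * x i j) * c i)"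
      by (simp add: sum_distrib_left mult_ac)
    finally show ?thesis using c0[OF l] by simp
  qed
  have "nsq k (adj_app n A y) \<le> (\<Sum>l<n. t\<^sup>2 * (cmod (\<Sum>i<n. cnj (U i l) * y i))\<^sup>2)"
    unfolding U2
  proof (rule sum_mono)
    fix l assume "l \<in> {..<n}"
    then have l: "l < n" by simp
    show "(sing_vals A ! l)\<^sup>2 * (cmod (\<Sum>i<n. cnj (U i l) * y i))\<^sup>2 \<le> t\<^sup>2 * (cmod (\<Sum>i<n. cnj (U i l) * y i))\<^sup>2"
    proof (cases "l < p - 1")
      case False
      then have "sing_vals A ! l \<le> t" 
        using sing_vals_decomposition(2)[OF A, of "p - 1" l] l le by (simp add: sval_def)
      then show ?thesis using sing_vals_decomposition(3)[OF A l] by (intro mult_right_mono power_mono) auto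
    qed (simp add: co)
  qed
  also have "\<dots> = t\<^sup>2 * nsq n y" unfolding U1[of y] by (simp add: nsq_def sum_distrib_left)
  finally show False using gt[OF c] by (simp add: y_def[abs_def])
qed

text \<open>Courant-Fischer from above: the span of the top p + 1 eigenvectors meets the common
  kernel of p functionals in a nonzero vector, where the form would exceed t^2 times the squared
  norm.\<close>

lemma sval_le_if:
  assumes A: "A \<in> carrier_mat n k" and p: "p < n" and t: "0 \<le> t"
    and le: "\<And>y. (\<And>e. e < p \<Longrightarrow> (\<Sum>j<n. f e j * y j) = 0) \<Longrightarrow> nsq k (adj_app n A y) \<le> t\<^sup>2 * nsq n y"
  shows "sval A (Suc p) \<le> t"
proof (rule ccontr)
  assume "\<not> sval A (Suc p) \<le> t"
  then have gt: "t < sing_vals A ! p" by (simp add: sval_def)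
  obtain U where U1: "\<And>y. nsq n y = nsq n (\<lambda>l. \<Sum>i<n. cnj (U i l) * y i)" and 
    U2: "\<And>y. nsq k (adj_app n A y) = (\<Sum>l<n. (sing_vals A ! l)\<^sup>2 * (cmod (\<Sum>i<n. cnj (U i l) * y i))\<^sup>2)"
    and U3: "\<And>d l. l < n \<Longrightarrow> (\<Sum>i<n. cnj (U i l) * (\<Sum>j<n. U i j * d j)) = d l"
    using sing_vals_coords[OF A] by blast
  obtain c where c: "\<exists>i<Suc p. c i \<noteq> 0" and 
    c0: "\<And>e. e < p \<Longrightarrow> (\<Sum>i<Suc p. (\<Sum>j<n. f e j * U j i) * c i) = 0"
    using homogeneous_system[of p "Suc p" "\<lambda>e i. \<Sum>j<n. f e j * U j i"] by auto
  define d where "d l = (if l < Suc p then c l else 0)" for l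
  define y where "y i = (\<Sum>j<n. U i j * d j)" for i
  have yco: "(\<Sum>i<n. cnj (U i l) * y i) = d l" if "l < n" for l
    unfolding y_def by (rule U3[OF that])
  have "(\<Sum>j<n. f e j * y j) = 0" if "e < p" for e
  proof -
    have "(\<Sum>j<n. f e j * y j) = (\<Sum>i<n. \<Sum>j<n. f e j * (U j i * d i))"
      unfolding y_def sum_distrib_left by (rule sum.swap)
    also have "\<dots> = (\<Sum>i<n. (\<Sum>j<n. f e j * U j i) * d i)"
      by (simp add: sum_distrib_left mult_ac)
    also have "\<dots> = (\<Sum>i<Suc p. (\<Sum>j<n. f e j * U j i) * d i)"
      by (rule sum.mono_neutral_right) (use p in \<open>auto simp: d_def\<close>)
    finally show ?thesis using c0[OF that] by (simp add: d_def)
  qed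
  from le[OF this] have "nsq k (adj_app n A y) \<le> t\<^sup>2 * nsq n y" .
  moreover have "t\<^sup>2 * nsq n y < nsq k (adj_app n A y)"
  proof -
    have "t\<^sup>2 * nsq n y = (\<Sum>l<n. t\<^sup>2 * (cmod (d l))\<^sup>2)"
      unfolding U1[of y] by (simp add: nsq_def sum_distrib_left yco)
    also have "\<dots> < (\<Sum>l<n. (sing_vals A ! l)\<^sup>2 * (cmod (d l))\<^sup>2)"
    proof (rule sum_strict_mono_ex1)
      have sq: "t\<^sup>2 < (sing_vals A ! l)\<^sup>2" if "l < Suc p" for l
        using sing_vals_decomposition(2)[OF A, of l p] that p gt t by (intro power_strict_mono) auto
      show "\<forall>l\<in>{..<n}. t\<^sup>2 * (cmod (d l))\<^sup>2 \<le> (sing_vals A ! l)\<^sup>2 * (cmod (d l))\<^sup>2"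
        using sq by (auto simp: d_def intro!: mult_right_mono[OF less_imp_le])
      obtain i where i: "i < Suc p" "c i \<noteq> 0" using c by blast
      then show "\<exists>l\<in>{..<n}. t\<^sup>2 * (cmod (d l))\<^sup>2 < (sing_vals A ! l)\<^sup>2 * (cmod (d l))\<^sup>2"
        using p sq[OF i(1)] by (intro bexI[of _ i]) (auto simp: d_def)
    qed simp
    also have "\<dots> = nsq k (adj_app n A y)" unfolding U2 by (intro sum.cong) (auto simp: yco)
    finally show ?thesis .
  qed
  ultimately show False by simp
qed

lemma sval_nonneg: "A \<in> carrier_mat n k \<Longrightarrow> 1 \<le> i \<Longrightarrow> i \<le> n \<Longrightarrow> 0 \<le> sval A i"
  using sing_vals_decomposition(3)[of A n k "i - 1"] by (auto simp: sval_def)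

lemma sval_antimono: "A \<in> carrier_mat n k \<Longrightarrow> 1 \<le> i \<Longrightarrow> i \<le> j \<Longrightarrow> j \<le> n \<Longrightarrow> sval A j \<le> sval A i"
  using sing_vals_decomposition(2)[of A n k "i - 1" "j - 1"] by (auto simp: sval_def)

text \<open>The functionals are inner products with the top i - 1 eigenvectors. This is the converse
  direction to \<open>sval_le_if\<close>.\<close>

lemma adj_app_le_if_orthogonal:
  assumes A: "A \<in> carrier_mat n k" and i: "1 \<le> i" "i \<le> n"
  obtains f where "\<And>y. (\<And>e. e < i - 1 \<Longrightarrow> (\<Sum>j<n. f e j * y j) = 0) \<Longrightarrow> 
    nsq k (adj_app n A y) \<le> (sval A i)\<^sup>2 * nsq n y"
proof -
  obtain U where U1: "\<And>y. nsq n y = nsq n (\<lambda>l. \<Sum>i<n. cnj (U i l) * y i)" and 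
    U2: "\<And>y. nsq k (adj_app n A y) = (\<Sum>l<n. (sing_vals A ! l)\<^sup>2 * (cmod (\<Sum>i<n. cnj (U i l) * y i))\<^sup>2)" and
    "\<And>d l. l < n \<Longrightarrow> (\<Sum>i<n. cnj (U i l) * (\<Sum>j<n. U i j * d j)) = d l"
    using sing_vals_coords[OF A] by blast
  show thesis
  proof (rule that[of "\<lambda>e j. cnj (U j e)"])
    fix y assume y: "\<And>e. e < i - 1 \<Longrightarrow> (\<Sum>j<n. cnj (U j e) * y j) = 0"
    have "nsq k (adj_app n A y) \<le> (\<Sum>l<n. (sval A i)\<^sup>2 * (cmod (\<Sum>i<n. cnj (U i l) * y i))\<^sup>2)"
      unfolding U2
    proof (rule sum_mono)
      fix l assume "l \<in> {..<n}"
      then have l: "l < n" by simp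
      show "(sing_vals A ! l)\<^sup>2 * (cmod (\<Sum>i<n. cnj (U i l) * y i))\<^sup>2 
         \<le> (sval A i)\<^sup>2 * (cmod (\<Sum>i<n. cnj (U i l) * y i))\<^sup>2"
      proof (cases "l < i - 1")
        case False
        then have "sing_vals A ! l \<le> sval A i" 
          using sing_vals_decomposition(2)[OF A, of "i - 1" l] l by (simp add: sval_def)
        then show ?thesis using sing_vals_decomposition(3)[OF A l] by (intro mult_right_mono power_mono) auto
      qed (simp add: y)
    qed
    also have "\<dots> = (sval A i)\<^sup>2 * nsq n y" unfolding U1[of y] by (simp add: nsq_def sum_distrib_left)
    finally show "nsq k (adj_app n A y) \<le> (sval A i)\<^sup>2 * nsq n y" .
  qed
qed

lemma adj_app_bound:
  assumes "A \<in> carrier_mat n k" "1 \<le> n"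
  shows "nsq k (adj_app n A y) \<le> (sval A 1)\<^sup>2 * nsq n y"
  using adj_app_le_if_orthogonal[OF assms(1) order_refl assms(2)] by auto

text \<open>The r conditions under which the two adjoints agree are listed before the i - 1
  conditions belonging to B, which makes i - 1 + r functionals for A.\<close>

lemma sval_interlacing:
  assumes A: "A \<in> carrier_mat n k" and B: "B \<in> carrier_mat n k" and i: "1 \<le> i" "i + r \<le> n"
    and eq: "\<And>y j. (\<And>e. e < r \<Longrightarrow> (\<Sum>j<n. g e j * y j) = 0) \<Longrightarrow> j < k \<Longrightarrow> adj_app n A y j = adj_app n B y j"
  shows "sval A (i + r) \<le> sval B i"
proof -
  obtain f where f: "\<And>y. (\<And>e. e < i - 1 \<Longrightarrow> (\<Sum>j<n. f e j * y j) = 0) \<Longrightarrow> 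
    nsq k (adj_app n B y) \<le> (sval B i)\<^sup>2 * nsq n y"
    using adj_app_le_if_orthogonal[OF B, of i] i by auto
  have "sval A (Suc (i - 1 + r)) \<le> sval B i"
  proof (rule sval_le_if[OF A, where f = "\<lambda>e. if e < r then g e else f (e - r)"])
    fix y assume h: "\<And>e. e < i - 1 + r \<Longrightarrow> (\<Sum>j<n. (if e < r then g e else f (e - r)) j * y j) = 0"
    have "nsq k (adj_app n A y) = nsq k (adj_app n B y)"
    proof -
      have "(\<Sum>j<n. g e j * y j) = 0" if "e < r" for e
        using h[of e] that by simp
      then show ?thesis unfolding nsq_def by (intro sum.cong refl) (simp add: eq)
    qed
    moreover have "(\<Sum>j<n. f e j * y j) = 0" if "e < i - 1" for e
      using h[of "e + r"] that by simp
    ultimately show "nsq k (adj_app n A y) \<le> (sval B i)\<^sup>2 * nsq n y" using f[of y] by simp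
  qed (use i sval_nonneg[OF B] in auto)
  then show ?thesis using i by simp
qed

section \<open>Quadratic forms in random signs\<close>

text \<open>Expectation over N independent signs as a finite recursion, so that moment bounds become
  inductions on N. Starting from the constant 1 ensures that only sign vectors ever reach
  \<open>f\<close>.\<close>

fun sgn_avg :: "nat \<Rightarrow> ((nat \<Rightarrow> real) \<Rightarrow> real) \<Rightarrow> real" where
  "sgn_avg 0 f = f (\<lambda>_. 1)"
| "sgn_avg (Suc N) f = (sgn_avg N (\<lambda>e. f (e(N := 1))) + sgn_avg N (\<lambda>e. f (e(N := - 1)))) / 2"

lemma sgn_avg_add: "sgn_avg N (\<lambda>e. f e + g e) = sgn_avg N f + sgn_avg N g"
  by (induction N arbitrary: f g) (auto simp: field_simps)

lemma sgn_avg_cmult: "sgn_avg N (\<lambda>e. c * f e) = c * sgn_avg N f"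
  by (induction N arbitrary: f) (auto simp: field_simps)

lemma sgn_avg_mono: "(\<And>e. f e \<le> g e) \<Longrightarrow> sgn_avg N f \<le> sgn_avg N g"
proof (induction N arbitrary: f g)
  case (Suc N)
  then show ?case by (simp add: add_mono divide_right_mono)
qed simp

lemma sgn_avg_const [simp]: "sgn_avg N (\<lambda>_. c) = c"
  by (induction N) auto

lemma sgn_avg_Suc: "sgn_avg (Suc N) f = sgn_avg N (\<lambda>e. (f (e(N := 1)) + f (e(N := - 1))) / 2)"
  using sgn_avg_cmult[of N "1/2" "\<lambda>e. f (e(N := 1)) + f (e(N := - 1))"]
  by (simp add: sgn_avg_add)

lemma sgn_avg_linear2: "sgn_avg N (\<lambda>e. (\<Sum>i<N. a i * e i)\<^sup>2) = (\<Sum>i<N. (a i)\<^sup>2)"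
proof (induction N)
  case (Suc N)
  have "sgn_avg (Suc N) (\<lambda>e. (\<Sum>i<Suc N. a i * e i)\<^sup>2)
      = sgn_avg N (\<lambda>e. (\<Sum>i<N. a i * e i)\<^sup>2 + (a N)\<^sup>2)"
    unfolding sgn_avg_Suc by (rule arg_cong[of _ _ "sgn_avg N"]) (auto simp: fun_eq_iff power2_eq_square algebra_simps)
  then show ?case by (simp add: sgn_avg_add Suc)
qed simp

text \<open>Terms odd in the last sign average out. The constant 3 is the Gaussian one, and the
  induction step has twice the fourth power of the new coefficient to spare.\<close>

lemma sgn_avg_linear4: "sgn_avg N (\<lambda>e. (\<Sum>i<N. a i * e i) ^ 4) \<le> 3 * (\<Sum>i<N. (a i)\<^sup>2)\<^sup>2"
proof (induction N)
  case (Suc N)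
  let ?L = "\<lambda>e. \<Sum>i<N. a i * e i"
  have "sgn_avg (Suc N) (\<lambda>e. (\<Sum>i<Suc N. a i * e i) ^ 4)
      = sgn_avg N (\<lambda>e. ?L e ^ 4 + (6 * (a N)\<^sup>2 * (?L e)\<^sup>2 + (a N) ^ 4))"
    unfolding sgn_avg_Suc 
    by (rule arg_cong[of _ _ "sgn_avg N"]) (auto simp: fun_eq_iff power2_eq_square power4_eq_xxxx algebra_simps)
  also have "\<dots> \<le> 3 * (\<Sum>i<N. (a i)\<^sup>2)\<^sup>2 + 6 * (a N)\<^sup>2 * (\<Sum>i<N. (a i)\<^sup>2) + (a N) ^ 4"
    using Suc by (simp add: sgn_avg_add sgn_avg_cmult sgn_avg_linear2 mult.assoc)
  also have "\<dots> \<le> 3 * (\<Sum>i<Suc N. (a i)\<^sup>2)\<^sup>2"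
  proof -
    have "3 * (s + x\<^sup>2)\<^sup>2 - (3 * s\<^sup>2 + 6 * x\<^sup>2 * s + x ^ 4) = 2 * x ^ 4" for s x :: real
      by (simp add: power2_eq_square power4_eq_xxxx algebra_simps)
    moreover have "0 \<le> 2 * x ^ 4" for x :: real by simp
    ultimately show ?thesis by (simp only: sum.lessThan_Suc) (metis diff_ge_0_iff_ge)
  qed
  finally show ?case .
qed simp

text \<open>The Bonami inequality for quadratic forms in independent signs, with the sum of the squared
  coefficients in place of the second moment.\<close>

lemma sgn_avg_quadratic4:
  "sgn_avg N (\<lambda>e. (\<Sum>i<N. \<Sum>j<i. a i j * e i * e j) ^ 4) \<le> 81 * (\<Sum>i<N. \<Sum>j<i. (a i j)\<^sup>2)\<^sup>2"
proof (induction N)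
  case (Suc N)
  let ?Q = "\<lambda>e. \<Sum>i<N. \<Sum>j<i. a i j * e i * e j" and ?L = "\<lambda>e. \<Sum>j<N. a N j * e j"
  define S where "S = (\<Sum>i<N. \<Sum>j<i. (a i j)\<^sup>2)"
  define l where "l = (\<Sum>j<N. (a N j)\<^sup>2)"
  have S0: "S \<ge> 0" and l0: "l \<ge> 0" unfolding S_def l_def by (auto intro!: sum_nonneg)
  have upd: "(\<Sum>i<N. \<Sum>j<i. a i j * (e(N := s)) i * (e(N := s)) j) = ?Q e" 
    "(\<Sum>j<N. a N j * s * (e(N := s)) j) = s * ?L e" for e s
    by (auto simp: sum_distrib_left mult_ac intro!: sum.cong)
  have "sgn_avg (Suc N) (\<lambda>e. (\<Sum>i<Suc N. \<Sum>j<i. a i j * e i * e j) ^ 4)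
      = sgn_avg N (\<lambda>e. ((?Q e + ?L e) ^ 4 + (?Q e - ?L e) ^ 4) / 2)"
    unfolding sgn_avg_Suc by (simp add: upd[where s = 1, simplified] upd[where s = "-1", simplified])
  also have "(\<lambda>e. ((?Q e + ?L e) ^ 4 + (?Q e - ?L e) ^ 4) / 2) = 
      (\<lambda>e. ?Q e ^ 4 + (6 * ((?Q e)\<^sup>2 * (?L e)\<^sup>2) + ?L e ^ 4))"
  proof
    fix e
    have "((x + y) ^ 4 + (x - y) ^ 4) / 2 = x ^ 4 + (6 * (x\<^sup>2 * y\<^sup>2) + y ^ 4)" for x y :: real
      by (simp add: power2_eq_square power4_eq_xxxx algebra_simps)
    then show "((?Q e + ?L e) ^ 4 + (?Q e - ?L e) ^ 4) / 2 = ?Q e ^ 4 + (6 * ((?Q e)\<^sup>2 * (?L e)\<^sup>2) + ?L e ^ 4)" .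
  qed
  also have "sgn_avg N \<dots> = sgn_avg N (\<lambda>e. ?Q e ^ 4) + 6 * sgn_avg N (\<lambda>e. (?Q e)\<^sup>2 * (?L e)\<^sup>2) + sgn_avg N (\<lambda>e. ?L e ^ 4)"
    by (simp add: sgn_avg_add sgn_avg_cmult)
  also have "\<dots> \<le> 81 * S\<^sup>2 + 6 * sgn_avg N (\<lambda>e. (?Q e)\<^sup>2 * (?L e)\<^sup>2) + 3 * l\<^sup>2"
    using Suc sgn_avg_linear4[of N "a N"] unfolding S_def l_def by simp
  also have "sgn_avg N (\<lambda>e. (?Q e)\<^sup>2 * (?L e)\<^sup>2) \<le> 18 * S * l"
  \<comment> \<open>The weight chosen below is a quotient of \<open>l\<close> and \<open>S\<close>
    and must be positive; if either sum vanishes, so does the product.\<close>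
  proof (cases "S = 0 \<or> l = 0")
    case True
    then have "(?Q e)\<^sup>2 * (?L e)\<^sup>2 = 0" for e
    proof
      assume "S = 0"
      then have "\<forall>i<N. (\<Sum>j<i. (a i j)\<^sup>2) = 0" unfolding S_def
        by (subst (asm) sum_nonneg_eq_0_iff) (auto intro!: sum_nonneg)
      then have "\<forall>i<N. \<forall>j<i. a i j = 0" by (auto simp: sum_nonneg_eq_0_iff)
      then show ?thesis by simp
    next
      assume "l = 0"
      then show ?thesis by (auto simp: l_def sum_nonneg_eq_0_iff)
    qed
    then show ?thesis using S0 l0 by (simp only: sgn_avg_const) simp
  next
    case False
    \<comment> \<open>A weight for Young's inequality that avoids roots: the two terms contribute
      27/2 + 9/2 = 18 times \<open>S * l\<close>, and 6 * 18 = 108 stays below the cross coefficient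
      2 * 81 = 162.\<close>
    define h where "h = l / (3 * S)"
    have h: "h > 0" using False S0 l0 by (auto simp: h_def)
    have "(?Q e)\<^sup>2 * (?L e)\<^sup>2 \<le> h / 2 * ?Q e ^ 4 + 1 / (2 * h) * ?L e ^ 4" for e
    proof -
      have "0 \<le> (h * x\<^sup>2 - y\<^sup>2)\<^sup>2 / (2 * h)" for x y :: real using h by simp
      also have "(h * x\<^sup>2 - y\<^sup>2)\<^sup>2 / (2 * h) = h / 2 * x ^ 4 + 1 / (2 * h) * y ^ 4 - x\<^sup>2 * y\<^sup>2" for x y :: real
        using h by (simp add: field_simps power2_eq_square power4_eq_xxxx)
      finally have "0 \<le> h / 2 * x ^ 4 + 1 / (2 * h) * y ^ 4 - x\<^sup>2 * y\<^sup>2" for x y :: real .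
      from this[of "?Q e" "?L e"] show ?thesis by linarith
    qed
    then have "sgn_avg N (\<lambda>e. (?Q e)\<^sup>2 * (?L e)\<^sup>2) \<le> sgn_avg N (\<lambda>e. h / 2 * ?Q e ^ 4 + 1 / (2 * h) * ?L e ^ 4)"
      by (rule sgn_avg_mono)
    also have "\<dots> = h / 2 * sgn_avg N (\<lambda>e. ?Q e ^ 4) + 1 / (2 * h) * sgn_avg N (\<lambda>e. ?L e ^ 4)"
      by (simp only: sgn_avg_add sgn_avg_cmult)
    also have "\<dots> \<le> h / 2 * (81 * S\<^sup>2) + 1 / (2 * h) * (3 * l\<^sup>2)"
      using Suc sgn_avg_linear4[of N "a N"] h unfolding S_def l_def by (intro add_mono mult_left_mono) auto
    also have "\<dots> = 18 * S * l" using False by (simp add: h_def field_simps power2_eq_square)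
    finally show ?thesis .
  qed
  also have "81 * S\<^sup>2 + 6 * (18 * S * l) + 3 * l\<^sup>2 \<le> 81 * (S + l)\<^sup>2"
    using S0 l0 by (simp add: power2_eq_square algebra_simps)
  finally show ?case by (simp add: S_def l_def)
qed simp

text \<open>If every choice of signs yields the same integral, so does the average over signs.
  \<open>C\<close> is an extended nonnegative number, which keeps integrability out of the
  argument.\<close>

lemma nn_integral_sgn_avg:
  fixes f :: "(nat \<Rightarrow> real) \<Rightarrow> 'a \<Rightarrow> real"
  assumes "\<And>e. (\<And>i. e i \<in> {1, -1}) \<Longrightarrow> f e \<in> borel_measurable M"
    "\<And>e x. (\<And>i. e i \<in> {1, -1}) \<Longrightarrow> 0 \<le> f e x"
    "\<And>e. (\<And>i. e i \<in> {1, -1}) \<Longrightarrow> (\<integral>\<^sup>+x. ennreal (f e x) \<partial>M) = C"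
  shows "(\<lambda>x. sgn_avg N (\<lambda>e. f e x)) \<in> borel_measurable M \<and> (\<forall>x. 0 \<le> sgn_avg N (\<lambda>e. f e x)) \<and>
    (\<integral>\<^sup>+x. ennreal (sgn_avg N (\<lambda>e. f e x)) \<partial>M) = C"
  using assms
proof (induction N arbitrary: f)
  case (Suc N)
  let ?g = "\<lambda>s x. sgn_avg N (\<lambda>e. f (e(N := s)) x)"
  have IH: "?g s \<in> borel_measurable M \<and> (\<forall>x. 0 \<le> ?g s x) \<and> (\<integral>\<^sup>+x. ennreal (?g s x) \<partial>M) = C" if "s \<in> {1,-1}" for s
    by (rule Suc.IH) (use that Suc.prems in auto)
  note a = IH[of 1, simplified] and b = IH[of "-1", simplified]
  have [measurable]: "?g 1 \<in> borel_measurable M" "?g (-1) \<in> borel_measurable M" using a b by auto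
  have "(\<integral>\<^sup>+x. ennreal (sgn_avg (Suc N) (\<lambda>e. f e x)) \<partial>M) = (\<integral>\<^sup>+x. ennreal (1/2) * (ennreal (?g 1 x) + ennreal (?g (-1) x)) \<partial>M)"
  proof (rule nn_integral_cong)
    have "ennreal ((x + y) / 2) = ennreal (1/2) * (ennreal x + ennreal y)" if "0 \<le> x" "0 \<le> y" for x y :: real
      unfolding ennreal_plus[OF that, symmetric] using that by (subst ennreal_mult[symmetric]) auto
    then show "ennreal (sgn_avg (Suc N) (\<lambda>e. f e x)) = ennreal (1/2) * (ennreal (?g 1 x) + ennreal (?g (-1) x))" for x
      using a b by simp
  qed
  also have "\<dots> = ennreal (1/2) * (C + C)"
    using a b by (subst nn_integral_cmult) (simp_all add: nn_integral_add)
  also have "C + C = ennreal 2 * C" by (simp add: mult_2)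
  also have "ennreal (1/2) * (ennreal 2 * C) = C"
    unfolding mult.assoc[symmetric] by (subst ennreal_mult[symmetric]) auto
  finally show ?case using a b by (simp)
qed simp

section \<open>The Hermitian dilation of a matrix\<close>

lemma sgn_avg_cong:
  "(\<And>e. (\<And>i. e i \<in> {1, -1}) \<Longrightarrow> f e = g e) \<Longrightarrow> sgn_avg N f = sgn_avg N g"
proof (induction N arbitrary: f g)
  case (Suc N)
  have "sgn_avg N (\<lambda>e. f (e(N := s))) = sgn_avg N (\<lambda>e. g (e(N := s)))" if "s \<in> {1,-1}" for s
    by (rule Suc.IH, rule Suc.prems) (use that in auto)
  then show ?case by simp
qed simp

section \<open>Matrix-vector products, inner products and partial traces on functions\<close>

definition mv :: "nat \<Rightarrow> complex mat \<Rightarrow> (nat \<Rightarrow> complex) \<Rightarrow> nat \<Rightarrow> complex" where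
  "mv N P y i = (\<Sum>j<N. P $$ (i,j) * y j)"

definition ip :: "nat \<Rightarrow> (nat \<Rightarrow> complex) \<Rightarrow> (nat \<Rightarrow> complex) \<Rightarrow> complex" where
  "ip N x y = (\<Sum>i<N. cnj (x i) * y i)"

text \<open>Traces over an index set, because the two diagonal blocks of the dilation have different
  normalised traces.\<close>

definition ptr :: "nat set \<Rightarrow> complex mat \<Rightarrow> complex" where
  "ptr I P = (\<Sum>i\<in>I. P $$ (i,i))"

lemma mv_cong: "(\<And>j. j < N \<Longrightarrow> y j = y' j) \<Longrightarrow> mv N P y = mv N P y'"
  by (auto simp: mv_def fun_eq_iff)

lemma ip_cong: "(\<And>j. j < N \<Longrightarrow> x j = x' j) \<Longrightarrow> (\<And>j. j < N \<Longrightarrow> y j = y' j) \<Longrightarrow> ip N x y = ip N x' y'"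
  by (auto simp: ip_def)

lemma mv_mult:
  assumes "P \<in> carrier_mat N N" "Q \<in> carrier_mat N N" "i < N"
  shows "mv N (P * Q) y i = mv N P (mv N Q y) i"
proof -
  have "mv N (P * Q) y i = (\<Sum>j<N. \<Sum>p<N. P $$ (i,p) * (Q $$ (p,j) * y j))"
    unfolding mv_def
    by (intro sum.cong refl) (simp add: mult_index[OF assms(1,2,3)] sum_distrib_right mult.assoc del: index_mult_mat)
  also have "\<dots> = (\<Sum>p<N. \<Sum>j<N. P $$ (i,p) * (Q $$ (p,j) * y j))" by (rule sum.swap)
  finally show ?thesis by (simp add: mv_def sum_distrib_left)
qed

lemma mv_one: "i < N \<Longrightarrow> mv N (1\<^sub>m N) y i = y i"
proof -
  assume i: "i < N"
  have "mv N (1\<^sub>m N) y i = (\<Sum>j<N. if i = j then y j else 0)"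
    unfolding mv_def by (intro sum.cong) (use i in auto)
  then show ?thesis using i by simp
qed

lemma ip_mv_adj:
  assumes P: "P \<in> carrier_mat N N"
  shows "ip N x (mv N P y) = ip N (mv N (adj P) x) y"
proof -
  have "ip N x (mv N P y) = (\<Sum>i<N. \<Sum>j<N. cnj (x i) * P $$ (i,j) * y j)"
    by (simp add: ip_def mv_def sum_distrib_left mult.assoc)
  also have "\<dots> = (\<Sum>j<N. \<Sum>i<N. cnj (x i) * P $$ (i,j) * y j)" by (rule sum.swap)
  also have "\<dots> = ip N (mv N (adj P) x) y"
    unfolding ip_def mv_def cnj_sum sum_distrib_right
    by (intro sum.cong refl) (use P in auto)
  finally show ?thesis .
qed

lemma pow_carrier [simp]: "H \<in> carrier_mat N N \<Longrightarrow> H ^\<^sub>m p \<in> carrier_mat N N"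
  by (rule pow_carrier_mat)

lemma conj_pow:
  assumes W: "W \<in> carrier_mat N N" "W * adj W = 1\<^sub>m N" and H: "H \<in> carrier_mat N N"
  shows "(W * H * adj W) ^\<^sub>m p = W * H ^\<^sub>m p * adj W"
proof (induction p)
  case 0
  then show ?case using W H by simp
next
  case (Suc p)
  have aW: "adj W \<in> carrier_mat N N" using W by simp
  have P: "H ^\<^sub>m p \<in> carrier_mat N N" using H by simp
  note [simp] = assoc_square[where n=N] mult_carrier_square[where n=N]
  have "W * H ^\<^sub>m p * adj W * (W * H * adj W) = W * H ^\<^sub>m p * (adj W * W) * H * adj W"
    using W(1) H aW P by simp
  then show ?case using Suc W(1) H aW P unitary_left[OF W] by simp
qed

lemma ip_conj:
  assumes W: "W \<in> carrier_mat N N" "W * adj W = 1\<^sub>m N" and P: "P \<in> carrier_mat N N"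
    and w: "\<And>i. i < N \<Longrightarrow> w i = mv N W w' i"
  shows "ip N w (mv N (W * P * adj W) w) = ip N w' (mv N P w')"
proof -
  have aW: "adj W \<in> carrier_mat N N" using W by simp
  have WP: "W * P \<in> carrier_mat N N" using W P by simp
  have w': "mv N (adj W) w i = w' i" if "i < N" for i
  proof -
    have "mv N (adj W) w i = mv N (adj W) (mv N W w') i" using mv_cong[of N w, OF w] by simp
    also have "\<dots> = mv N (1\<^sub>m N) w' i" using mv_mult[OF aW W(1) that] by (simp add: unitary_left[OF W])
    finally show ?thesis using that by (simp add: mv_one)
  qed
  have "ip N w (mv N (W * P * adj W) w) = ip N w (mv N W (mv N P (mv N (adj W) w)))"
    by (rule ip_cong) (simp_all add: mv_mult[OF WP aW] mv_mult[OF W(1) P])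
  also have "\<dots> = ip N (mv N (adj W) w) (mv N P (mv N (adj W) w))"
    by (rule ip_mv_adj[OF W(1)])
  also have "mv N P (mv N (adj W) w) = mv N P w'" by (rule mv_cong) (rule w')
  also have "ip N (mv N (adj W) w) (mv N P w') = ip N w' (mv N P w')" by (rule ip_cong) (auto simp: w')
  finally show ?thesis .
qed

text \<open>\<open>WI\<close> says W^H Q W = Q for the coordinate projection Q onto I; the trace of
  Q W P W^H is then that of Q P by cyclicity.\<close>

lemma ptr_conj:
  assumes W: "W \<in> carrier_mat N N" and P: "P \<in> carrier_mat N N" and I: "I \<subseteq> {..<N}"
    and WI: "\<And>p q. p < N \<Longrightarrow> q < N \<Longrightarrow> (\<Sum>i\<in>I. W $$ (i,p) * cnj (W $$ (i,q))) = (if p = q \<and> p \<in> I then 1 else 0)"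
  shows "ptr I (W * P * adj W) = ptr I P"
proof -
  have aW: "adj W \<in> carrier_mat N N" using W by simp
  have WP: "W * P \<in> carrier_mat N N" using W P by simp
  have "ptr I (W * P * adj W) = (\<Sum>i\<in>I. \<Sum>q<N. \<Sum>p<N. P $$ (p,q) * (W $$ (i,p) * cnj (W $$ (i,q))))"
    unfolding ptr_def
  proof (intro sum.cong refl)
    fix i assume "i \<in> I"
    then have i: "i < N" using I by auto
    show "(W * P * adj W) $$ (i,i) = (\<Sum>q<N. \<Sum>p<N. P $$ (p,q) * (W $$ (i,p) * cnj (W $$ (i,q))))"
      unfolding mult_index[OF WP aW i i] 
      using W i by (intro sum.cong refl) (simp add: mult_index[OF W P i] sum_distrib_left mult_ac del: index_mult_mat)
  qed
  also have "\<dots> = (\<Sum>q<N. \<Sum>i\<in>I. \<Sum>p<N. P $$ (p,q) * (W $$ (i,p) * cnj (W $$ (i,q))))"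
    by (rule sum.swap)
  also have "\<dots> = (\<Sum>q<N. \<Sum>p<N. \<Sum>i\<in>I. P $$ (p,q) * (W $$ (i,p) * cnj (W $$ (i,q))))"
    by (intro sum.cong refl sum.swap)
  also have "\<dots> = (\<Sum>q<N. \<Sum>p<N. if p = q then (if q \<in> I then P $$ (q,q) else 0) else 0)"
    by (intro sum.cong refl) (use WI in \<open>auto simp flip: sum_distrib_left\<close>)
  also have "\<dots> = (\<Sum>q<N. if q \<in> I then P $$ (q,q) else 0)" by simp
  also have "\<dots> = ptr I P" unfolding ptr_def using I
    by (simp add: sum.If_cases Int_absorb1)
  finally show ?thesis .
qed

lemma hermitian_index: "adj P = P \<Longrightarrow> P \<in> carrier_mat N N \<Longrightarrow> i < N \<Longrightarrow> j < N \<Longrightarrow> cnj (P $$ (j,i)) = P $$ (i,j)"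
  using adj_index[of i P j] by simp

lemma frobenius_ptr:
  assumes P: "P \<in> carrier_mat N N" and H: "adj P = P"
  shows "Re (ptr {..<N} (P * P)) = (\<Sum>i<N. \<Sum>j<N. (cmod (P $$ (i,j)))\<^sup>2)"
proof -
  have "ptr {..<N} (P * P) = (\<Sum>i<N. \<Sum>j<N. complex_of_real ((cmod (P $$ (i,j)))\<^sup>2))"
    unfolding ptr_def
  proof (intro sum.cong refl)
    fix i assume "i \<in> {..<N}"
    then have i: "i < N" by simp
    show "(P * P) $$ (i,i) = (\<Sum>j<N. complex_of_real ((cmod (P $$ (i,j)))\<^sup>2))"
      unfolding mult_index[OF P P i i] complex_norm_square
      by (intro sum.cong refl) (use hermitian_index[OF H P] i in auto)
  qed
  also have "\<dots> = of_real (\<Sum>i<N. \<Sum>j<N. (cmod (P $$ (i,j)))\<^sup>2)" by simp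
  finally show ?thesis by simp
qed

lemma adj_pow:
  assumes H: "H \<in> carrier_mat N N" "adj H = H"
  shows "adj (H ^\<^sub>m p) = H ^\<^sub>m p"
proof (induction p)
  case (Suc p)
  have c: "H ^\<^sub>m p \<in> carrier_mat N N" using H by simp
  have comm: "H * H ^\<^sub>m q = H ^\<^sub>m q * H" for q
  proof (induction q)
    case (Suc q)
    have c: "H ^\<^sub>m q \<in> carrier_mat N N" using H by simp
    show ?case using Suc assoc_square[OF H(1) c H(1)] by simp
  qed (use H in simp)
  show ?case using adj_mult[OF c H(1)] Suc H comm by simp
qed (use H in simp)

lemma pow_add:
  assumes H: "H \<in> carrier_mat N N"
  shows "(H ^\<^sub>m p) * (H ^\<^sub>m q) = H ^\<^sub>m (p + q)"
proof (induction q)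
  case (Suc q)
  have "H ^\<^sub>m p * (H ^\<^sub>m q * H) = H ^\<^sub>m p * H ^\<^sub>m q * H"
    using H by (intro assoc_square[symmetric]) auto
  then show ?case using Suc by simp
qed (use H in simp)

text \<open>The Hermitian dilation of A. The dimensions are arguments, so \<open>dil_carrier\<close>
  holds for every A.\<close>

definition dil :: "nat \<Rightarrow> nat \<Rightarrow> complex mat \<Rightarrow> complex mat" where
  "dil n k A = four_block_mat (0\<^sub>m n n) A (adj A) (0\<^sub>m k k)"

lemma dil_carrier [simp]: "dil n k A \<in> carrier_mat (n + k) (n + k)"
  by (simp add: dil_def)

lemma dil_index:
  assumes "A \<in> carrier_mat n k" "i < n + k" "j < n + k"
  shows "dil n k A $$ (i,j) = (if i < n then (if j < n then 0 else A $$ (i, j - n))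
     else if j < n then cnj (A $$ (j, i - n)) else 0)"
  using assms by (auto simp: dil_def)

lemma dil_adj: "A \<in> carrier_mat n k \<Longrightarrow> adj (dil n k A) = dil n k A"
  by (rule eq_matI) (auto simp: dil_index carrier_matD[OF dil_carrier] dil_carrier[THEN carrier_matD(1)] dil_carrier[THEN carrier_matD(2)])

lemma block_unitary:
  assumes U: "U \<in> carrier_mat n n" "U * adj U = 1\<^sub>m n" and V: "V \<in> carrier_mat k k" "V * adj V = 1\<^sub>m k"
  defines "W \<equiv> four_block_mat U (0\<^sub>m n k) (0\<^sub>m k n) V"
  shows "W \<in> carrier_mat (n + k) (n + k)" "W * adj W = 1\<^sub>m (n + k)" 
    "adj W = four_block_mat (adj U) (0\<^sub>m n k) (0\<^sub>m k n) (adj V)"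
proof -
  show "W \<in> carrier_mat (n + k) (n + k)" using U V by (simp add: W_def)
  show aW: "adj W = four_block_mat (adj U) (0\<^sub>m n k) (0\<^sub>m k n) (adj V)"
    by (rule eq_matI) (use U V in \<open>auto simp: W_def\<close>)
  show "W * adj W = 1\<^sub>m (n + k)" unfolding aW unfolding W_def
    using U V by (subst block_diag_mult) auto
qed

text \<open>Two-sided multiplication of A becomes one conjugation of the dilation, so bi-invariance
  turns into invariance under block diagonal unitaries.\<close>

lemma dil_conj:
  assumes U: "U \<in> carrier_mat n n" and V: "V \<in> carrier_mat k k" and A: "A \<in> carrier_mat n k"
  defines "W \<equiv> four_block_mat U (0\<^sub>m n k) (0\<^sub>m k n) V"
  shows "dil n k (U * A * adj V) = W * dil n k A * adj W"
proof -
  have aW: "adj W = four_block_mat (adj U) (0\<^sub>m n k) (0\<^sub>m k n) (adj V)"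
    by (rule eq_matI) (use U V in \<open>auto simp: W_def\<close>)
  have c: "adj U \<in> carrier_mat n n" "adj V \<in> carrier_mat k k" "adj A \<in> carrier_mat k n" using U V A by auto
  have UA: "U * A \<in> carrier_mat n k" "V * adj A \<in> carrier_mat k n" using U V A by auto
  have p: "U * A * adj V \<in> carrier_mat n k" "V * adj A * adj U \<in> carrier_mat k n" using UA c by auto
  note z = left_mult_zero_mat right_mult_zero_mat right_add_zero_mat left_add_zero_mat
  have 1: "W * dil n k A = four_block_mat (0\<^sub>m n n) (U * A) (V * adj A) (0\<^sub>m k k)"
    unfolding W_def dil_def
    by (subst mult_four_block_mat[OF U zero_carrier_mat zero_carrier_mat V zero_carrier_mat A c(3) zero_carrier_mat])
       (simp add: right_mult_zero_mat[OF U] left_mult_zero_mat[OF c(3)] right_mult_zero_mat[OF V] left_mult_zero_mat[OF A]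
         left_add_zero_mat[OF UA(2)] right_add_zero_mat[OF UA(1)])
  have 2: "W * dil n k A * adj W = four_block_mat (0\<^sub>m n n) (U * A * adj V) (V * adj A * adj U) (0\<^sub>m k k)"
    unfolding 1 aW
    by (subst mult_four_block_mat[OF zero_carrier_mat UA zero_carrier_mat c(1) zero_carrier_mat zero_carrier_mat c(2)])
       (simp add: left_mult_zero_mat[OF c(1)] right_mult_zero_mat[OF UA(1)] right_mult_zero_mat[OF UA(2)] left_mult_zero_mat[OF c(2)]
         left_add_zero_mat[OF p(1)] right_add_zero_mat[OF p(2)])
  have "adj (U * A * adj V) = V * adj A * adj U"
    using adj_mult[OF UA(1) c(2)] adj_mult[OF U A] assoc_mult_mat[OF V c(3) c(1)] by simp
  then show ?thesis unfolding 2 by (simp add: dil_def)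
qed

lemma ptr_block_conj:
  assumes U: "U \<in> carrier_mat n n" "U * adj U = 1\<^sub>m n" and V: "V \<in> carrier_mat k k" "V * adj V = 1\<^sub>m k"
    and P: "P \<in> carrier_mat (n + k) (n + k)"
  defines "W \<equiv> four_block_mat U (0\<^sub>m n k) (0\<^sub>m k n) V"
  shows "ptr {..<n} (W * P * adj W) = ptr {..<n} P" "ptr {n..<n+k} (W * P * adj W) = ptr {n..<n+k} P"
proof -
  note W = block_unitary[OF U V, folded W_def]
  have gU: "(\<Sum>i<n. U $$ (i,p) * cnj (U $$ (i,q))) = (if p = q then 1 else 0)" if "p < n" "q < n" for p q
    using mult_index[OF adj_carrier[OF U(1)] U(1) that(2,1)] unitary_left[OF U] that U(1)
    by (auto simp: mult.commute)
  have gV: "(\<Sum>i<k. V $$ (i,p) * cnj (V $$ (i,q))) = (if p = q then 1 else 0)" if "p < k" "q < k" for p q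
    using mult_index[OF adj_carrier[OF V(1)] V(1) that(2,1)] unitary_left[OF V] that V(1)
    by (auto simp: mult.commute)
  have Wi: "W $$ (i,p) = (if i < n then (if p < n then U $$ (i,p) else 0) else if p < n then 0 else V $$ (i - n, p - n))"
    if "i < n + k" "p < n + k" for i p
    using that U V by (auto simp: W_def)
  show "ptr {..<n} (W * P * adj W) = ptr {..<n} P"
  proof (rule ptr_conj[OF W(1) P])
    fix p q assume pq: "p < n + k" "q < n + k"
    then have "(\<Sum>i<n. W $$ (i,p) * cnj (W $$ (i,q))) = (\<Sum>i<n. if p < n \<and> q < n then U $$ (i,p) * cnj (U $$ (i,q)) else 0)"
      by (intro sum.cong) (auto simp: Wi)
    then show "(\<Sum>i<n. W $$ (i,p) * cnj (W $$ (i,q))) = (if p = q \<and> p \<in> {..<n} then 1 else 0)"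
      using gU by (cases "p < n \<and> q < n") auto
  qed auto
  show "ptr {n..<n+k} (W * P * adj W) = ptr {n..<n+k} P"
  proof (rule ptr_conj[OF W(1) P])
    fix p q assume pq: "p < n + k" "q < n + k"
    have "(\<Sum>i\<in>{n..<n+k}. W $$ (i,p) * cnj (W $$ (i,q))) = (\<Sum>i<k. W $$ (n + i,p) * cnj (W $$ (n + i,q)))"
      using sum.shift_bounds_nat_ivl[of "\<lambda>i. W $$ (i,p) * cnj (W $$ (i,q))" 0 n k] 
      by (simp add: add.commute lessThan_atLeast0)
    also have "\<dots> = (\<Sum>i<k. if \<not> p < n \<and> \<not> q < n then V $$ (i,p - n) * cnj (V $$ (i,q - n)) else 0)"
      using pq by (intro sum.cong) (auto simp: Wi)
    also have "\<dots> = (if p = q \<and> p \<in> {n..<n+k} then 1 else 0)"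
      using gV[of "p - n" "q - n"] pq by (cases "\<not> p < n \<and> \<not> q < n") auto
    finally show "(\<Sum>i\<in>{n..<n+k}. W $$ (i,p) * cnj (W $$ (i,q))) = (if p = q \<and> p \<in> {n..<n+k} then 1 else 0)" .
  qed auto
qed

section \<open>Fourth moments of invariant quadratic forms\<close>

definition join :: "nat \<Rightarrow> (nat \<Rightarrow> complex) \<Rightarrow> (nat \<Rightarrow> complex) \<Rightarrow> nat \<Rightarrow> complex" where
  "join n x y i = (if i < n then x i else y (i - n))"

lemma sum_join: "(\<Sum>i<n+(k::nat). f i) = (\<Sum>i<n. f i) + (\<Sum>i<k. f (n + i) :: 'a :: comm_monoid_add)"
  by (induction k) (auto simp: add.assoc)

text \<open>The fourth power of the deviation of \<open>w\<^sup>H H\<^sup>p w\<close> from its mean over random signs, truncated where the Frobenius norm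
  of \<open>H\<^sup>p\<close> is large so that its moments are finite.\<close>

definition dev4 :: "nat \<Rightarrow> nat \<Rightarrow> nat \<Rightarrow> (nat \<Rightarrow> complex) \<Rightarrow> real \<Rightarrow> real \<Rightarrow> real \<Rightarrow> complex mat \<Rightarrow> real" where
  "dev4 n k p w \<alpha> \<beta> B A = (let H = dil n k A in
     if Re (ptr {..<n} (H ^\<^sub>m (2 * p))) + Re (ptr {n..<n+k} (H ^\<^sub>m (2 * p))) \<le> B
     then (Re (ip (n + k) w (mv (n + k) (H ^\<^sub>m p) w))
        - (\<alpha> / real n * Re (ptr {..<n} (H ^\<^sub>m p)) + \<beta> / real k * Re (ptr {n..<n+k} (H ^\<^sub>m p)))) ^ 4
     else 0)"

lemma dev4_nonneg: "0 \<le> dev4 n k p w \<alpha> \<beta> B A"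
  by (simp add: dev4_def Let_def)

lemma double_sum_split:
  "(\<Sum>i<(N::nat). \<Sum>j<N. g i j) = (\<Sum>i<N. g i i) + (\<Sum>i<N. \<Sum>j<i. g i j + g j i :: real)"
  by (induction N) (auto simp: sum.distrib)

text \<open>The truncation condition and the subtracted mean are built from partial traces, which
  block diagonal unitaries preserve; only the vector is transported.\<close>

lemma dev4_conj:
  assumes U: "U \<in> carrier_mat n n" "U * adj U = 1\<^sub>m n" and V: "V \<in> carrier_mat k k" "V * adj V = 1\<^sub>m k"
    and A: "A \<in> carrier_mat n k"
    and x: "\<And>i. i < n \<Longrightarrow> x i = (\<Sum>j<n. U $$ (i,j) * x' j)" and y: "\<And>i. i < k \<Longrightarrow> y i = (\<Sum>j<k. V $$ (i,j) * y' j)"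
  shows "dev4 n k p (join n x y) \<alpha> \<beta> B (U * A * adj V) = dev4 n k p (join n x' y') \<alpha> \<beta> B A"
proof -
  define W where "W = four_block_mat U (0\<^sub>m n k) (0\<^sub>m k n) V"
  note W = block_unitary[OF U V, folded W_def]
  note d = dil_conj[OF U(1) V(1) A, folded W_def]
  have H: "dil n k A ^\<^sub>m q \<in> carrier_mat (n + k) (n + k)" for q by simp
  have pw: "dil n k (U * A * adj V) ^\<^sub>m q = W * dil n k A ^\<^sub>m q * adj W" for q
    unfolding d by (rule conj_pow[OF W(1,2) dil_carrier])
  have Wi: "W $$ (i,p) = (if i < n then (if p < n then U $$ (i,p) else 0) else if p < n then 0 else V $$ (i - n, p - n))"
    if "i < n + k" "p < n + k" for i p
    using that U V by (auto simp: W_def)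
  have w: "join n x y i = mv (n + k) W (join n x' y') i" if "i < n + k" for i
    unfolding mv_def sum_join using that by (auto simp: Wi join_def x y)
  note pt = ptr_block_conj[OF U V H, folded W_def]
  note ipc = ip_conj[OF W(1,2) H w]
  show ?thesis unfolding dev4_def Let_def pw pt by (subst ipc) auto
qed

text \<open>A bound for each fixed matrix. Since squared signs are 1, the diagonal part of the form
  is exactly the mean subtracted in \<open>dev4\<close>. The squared coefficients of the
  off-diagonal rest sum to at most 4 ((\<alpha> + \<beta>)/n)^2 B, and 81 * 4^2 = 1296.\<close>

lemma sgn_avg_dev4:
  assumes A: "A \<in> carrier_mat n k" and n: "1 \<le> n" "n \<le> k" and ab: "0 \<le> \<alpha>" "0 \<le> \<beta>" and B: "0 \<le> B"
  shows "sgn_avg (n + k) (\<lambda>e. dev4 n k p (join n (\<lambda>i. of_real (sqrt (\<alpha> / n) * e i)) 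
     (\<lambda>i. of_real (sqrt (\<beta> / k) * e (n + i)))) \<alpha> \<beta> B A) \<le> 1296 * (\<alpha> + \<beta>) ^ 4 * B\<^sup>2 / real n ^ 4"
proof (cases "Re (ptr {..<n} (dil n k A ^\<^sub>m (2 * p))) + Re (ptr {n..<n+k} (dil n k A ^\<^sub>m (2 * p))) \<le> B")
  case False
  then show ?thesis using ab by (simp add: dev4_def Let_def)
next
  case True
  define P where "P = dil n k A ^\<^sub>m p"
  define s where "s i = (if i < n then sqrt (\<alpha> / n) else sqrt (\<beta> / k))" for i
  \<comment> \<open>The factor 2 merges the terms (i,j) and (j,i), whose real parts agree because P
    is Hermitian.\<close>
  define a where "a i j = 2 * (s i * s j * Re (P $$ (i,j)))" for i j
  have P: "P \<in> carrier_mat (n + k) (n + k)" by (simp add: P_def)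
  have PH: "adj P = P" unfolding P_def by (rule adj_pow[OF dil_carrier dil_adj[OF A]])
  have Pij: "Re (P $$ (j,i)) = Re (P $$ (i,j))" if "i < n + k" "j < n + k" for i j
    using hermitian_index[OF PH P that] by (metis complex_cnj(1) cnj.simps(1))
  have tot: "ptr {..<n} Q + ptr {n..<n+k} Q = ptr {..<n+k} Q" for Q
    unfolding ptr_def by (subst sum.union_disjoint[symmetric]) (auto simp: ivl_disj_un)
  have PP: "P * P = dil n k A ^\<^sub>m (2 * p)" unfolding P_def
    by (subst pow_add[OF dil_carrier]) (simp add: mult_2)
  have Fr: "(\<Sum>i<n+k. \<Sum>j<n+k. (cmod (P $$ (i,j)))\<^sup>2) \<le> B"
    using True frobenius_ptr[OF P PH] arg_cong[OF tot, of Re "P * P"] by (simp add: PP)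
  have s0: "0 \<le> s i" for i using ab by (simp add: s_def)
  have s2: "(s i)\<^sup>2 = (if i < n then \<alpha> / n else \<beta> / k)" for i using ab by (simp add: s_def)
  have s2le: "(s i)\<^sup>2 \<le> (\<alpha> + \<beta>) / n" for i
  proof -
    have "\<beta> / k \<le> \<beta> / n" using ab n by (intro divide_left_mono) auto
    moreover have "0 \<le> \<alpha> / n" "0 \<le> \<beta> / n" using ab by auto
    ultimately show ?thesis unfolding s2 add_divide_distrib by auto
  qed
  have dv: "dev4 n k p (join n (\<lambda>i. of_real (sqrt (\<alpha> / n) * e i)) (\<lambda>i. of_real (sqrt (\<beta> / k) * e (n + i)))) \<alpha> \<beta> B A
      = (\<Sum>i<n+k. \<Sum>j<i. a i j * e i * e j) ^ 4" if e: "\<And>i. e i \<in> {1, -1}" for e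
  proof -
    let ?w = "join n (\<lambda>i. complex_of_real (sqrt (\<alpha> / n) * e i)) (\<lambda>i. complex_of_real (sqrt (\<beta> / k) * e (n + i)))"
    have w: "?w i = of_real (s i * e i)" for i by (simp add: join_def s_def)
    have e2: "e i * e i = 1" for i using e[of i] by auto
    have "Re (ip (n + k) ?w (mv (n + k) P ?w)) = (\<Sum>i<n+k. \<Sum>j<n+k. s i * e i * Re (P $$ (i,j)) * (s j * e j))"
      unfolding ip_def mv_def w by (simp add: sum_distrib_left mult.assoc)
    also have "\<dots> = (\<Sum>i<n+k. s i * e i * Re (P $$ (i,i)) * (s i * e i)) + 
       (\<Sum>i<n+k. \<Sum>j<i. s i * e i * Re (P $$ (i,j)) * (s j * e j) + s j * e j * Re (P $$ (j,i)) * (s i * e i))"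
      by (rule double_sum_split)
    also have "(\<Sum>i<n+k. \<Sum>j<i. s i * e i * Re (P $$ (i,j)) * (s j * e j) + s j * e j * Re (P $$ (j,i)) * (s i * e i))
       = (\<Sum>i<n+k. \<Sum>j<i. a i j * e i * e j)"
      by (intro sum.cong refl) (simp add: a_def Pij)
    also have "(\<Sum>i<n+k. s i * e i * Re (P $$ (i,i)) * (s i * e i)) = (\<Sum>i<n+k. (s i)\<^sup>2 * Re (P $$ (i,i)))"
    proof (intro sum.cong refl)
      fix i
      have "s i * e i * r * (s i * e i) = (e i * e i) * ((s i)\<^sup>2 * r)" for r by (simp add: power2_eq_square)
      then show "s i * e i * Re (P $$ (i,i)) * (s i * e i) = (s i)\<^sup>2 * Re (P $$ (i,i))" by (simp add: e2)
    qed
    also have "\<dots> = \<alpha> / n * Re (ptr {..<n} P) + \<beta> / k * Re (ptr {n..<n+k} P)"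
    proof -
      have "ptr {n..<n+k} P = (\<Sum>i<k. P $$ (n + i, n + i))"
        unfolding ptr_def using sum.shift_bounds_nat_ivl[of "\<lambda>i. P $$ (i,i)" 0 n k]
        by (simp add: add.commute lessThan_atLeast0)
      then show ?thesis unfolding sum_join by (simp add: ptr_def s2 sum_distrib_left)
    qed
    finally show ?thesis using True unfolding dev4_def Let_def P_def by simp
  qed
  have "sgn_avg (n + k) (\<lambda>e. dev4 n k p (join n (\<lambda>i. of_real (sqrt (\<alpha> / n) * e i)) 
     (\<lambda>i. of_real (sqrt (\<beta> / k) * e (n + i)))) \<alpha> \<beta> B A) = 
     sgn_avg (n + k) (\<lambda>e. (\<Sum>i<n+k. \<Sum>j<i. a i j * e i * e j) ^ 4)"
    by (rule sgn_avg_cong) (rule dv)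
  also have "\<dots> \<le> 81 * (\<Sum>i<n+k. \<Sum>j<i. (a i j)\<^sup>2)\<^sup>2" by (rule sgn_avg_quadratic4)
  also have "(\<Sum>i<n+k. \<Sum>j<i. (a i j)\<^sup>2) \<le> 4 * ((\<alpha> + \<beta>) / n)\<^sup>2 * B"
  proof -
    have "(\<Sum>i<n+k. \<Sum>j<i. (a i j)\<^sup>2) \<le> (\<Sum>i<n+k. \<Sum>j<n+k. (a i j)\<^sup>2)"
      by (intro sum_mono sum_mono2) auto
    also have "\<dots> \<le> (\<Sum>i<n+k. \<Sum>j<n+k. 4 * ((\<alpha> + \<beta>) / n)\<^sup>2 * (cmod (P $$ (i,j)))\<^sup>2)"
    proof (intro sum_mono)
      fix i j
      have "(a i j)\<^sup>2 = 4 * ((s i)\<^sup>2 * (s j)\<^sup>2) * (Re (P $$ (i,j)))\<^sup>2"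
        by (simp add: a_def power_mult_distrib)
      also have "\<dots> \<le> 4 * ((\<alpha> + \<beta>) / n)\<^sup>2 * (cmod (P $$ (i,j)))\<^sup>2"
      proof (rule mult_mono)
        show "4 * ((s i)\<^sup>2 * (s j)\<^sup>2) \<le> 4 * ((\<alpha> + \<beta>) / n)\<^sup>2"
          unfolding power2_eq_square[of "(\<alpha> + \<beta>) / n"]
          using s2le ab by (intro mult_left_mono mult_mono) auto
        show "(Re (P $$ (i,j)))\<^sup>2 \<le> (cmod (P $$ (i,j)))\<^sup>2" by (simp add: cmod_power2)
      qed auto
      finally show "(a i j)\<^sup>2 \<le> 4 * ((\<alpha> + \<beta>) / n)\<^sup>2 * (cmod (P $$ (i,j)))\<^sup>2" .
    qed
    also have "\<dots> = 4 * ((\<alpha> + \<beta>) / n)\<^sup>2 * (\<Sum>i<n+k. \<Sum>j<n+k. (cmod (P $$ (i,j)))\<^sup>2)"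
      by (simp only: sum_distrib_left)
    also have "\<dots> \<le> 4 * ((\<alpha> + \<beta>) / n)\<^sup>2 * B" using Fr by (intro mult_left_mono) auto
    finally show ?thesis .
  qed
  then have "81 * (\<Sum>i<n+k. \<Sum>j<i. (a i j)\<^sup>2)\<^sup>2 \<le> 81 * (4 * ((\<alpha> + \<beta>) / n)\<^sup>2 * B)\<^sup>2"
    by (intro mult_left_mono power_mono) (auto intro!: sum_nonneg)
  also have "\<dots> = 1296 * (\<alpha> + \<beta>) ^ 4 * B\<^sup>2 / real n ^ 4"
    by (simp add: power_mult_distrib power_divide flip: power_mult)
  finally show ?thesis .
qed

section \<open>Measurability and expectation of the truncated deviation\<close>

lemma dil_pow_measurable:
  assumes "i < n + k" "j < n + k"
  shows "(\<lambda>e. (dil n k (mat n k e) ^\<^sub>m p) $$ (i,j)) \<in> borel_measurable (mat_space n k)"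
  using assms
proof (induction p arbitrary: i j)
  case (Suc p)
  have base: "(\<lambda>e. dil n k (mat n k e) $$ (l,j)) \<in> borel_measurable (mat_space n k)" if "l < n + k" for l
  proof -
    have [measurable]: "(\<lambda>e. e (i,j)) \<in> borel_measurable (mat_space n k)" if "i < n" "j < k" for i j
      unfolding mat_space_def using that by (intro measurable_component_singleton) auto
    have [measurable]: "(\<lambda>e. cnj (e (i,j))) \<in> borel_measurable (mat_space n k)" if "i < n" "j < k" for i j
      by (rule measurable_compose[of _ _ borel]) (use that in \<open>auto intro!: borel_measurable_continuous_onI continuous_intros\<close>)
    show ?thesis
      using that Suc.prems by (cases "l < n"; cases "j < n") (auto simp: dil_index[of _ n k])
  qed
  have "(\<lambda>e. (dil n k (mat n k e) ^\<^sub>m Suc p) $$ (i,j)) = 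
     (\<lambda>e. \<Sum>l<n+k. (dil n k (mat n k e) ^\<^sub>m p) $$ (i,l) * dil n k (mat n k e) $$ (l,j))"
  proof
    fix e
    show "(dil n k (mat n k e) ^\<^sub>m Suc p) $$ (i,j) = 
      (\<Sum>l<n+k. (dil n k (mat n k e) ^\<^sub>m p) $$ (i,l) * dil n k (mat n k e) $$ (l,j))"
      unfolding pow_mat.simps
      by (rule mult_index[OF pow_carrier[OF dil_carrier] dil_carrier Suc.prems])
  qed
  also have "\<dots> \<in> borel_measurable (mat_space n k)"
    using Suc base by (intro borel_measurable_sum borel_measurable_times) auto
  finally show ?case .
qed (auto simp: carrier_matD[OF dil_carrier])

lemma dev4_measurable:
  "(\<lambda>e. dev4 n k p w \<alpha> \<beta> B (mat n k e)) \<in> borel_measurable (mat_space n k)"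
proof -
  define q where "q e = Re (ip (n + k) w (mv (n + k) (dil n k (mat n k e) ^\<^sub>m p) w))" for e
  define t where "t I l e = Re (ptr I (dil n k (mat n k e) ^\<^sub>m l))" for I l e
  have [measurable]: "t I l \<in> borel_measurable (mat_space n k)" if "I \<subseteq> {..<n+k}" for I l
    unfolding t_def ptr_def
    by (rule measurable_compose[OF _ borel_measurable_Re], rule borel_measurable_sum, rule dil_pow_measurable) (use that in auto)
  then have [measurable]: "t {..<n} l \<in> borel_measurable (mat_space n k)" "t {n..<n+k} l \<in> borel_measurable (mat_space n k)" for l
    by (auto simp: subset_iff)
  have [measurable]: "q \<in> borel_measurable (mat_space n k)"
    unfolding q_def ip_def mv_def
    by (rule measurable_compose[OF _ borel_measurable_Re], 
        intro borel_measurable_sum borel_measurable_times borel_measurable_const)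
       (rule dil_pow_measurable, auto)
  show ?thesis unfolding dev4_def Let_def q_def[symmetric] t_def[symmetric] by measurable
qed

lemma mat_entries: "A \<in> carrier_mat n k \<Longrightarrow> mat n k (entries n k A) = A"
  by (rule eq_matI) (auto simp: entries_def)

lemma entries_measurable:
  assumes "\<And>i j. i < n \<Longrightarrow> j < k \<Longrightarrow> (\<lambda>\<omega>. Y \<omega> $$ (i,j)) \<in> borel_measurable M"
  shows "(\<lambda>\<omega>. entries n k (Y \<omega>)) \<in> measurable M (mat_space n k)"
  unfolding entries_def mat_space_def by (rule measurable_restrict) (use assms in auto)

text \<open>By invariance the expectation is unchanged when (x, y) is replaced by any scaled sign
  vector, so it equals the expectation of the sign average, which is bounded for each
  matrix.\<close>

lemma dev4_expectation:
  assumes n: "1 \<le> n" "n \<le> k" and B: "0 \<le> B"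
    and X: "\<And>\<omega>. \<omega> \<in> space M \<Longrightarrow> X \<omega> \<in> carrier_mat n k"
    and X_meas: "\<And>i j. i < n \<Longrightarrow> j < k \<Longrightarrow> (\<lambda>\<omega>. X \<omega> $$ (i, j)) \<in> borel_measurable M"
    and inv: "\<And>U V. K_unitary realK n U \<Longrightarrow> K_unitary realK k V \<Longrightarrow>
          distr M (mat_space n k) (\<lambda>\<omega>. entries n k (U * X \<omega> * V)) = distr M (mat_space n k) (\<lambda>\<omega>. entries n k (X \<omega>))"
    and x: "nsq n x = \<alpha>" "realK \<Longrightarrow> \<forall>i<n. Im (x i) = 0"
    and y: "nsq k y = \<beta>" "realK \<Longrightarrow> \<forall>i<k. Im (y i) = 0"
    and M: "prob_space M"
  shows "(\<integral>\<^sup>+\<omega>. ennreal (dev4 n k p (join n x y) \<alpha> \<beta> B (X \<omega>)) \<partial>M) \<le> ennreal (1296 * (\<alpha> + \<beta>) ^ 4 * B\<^sup>2 / real n ^ 4)"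
proof -
  interpret prob_space M by fact
  have ab: "0 \<le> \<alpha>" "0 \<le> \<beta>" using x(1) y(1) nsq_nonneg by metis+
  define ws where "ws e = join n (\<lambda>i. complex_of_real (sqrt (\<alpha> / n) * e i)) (\<lambda>i. complex_of_real (sqrt (\<beta> / k) * e (n + i)))"
    for e :: "nat \<Rightarrow> real"
  let ?C = "\<integral>\<^sup>+\<omega>. ennreal (dev4 n k p (join n x y) \<alpha> \<beta> B (X \<omega>)) \<partial>M"
  note eX = entries_measurable[OF X_meas]
  have dX: "(\<integral>\<^sup>+e. ennreal (dev4 n k p w \<alpha> \<beta> B (mat n k e)) \<partial>distr M (mat_space n k) (\<lambda>\<omega>. entries n k (Y \<omega>)))
     = (\<integral>\<^sup>+\<omega>. ennreal (dev4 n k p w \<alpha> \<beta> B (Y \<omega>)) \<partial>M)"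
    if "(\<lambda>\<omega>. entries n k (Y \<omega>)) \<in> measurable M (mat_space n k)" "\<And>\<omega>. \<omega> \<in> space M \<Longrightarrow> Y \<omega> \<in> carrier_mat n k" for w Y
    using that dev4_measurable[of n k p w \<alpha> \<beta> B]
    by (subst nn_integral_distr) (auto simp: mat_entries intro!: nn_integral_cong)
  have main: "(\<integral>\<^sup>+\<omega>. ennreal (dev4 n k p (ws e) \<alpha> \<beta> B (X \<omega>)) \<partial>M) = ?C" if e: "\<And>i. e i \<in> {1, -1}" for e
  proof -
    have e2: "(e i)\<^sup>2 = 1" for i using e[of i] by auto
    \<comment> \<open>All n sign entries have modulus sqrt(\<alpha>/n), so the norms agree and a
      fixed unitary over K carries the sign vector to \<open>x\<close>.\<close>
    have "nsq n x = nsq n (\<lambda>i. complex_of_real (sqrt (\<alpha> / n) * e i))"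
      unfolding x(1) using n ab by (simp add: nsq_def norm_mult power_mult_distrib e2)
    from householder[OF this] obtain U where U: "U \<in> carrier_mat n n" "U * adj U = 1\<^sub>m n" and
      Ux: "\<And>i. i < n \<Longrightarrow> (\<Sum>j<n. U $$ (i,j) * complex_of_real (sqrt (\<alpha> / n) * e j)) = x i" and
      UR: "realK \<Longrightarrow> \<forall>i<n. \<forall>j<n. Im (U $$ (i,j)) = 0"
      using x(2) by auto
    have "nsq k y = nsq k (\<lambda>i. complex_of_real (sqrt (\<beta> / k) * e (n + i)))"
      unfolding y(1) using n ab by (simp add: nsq_def norm_mult power_mult_distrib e2)
    from householder[OF this] obtain V where V: "V \<in> carrier_mat k k" "V * adj V = 1\<^sub>m k" and
      Vy: "\<And>i. i < k \<Longrightarrow> (\<Sum>j<k. V $$ (i,j) * complex_of_real (sqrt (\<beta> / k) * e (n + j))) = y i" and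
      VR: "realK \<Longrightarrow> \<forall>i<k. \<forall>j<k. Im (V $$ (i,j)) = 0"
      using y(2) by auto
    have KU: "K_unitary realK n U" using U UR by (simp add: K_unitary_def K_mat_def)
    \<comment> \<open>Invariance is stated for U X V, so V^H is taken as the right factor; on the
      dilation this is conjugation by diag(U, V).\<close>
    have KV: "K_unitary realK k (adj V)" using V VR unitary_left[OF V] by (simp add: K_unitary_def K_mat_def)
    have aV: "adj V \<in> carrier_mat k k" using V by simp
    have Yc: "U * X \<omega> * adj V \<in> carrier_mat n k" if "\<omega> \<in> space M" for \<omega> using U aV X[OF that] by auto
    have "(\<lambda>\<omega>. (U * X \<omega> * adj V) $$ (i,j)) \<in> borel_measurable M" if ij: "i < n" "j < k" for i j
    proof -
      have "(U * X \<omega> * adj V) $$ (i,j) = (\<Sum>q<k. (\<Sum>p<n. U $$ (i,p) * X \<omega> $$ (p,q)) * adj V $$ (q,j))" 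
        if "\<omega> \<in> space M" for \<omega>
      proof -
        have UX: "U * X \<omega> \<in> carrier_mat n k" using U X[OF that] by simp
        show ?thesis unfolding mult_index[OF UX aV ij] 
          by (intro sum.cong refl) (use ij in \<open>simp add: mult_index[OF U(1) X[OF that]] del: index_mult_mat\<close>)
      qed
      then show ?thesis using X_meas ij
        by (subst measurable_cong) (auto intro!: borel_measurable_sum borel_measurable_times)
    qed
    note eY = entries_measurable[OF this]
    have "?C = (\<integral>\<^sup>+e. ennreal (dev4 n k p (join n x y) \<alpha> \<beta> B (mat n k e)) \<partial>distr M (mat_space n k) (\<lambda>\<omega>. entries n k (X \<omega>)))"
      by (rule dX[OF eX X, symmetric])
    also have "\<dots> = (\<integral>\<^sup>+\<omega>. ennreal (dev4 n k p (join n x y) \<alpha> \<beta> B (U * X \<omega> * adj V)) \<partial>M)"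
      unfolding inv[OF KU KV, symmetric] by (rule dX[OF eY Yc])
    also have "\<dots> = (\<integral>\<^sup>+\<omega>. ennreal (dev4 n k p (ws e) \<alpha> \<beta> B (X \<omega>)) \<partial>M)"
      unfolding ws_def
      by (intro nn_integral_cong arg_cong[of _ _ ennreal] dev4_conj[OF U V X]) (simp_all only: Ux Vy)
    finally show ?thesis by simp
  qed
  have meas: "(\<lambda>\<omega>. dev4 n k p w \<alpha> \<beta> B (X \<omega>)) \<in> borel_measurable M" for w
  proof -
    have me: "mat n k (entries n k (X \<omega>)) = X \<omega>" if "\<omega> \<in> space M" for \<omega>
      by (rule mat_entries[OF X[OF that]])
    have "(\<lambda>\<omega>. dev4 n k p w \<alpha> \<beta> B (X \<omega>)) \<in> borel_measurable M \<longleftrightarrow>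
        (\<lambda>\<omega>. dev4 n k p w \<alpha> \<beta> B (mat n k (entries n k (X \<omega>)))) \<in> borel_measurable M"
      by (rule measurable_cong) (simp only: me)
    then show ?thesis using measurable_compose[OF eX dev4_measurable[of n k p w \<alpha> \<beta> B]] by blast
  qed
  have "?C = (\<integral>\<^sup>+\<omega>. ennreal (sgn_avg (n + k) (\<lambda>e. dev4 n k p (ws e) \<alpha> \<beta> B (X \<omega>))) \<partial>M)"
    using nn_integral_sgn_avg[of "\<lambda>e \<omega>. dev4 n k p (ws e) \<alpha> \<beta> B (X \<omega>)" M ?C "n + k"] main meas dev4_nonneg by simp
  also have "\<dots> \<le> (\<integral>\<^sup>+\<omega>. ennreal (1296 * (\<alpha> + \<beta>) ^ 4 * B\<^sup>2 / real n ^ 4) \<partial>M)"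
    unfolding ws_def by (intro nn_integral_mono ennreal_leI sgn_avg_dev4[OF X n ab B])
  also have "\<dots> = ennreal (1296 * (\<alpha> + \<beta>) ^ 4 * B\<^sup>2 / real n ^ 4)" by (simp add: emeasure_space_1)
  finally show ?thesis .
qed

section \<open>Traces of powers of the dilation\<close>

lemma ptr_mult_commute:
  assumes B: "B \<in> carrier_mat n k" and C: "C \<in> carrier_mat k n"
  shows "ptr {..<n} (B * C) = ptr {..<k} (C * B)"
proof -
  have "ptr {..<n} (B * C) = (\<Sum>i<n. \<Sum>j<k. B $$ (i,j) * C $$ (j,i))"
    unfolding ptr_def by (intro sum.cong refl) (simp add: mult_index[OF B C] del: index_mult_mat)
  also have "\<dots> = (\<Sum>j<k. \<Sum>i<n. B $$ (i,j) * C $$ (j,i))" by (rule sum.swap)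
  also have "\<dots> = ptr {..<k} (C * B)"
    unfolding ptr_def by (intro sum.cong refl) (simp add: mult_index[OF C B] mult.commute del: index_mult_mat)
  finally show ?thesis .
qed

lemma diagm_pow: "diagm n f ^\<^sub>m j = diagm n (\<lambda>i. f i ^ j)"
proof (induction j)
  case (Suc j)
  have "diagm n (\<lambda>i. f i ^ j) * diagm n f = diagm n (\<lambda>i. f i ^ Suc j)"
  proof (rule eq_matI)
    fix i l assume "i < dim_row (diagm n (\<lambda>i. f i ^ Suc j))" "l < dim_col (diagm n (\<lambda>i. f i ^ Suc j))"
    then have il: "i < n" "l < n" by (auto simp: diagm_def)
    have "(diagm n (\<lambda>i. f i ^ j) * diagm n f) $$ (i,l) = (\<Sum>p<n. if p = i then (if i = l then f i ^ j * f i else 0) else 0)"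
      unfolding mult_index[OF diagm_carrier diagm_carrier il]
      by (intro sum.cong refl) (use il in \<open>auto simp: diagm_def\<close>)
    also have "\<dots> = diagm n (\<lambda>i. f i ^ Suc j) $$ (i,l)" using il by (auto simp: diagm_def)
    finally show "(diagm n (\<lambda>i. f i ^ j) * diagm n f) $$ (i,l) = diagm n (\<lambda>i. f i ^ Suc j) $$ (i,l)" .
  qed (auto simp: diagm_def)
  then show ?case by (simp add: Suc)
qed (auto simp: diagm_def intro!: eq_matI)

lemma trace_gram_pow:
  assumes A: "A \<in> carrier_mat n k"
  shows "ptr {..<n} ((A * adj A) ^\<^sub>m j) = of_real (\<Sum>i<n. (sval A (Suc i)) ^ (2 * j))"
proof -
  obtain U where U: "U \<in> carrier_mat n n" "U * adj U = 1\<^sub>m n" 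
    "A * adj A = U * diagm n (\<lambda>i. of_real ((sing_vals A ! i)\<^sup>2)) * adj U" (is "_ = U * ?D * adj U")
    using sing_vals_decomposition(4)[OF A] by blast
  have "ptr {..<n} ((A * adj A) ^\<^sub>m j) = ptr {..<n} (U * ?D ^\<^sub>m j * adj U)"
    unfolding U(3) by (subst conj_pow[OF U(1,2) diagm_carrier]) simp
  also have "\<dots> = ptr {..<n} (?D ^\<^sub>m j)"
  proof (rule ptr_conj[OF U(1)])
    fix p q assume pq: "p < n" "q < n"
    show "(\<Sum>i<n. U $$ (i,p) * cnj (U $$ (i,q))) = (if p = q \<and> p \<in> {..<n} then 1 else 0)"
      using mult_index[OF adj_carrier[OF U(1)] U(1) pq(2,1)] unitary_left[OF U(1,2)] pq U(1)
      by (auto simp: mult.commute)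
  qed auto
  also have "\<dots> = of_real (\<Sum>i<n. (sval A (Suc i)) ^ (2 * j))"
    unfolding diagm_pow by (simp add: ptr_def diagm_def sval_def power_mult)
  finally show ?thesis .
qed

lemma dil_even_pow:
  assumes A: "A \<in> carrier_mat n k"
  shows "dil n k A ^\<^sub>m (2 * j) = four_block_mat ((A * adj A) ^\<^sub>m j) (0\<^sub>m n k) (0\<^sub>m k n) ((adj A * A) ^\<^sub>m j)"
proof (induction j)
  case 0
  show ?case by (simp add: dil_def carrier_matD[OF A])
next
  case (Suc j)
  have aA: "adj A \<in> carrier_mat k n" using A by simp
  have sq: "dil n k A * dil n k A = four_block_mat (A * adj A) (0\<^sub>m n k) (0\<^sub>m k n) (adj A * A)"
    unfolding dil_def using A aA
    by (subst mult_four_block_mat[OF zero_carrier_mat A aA zero_carrier_mat zero_carrier_mat A aA zero_carrier_mat])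
       (simp add: left_mult_zero_mat[OF A] right_mult_zero_mat[OF A] left_mult_zero_mat[OF aA] right_mult_zero_mat[OF aA]
         right_add_zero_mat[OF mult_carrier_mat[OF aA A]])
  have "dil n k A ^\<^sub>m (2 * Suc j) = dil n k A ^\<^sub>m (2 * j) * (dil n k A * dil n k A)"
    using assoc_square[OF pow_carrier[OF dil_carrier] dil_carrier dil_carrier] by simp
  also have "\<dots> = four_block_mat ((A * adj A) ^\<^sub>m Suc j) (0\<^sub>m n k) (0\<^sub>m k n) ((adj A * A) ^\<^sub>m Suc j)"
    unfolding Suc sq using A aA by (subst block_diag_mult) auto
  finally show ?case .
qed

lemma ptr_lower: "ptr {n..<n+k} P = (\<Sum>i<k. P $$ (n + i, n + i))"
  unfolding ptr_def using sum.shift_bounds_nat_ivl[of "\<lambda>i. P $$ (i,i)" 0 n k]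
  by (simp add: add.commute lessThan_atLeast0)

text \<open>Odd powers have vanishing diagonal entries. For even p > 0 cyclicity gives both blocks
  the same trace, while p = 0 is an exception since the identity blocks have sizes n and k.\<close>

lemma trace_dil_pow:
  assumes A: "A \<in> carrier_mat n k"
  shows "ptr {..<n} (dil n k A ^\<^sub>m p) = (if even p then of_real (\<Sum>i<n. (sval A (Suc i)) ^ p) else 0)"
    "ptr {n..<n+k} (dil n k A ^\<^sub>m p) = (if p = 0 then of_nat k else if even p then of_real (\<Sum>i<n. (sval A (Suc i)) ^ p) else 0)"
proof -
  have aA: "adj A \<in> carrier_mat k n" using A by simp
  have P: "(A * adj A) ^\<^sub>m j \<in> carrier_mat n n" and R: "(adj A * A) ^\<^sub>m j \<in> carrier_mat k k" for j using A aA by auto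
  have odd: "(dil n k A ^\<^sub>m Suc (2 * j)) $$ (i,i) = 0" if i: "i < n + k" for i j
  proof -
    have "(dil n k A ^\<^sub>m Suc (2 * j)) $$ (i,i) = (\<Sum>l<n+k. (dil n k A ^\<^sub>m (2 * j)) $$ (i,l) * dil n k A $$ (l,i))"
      unfolding pow_mat.simps by (rule mult_index[OF pow_carrier[OF dil_carrier] dil_carrier i i])
    also have "\<dots> = 0"
      unfolding dil_even_pow[OF A] using i P[of j, THEN carrier_matD(1)] P[of j, THEN carrier_matD(2)]
        R[of j, THEN carrier_matD(1)] R[of j, THEN carrier_matD(2)]
      by (intro sum.neutral) (auto simp: dil_index[OF A])
    finally show ?thesis .
  qed
  have RP: "(adj A * A) ^\<^sub>m Suc j = adj A * ((A * adj A) ^\<^sub>m j * A)" for j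
  proof (induction j)
    case (Suc j)
    have PA: "(A * adj A) ^\<^sub>m j * A \<in> carrier_mat n k" using mult_carrier_mat[OF P A] .
    have "(adj A * A) ^\<^sub>m Suc (Suc j) = (adj A * ((A * adj A) ^\<^sub>m j * A)) * (adj A * A)"
      by (subst pow_mat.simps(2), subst Suc) simp
    also have "\<dots> = adj A * (((A * adj A) ^\<^sub>m j * A) * (adj A * A))"
      by (rule assoc_mult_mat[OF aA PA mult_carrier_mat[OF aA A]])
    also have "((A * adj A) ^\<^sub>m j * A) * (adj A * A) = ((A * adj A) ^\<^sub>m j * A) * adj A * A"
      by (rule assoc_mult_mat[OF PA aA A, symmetric])
    also have "((A * adj A) ^\<^sub>m j * A) * adj A = (A * adj A) ^\<^sub>m j * (A * adj A)"
      by (rule assoc_mult_mat[OF P A aA])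
    finally show ?case by simp
  qed (use A aA in simp)
  have upper: "ptr {..<n} (dil n k A ^\<^sub>m (2 * j)) = ptr {..<n} ((A * adj A) ^\<^sub>m j)" for j
    unfolding dil_even_pow[OF A] ptr_def using P[of j, THEN carrier_matD(1)] P[of j, THEN carrier_matD(2)]
        R[of j, THEN carrier_matD(1)] R[of j, THEN carrier_matD(2)] by simp
  have lower: "ptr {n..<n+k} (dil n k A ^\<^sub>m (2 * j)) = ptr {..<k} ((adj A * A) ^\<^sub>m j)" for j
    unfolding dil_even_pow[OF A] ptr_lower using P[of j, THEN carrier_matD(1)] P[of j, THEN carrier_matD(2)]
        R[of j, THEN carrier_matD(1)] R[of j, THEN carrier_matD(2)] by (simp add: ptr_def)
  have lower': "ptr {n..<n+k} (dil n k A ^\<^sub>m (2 * Suc j)) = ptr {..<n} ((A * adj A) ^\<^sub>m Suc j)" for j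
  proof -
    have "ptr {n..<n+k} (dil n k A ^\<^sub>m (2 * Suc j)) = ptr {..<k} (adj A * ((A * adj A) ^\<^sub>m j * A))"
      unfolding lower RP ..
    also have "\<dots> = ptr {..<n} ((A * adj A) ^\<^sub>m j * A * adj A)"
      by (rule ptr_mult_commute[symmetric, OF mult_carrier_mat[OF P A] aA])
    also have "(A * adj A) ^\<^sub>m j * A * adj A = (A * adj A) ^\<^sub>m Suc j"
      using assoc_mult_mat[OF P A aA] by simp
    finally show ?thesis .
  qed
  show "ptr {..<n} (dil n k A ^\<^sub>m p) = (if even p then of_real (\<Sum>i<n. (sval A (Suc i)) ^ p) else 0)"
  proof (cases "even p")
    case True
    then obtain j where "p = 2 * j" by blast
    then show ?thesis using upper trace_gram_pow[OF A] by simp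
  next
    case False
    then obtain j where "p = Suc (2 * j)" using oddE by fastforce
    then show ?thesis using odd[of _ j] by (simp add: ptr_def del: pow_mat.simps)
  qed
  show "ptr {n..<n+k} (dil n k A ^\<^sub>m p) = (if p = 0 then of_nat k else if even p then of_real (\<Sum>i<n. (sval A (Suc i)) ^ p) else 0)"
  proof (cases "even p")
    case True
    then obtain j where p: "p = 2 * j" by blast
    show ?thesis
    proof (cases j)
      case 0
      then show ?thesis using lower[of 0] p aA A by (simp add: ptr_def)
    next
      case (Suc i)
      then show ?thesis using lower'[of i] trace_gram_pow[OF A, of "Suc i"] p by (simp del: pow_mat.simps)
    qed
  next
    case False
    then obtain j where "p = Suc (2 * j)" using oddE by fastforce
    then show ?thesis using odd[of _ j] by (simp add: ptr_lower del: pow_mat.simps)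
  qed
qed

text \<open>Limits of the normalised traces of \<open>H\<^sup>p\<close> over the upper and the lower diagonal block.\<close>

definition mom1 :: "real measure \<Rightarrow> nat \<Rightarrow> real" where
  "mom1 mu p = (if even p then \<integral>t. t ^ p \<partial>mu else 0)"

definition mom2 :: "real \<Rightarrow> real measure \<Rightarrow> nat \<Rightarrow> real" where
  "mom2 c mu p = (if p = 0 then 1 else c * mom1 mu p)"

section \<open>The noise model and its almost sure event\<close>

locale invariant_noise = prob_space M for M :: "'w measure" +
  fixes realK :: bool and m :: "nat \<Rightarrow> nat" and c :: real and X :: "nat \<Rightarrow> 'w \<Rightarrow> complex mat"
    and muX :: "real measure" and a0 b :: real
  assumes m_ge: "\<And>n. m n \<ge> n"
    and ratio: "(\<lambda>n. real n / real (m n)) \<longlonglongrightarrow> c"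
    and X_dim: "\<And>n \<omega>. \<omega> \<in> space M \<Longrightarrow> X n \<omega> \<in> carrier_mat n (m n) \<and> K_mat realK (X n \<omega>)"
    and X_meas: "\<And>n i j. i < n \<Longrightarrow> j < m n \<Longrightarrow> (\<lambda>\<omega>. X n \<omega> $$ (i, j)) \<in> borel_measurable M"
    and X_invariant: "\<And>n U V. K_unitary realK n U \<Longrightarrow> K_unitary realK (m n) V \<Longrightarrow>
          distr M (mat_space n (m n)) (\<lambda>\<omega>. entries n (m n) (U * X n \<omega> * V))
        = distr M (mat_space n (m n)) (\<lambda>\<omega>. entries n (m n) (X n \<omega>))"
    and muX_prob: "prob_space muX" and muX_sets: "sets muX = sets borel"
    and muX_supp: "emeasure muX (UNIV - {a0..b}) = 0"
    and esd_conv: "AE \<omega> in M. \<forall>f :: real \<Rightarrow> real. continuous_on UNIV f \<and> bounded (range f) \<longrightarrow>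
          (\<lambda>n. (1 / real n) * (\<Sum>i\<in>{1..n}. f (sval (X n \<omega>) i))) \<longlonglongrightarrow> (\<integral>t. f t \<partial>muX)"
    and top_sv: "AE \<omega> in M. (\<lambda>n. sval (X n \<omega>) 1) \<longlonglongrightarrow> b"
begin

lemma X_carrier: "\<omega> \<in> space M \<Longrightarrow> X n \<omega> \<in> carrier_mat n (m n)"
  using X_dim by blast

lemma c_nonneg: "0 \<le> c" and c_le_1: "c \<le> 1"
proof -
  show "0 \<le> c" by (rule LIMSEQ_le_const[OF ratio]) auto
  show "c \<le> 1" by (rule LIMSEQ_le_const2[OF ratio]) (use m_ge in \<open>auto intro!: exI[of _ 0] divide_le_eq_1[THEN iffD2] simp: not_less\<close>)
qed

text \<open>The almost sure hypotheses as a property of one sample point, so that limits can be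
  handled path by path.\<close>

definition regular :: "'w \<Rightarrow> bool" where
  "regular \<omega> \<longleftrightarrow> \<omega> \<in> space M \<and> (\<lambda>n. sval (X n \<omega>) 1) \<longlonglongrightarrow> b \<and> 
    (\<forall>f :: real \<Rightarrow> real. continuous_on UNIV f \<and> bounded (range f) \<longrightarrow>
          (\<lambda>n. (1 / real n) * (\<Sum>i\<in>{1..n}. f (sval (X n \<omega>) i))) \<longlonglongrightarrow> (\<integral>t. f t \<partial>muX))"

lemma regular_space: "regular \<omega> \<Longrightarrow> \<omega> \<in> space M"
  by (simp add: regular_def)

lemma sval_X_nonneg: "regular \<omega> \<Longrightarrow> 1 \<le> i \<Longrightarrow> i \<le> n \<Longrightarrow> 0 \<le> sval (X n \<omega>) i"
  by (rule sval_nonneg[OF X_carrier[OF regular_space]])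

lemma AE_regular: "AE \<omega> in M. regular \<omega>"
  using esd_conv top_sv AE_space unfolding regular_def by eventually_elim auto

text \<open>An event of full probability is nonempty; one such sample point suffices for
  deterministic facts about \<open>b\<close> and \<open>muX\<close>.\<close>

lemma ex_regular: "\<exists>\<omega>. regular \<omega>"
  using AE_regular AE_False by (metis (mono_tags, lifting) AE_mp AE_I2 eventually_mono)

lemma b_nonneg: "0 \<le> b"
proof -
  obtain \<omega> where \<omega>: "regular \<omega>" using ex_regular by blast
  show ?thesis
    by (rule LIMSEQ_le_const[of "\<lambda>n. sval (X n \<omega>) 1"])
       (use \<omega> sval_X_nonneg[OF \<omega>, of 1] in \<open>auto simp: regular_def intro!: exI[of _ 1]\<close>)
qed

lemma AE_muX_le: "AE t in muX. a0 \<le> t \<and> t \<le> b"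
proof (rule AE_I[of _ _ "UNIV - {a0..b}"])
  show "UNIV - {a0..b} \<in> sets muX" by (simp add: muX_sets)
qed (use muX_supp in auto)

lemma muX_measurable [measurable_cong]: "measurable muX N = measurable borel N"
  using muX_sets by (rule measurable_cong_sets) simp

text \<open>The interval carrying \<open>muX\<close> may reach below 0. Nonnegativity is inherited
  from the singular values by testing with a bounded continuous function that vanishes on the
  nonnegative axis and is positive below it.\<close>

lemma AE_muX: "AE t in muX. 0 \<le> t \<and> t \<le> b"
proof -
  interpret mu: prob_space muX by (rule muX_prob)
  obtain \<omega> where \<omega>: "regular \<omega>" using ex_regular by blast
  define f where "f t = max 0 (min 1 (- t))" for t :: real
  have "continuous_on UNIV f" unfolding f_def by (intro continuous_intros)
  moreover have "bounded (range f)" by (rule boundedI[of _ 1]) (auto simp: f_def)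
  ultimately have lim: "(\<lambda>n. (1 / real n) * (\<Sum>i\<in>{1..n}. f (sval (X n \<omega>) i))) \<longlonglongrightarrow> (\<integral>t. f t \<partial>muX)"
    using \<omega> unfolding regular_def by blast
  have "(\<lambda>n. (1 / real n) * (\<Sum>i\<in>{1..n}. f (sval (X n \<omega>) i))) = (\<lambda>_. 0)"
  proof
    fix n
    have "(\<Sum>i\<in>{1..n}. f (sval (X n \<omega>) i)) = 0"
    proof (intro sum.neutral ballI)
      fix i assume "i \<in> {1..n}"
      then have "0 \<le> sval (X n \<omega>) i" using sval_X_nonneg[OF \<omega>] by auto
      then show "f (sval (X n \<omega>) i) = 0" by (simp add: f_def)
    qed
    then show "(1 / real n) * (\<Sum>i\<in>{1..n}. f (sval (X n \<omega>) i)) = 0" by simp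
  qed
  then have int0: "(\<integral>t. f t \<partial>muX) = 0" using lim by (metis LIMSEQ_unique tendsto_const)
  have [measurable]: "f \<in> borel_measurable borel" unfolding f_def by measurable
  have "integrable muX f"
    by (rule mu.integrable_const_bound[of _ 1]) (auto simp: f_def)
  then have "AE t in muX. f t = 0"
    using int0 by (subst (asm) integral_nonneg_eq_0_iff_AE) (auto simp: f_def)
  with AE_muX_le show ?thesis by eventually_elim (auto simp: f_def max_def min_def split: if_splits)
qed

lemma eventually_sval_le:
  assumes "regular \<omega>" "b < B"
  shows "\<forall>\<^sub>F n in sequentially. \<forall>i\<in>{1..n}. sval (X n \<omega>) i \<le> B"
proof -
  have "\<forall>\<^sub>F n in sequentially. sval (X n \<omega>) 1 < B"
    using assms unfolding regular_def by (auto intro: order_tendstoD(2))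
  then show ?thesis
  proof eventually_elim
    case (elim n)
    then show ?case using sval_antimono[OF X_carrier, of \<omega> 1 _ n] assms(1) unfolding regular_def by fastforce
  qed
qed

text \<open>Since the largest singular value converges to \<open>b\<close>, the test function only has to be
  continuous near \<open>[0, b]\<close>.\<close>

lemma esd_limit:
  fixes f :: "real \<Rightarrow> real"
  assumes \<omega>: "regular \<omega>" and B: "b < B" and f: "continuous_on {0..B} f" and fm: "f \<in> borel_measurable borel"
  shows "(\<lambda>n. (\<Sum>i\<in>{1..n}. f (sval (X n \<omega>) i)) / real n) \<longlonglongrightarrow> (\<integral>t. f t \<partial>muX)"
proof -
  interpret mu: prob_space muX by (rule muX_prob)
  define g where "g t = f (max 0 (min B t))" for t
  have B0: "0 \<le> B" using b_nonneg B by simp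
  have gc: "continuous_on UNIV g" unfolding g_def
    by (rule continuous_on_compose2[OF f]) (use B0 in \<open>auto intro!: continuous_intros\<close>)
  have "bounded (f ` {0..B})" using f by (intro compact_imp_bounded compact_continuous_image) auto
  then have gb: "bounded (range g)" by (rule bounded_subset) (use B0 in \<open>auto simp: g_def\<close>)
  have "(\<lambda>n. (1 / real n) * (\<Sum>i\<in>{1..n}. g (sval (X n \<omega>) i))) \<longlonglongrightarrow> (\<integral>t. g t \<partial>muX)"
    using \<omega> gc gb unfolding regular_def by blast
  moreover have "(\<integral>t. g t \<partial>muX) = (\<integral>t. f t \<partial>muX)"
  proof -
    have gm: "g \<in> borel_measurable borel" using gc by (rule borel_measurable_continuous_onI)
    have "AE t in muX. g t = f t" using AE_muX by eventually_elim (use B in \<open>auto simp: g_def min_def\<close>)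
    with gm fm show ?thesis by (intro integral_cong_AE) (auto simp: muX_measurable)
  qed
  ultimately have "(\<lambda>n. (1 / real n) * (\<Sum>i\<in>{1..n}. g (sval (X n \<omega>) i))) \<longlonglongrightarrow> (\<integral>t. f t \<partial>muX)" by simp
  then show ?thesis
  proof (rule Lim_transform_eventually)
    show "\<forall>\<^sub>F n in sequentially. (1 / real n) * (\<Sum>i\<in>{1..n}. g (sval (X n \<omega>) i)) = (\<Sum>i\<in>{1..n}. f (sval (X n \<omega>) i)) / real n"
      using eventually_sval_le[OF \<omega> B]
    proof eventually_elim
      case (elim n)
      have "(\<Sum>i\<in>{1..n}. g (sval (X n \<omega>) i)) = (\<Sum>i\<in>{1..n}. f (sval (X n \<omega>) i))"
      proof (intro sum.cong refl)
        fix i assume i: "i \<in> {1..n}"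
        then have "0 \<le> sval (X n \<omega>) i" using sval_X_nonneg[OF \<omega>] by auto
        moreover have "sval (X n \<omega>) i \<le> B" using elim i by auto
        ultimately show "g (sval (X n \<omega>) i) = f (sval (X n \<omega>) i)" by (simp add: g_def min_absorb2)
      qed
      then show ?case by simp
    qed
  qed
qed

end

section \<open>Almost sure limits of the quadratic forms\<close>

lemma tendsto_zero_of_power4:
  fixes f :: "nat \<Rightarrow> real"
  assumes "(\<lambda>n. f n ^ 4) \<longlonglongrightarrow> 0"
  shows "f \<longlonglongrightarrow> 0"
proof -
  have "(\<lambda>n. sqrt (sqrt (f n ^ 4))) \<longlonglongrightarrow> sqrt (sqrt 0)"
    by (intro tendsto_real_sqrt assms)
  moreover have "sqrt (sqrt (x ^ 4)) = \<bar>x\<bar>" for x :: real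
  proof -
    have "x ^ 4 = (x\<^sup>2)\<^sup>2" by simp
    then show ?thesis by (simp only: real_sqrt_abs) simp
  qed
  ultimately show ?thesis by (simp add: tendsto_rabs_zero_iff)
qed

text \<open>Borel-Cantelli in integrated form: summable integrals make the random series finite
  almost surely, so its terms tend to 0.\<close>

lemma AE_tendsto_zero_of_summable:
  fixes f :: "nat \<Rightarrow> 'a \<Rightarrow> real"
  assumes meas: "\<And>n. f n \<in> borel_measurable M" and nn: "\<And>n x. 0 \<le> f n x"
    and le: "\<And>n. (\<integral>\<^sup>+x. ennreal (f n x) \<partial>M) \<le> ennreal (g n)" and g: "summable g" "\<And>n. 0 \<le> g n"
  shows "AE x in M. (\<lambda>n. f n x) \<longlonglongrightarrow> 0"
proof -
  have "(\<integral>\<^sup>+x. (\<Sum>n. ennreal (f n x)) \<partial>M) = (\<Sum>n. \<integral>\<^sup>+x. ennreal (f n x) \<partial>M)"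
    using meas by (intro nn_integral_suminf) auto
  also have "\<dots> \<le> (\<Sum>n. ennreal (g n))" by (intro suminf_le le) auto
  also have "\<dots> = ennreal (suminf g)" by (rule suminf_ennreal2[OF g(2,1)])
  finally have "(\<integral>\<^sup>+x. (\<Sum>n. ennreal (f n x)) \<partial>M) < \<infinity>" using le_less_trans by fastforce
  then have "AE x in M. (\<Sum>n. ennreal (f n x)) \<noteq> \<infinity>"
    using meas by (intro nn_integral_PInf_AE) auto
  then show ?thesis
  proof eventually_elim
    case (elim x)
    then have "summable (\<lambda>n. f n x)" using nn by (intro summable_suminf_not_top) auto
    then show ?case by (rule summable_LIMSEQ_zero)
  qed
qed

text \<open>Taking \<zeta> to be 1 and the imaginary unit recovers both parts of the cross term from
  quadratic forms.\<close>

lemma polarization: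
  assumes P: "P \<in> carrier_mat N N" "adj P = P"
  shows "Re (ip N (\<lambda>i. x i + \<zeta> * y i) (mv N P (\<lambda>i. x i + \<zeta> * y i))) =
    Re (ip N x (mv N P x)) + (cmod \<zeta>)\<^sup>2 * Re (ip N y (mv N P y)) + 2 * Re (\<zeta> * ip N x (mv N P y))"
proof -
  have "mv N P (\<lambda>i. x i + \<zeta> * y i) = (\<lambda>i. mv N P x i + \<zeta> * mv N P y i)"
    by (auto simp: mv_def fun_eq_iff sum.distrib sum_distrib_left algebra_simps)
  then have "ip N (\<lambda>i. x i + \<zeta> * y i) (mv N P (\<lambda>i. x i + \<zeta> * y i)) =
     ip N x (mv N P x) + \<zeta> * ip N x (mv N P y) + cnj \<zeta> * ip N y (mv N P x) + cnj \<zeta> * \<zeta> * ip N y (mv N P y)"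
    by (simp add: ip_def sum.distrib sum_distrib_left algebra_simps)
  also have "ip N y (mv N P x) = cnj (ip N x (mv N P y))"
    unfolding ip_mv_adj[OF P(1), of y] P(2) by (simp add: ip_def mult.commute)
  also have "cnj \<zeta> * \<zeta> = of_real ((cmod \<zeta>)\<^sup>2)" by (simp add: complex_norm_square mult.commute del: of_real_power)
  finally show ?thesis by (simp add: algebra_simps)
qed

lemma Im_ip_hermitian:
  assumes P: "P \<in> carrier_mat N N" "adj P = P"
  shows "Im (ip N x (mv N P x)) = 0"
proof -
  have "ip N x (mv N P x) = cnj (ip N x (mv N P x))"
    by (subst ip_mv_adj[OF P(1), of x, unfolded P(2)]) (simp add: ip_def mult.commute)
  then show ?thesis by (metis cnj.simps(2) equal_neg_zero)
qed

lemma dil_pow_real: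
  assumes A: "A \<in> carrier_mat n k" and re: "\<And>i j. i < n \<Longrightarrow> j < k \<Longrightarrow> A $$ (i,j) \<in> \<real>"
    and ij: "i < n + k" "j < n + k"
  shows "(dil n k A ^\<^sub>m p) $$ (i,j) \<in> \<real>"
  using ij
proof (induction p arbitrary: j)
  case (Suc p)
  have base: "dil n k A $$ (l,j) \<in> \<real>" if "l < n + k" for l
    using that Suc.prems re by (auto simp: dil_index[OF A] Reals_cnj_iff)
  show ?case unfolding pow_mat.simps mult_index[OF pow_carrier[OF dil_carrier] dil_carrier Suc.prems]
    using Suc base by (intro sum_in_Reals Reals_mult) auto
qed (auto simp: carrier_matD[OF dil_carrier])

context invariant_noise
begin

lemma moment_limit:
  assumes \<omega>: "regular \<omega>"
  shows "(\<lambda>n. (\<Sum>i<n. (sval (X n \<omega>) (Suc i)) ^ p) / real n) \<longlonglongrightarrow> (\<integral>t. t ^ p \<partial>muX)"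
proof -
  have "(\<lambda>n. (\<Sum>i\<in>{1..n}. (sval (X n \<omega>) i) ^ p) / real n) \<longlonglongrightarrow> (\<integral>t. t ^ p \<partial>muX)"
    by (rule esd_limit[OF \<omega>, of "b + 1"]) (auto intro!: continuous_intros)
  then show ?thesis by (simp add: sum.atLeast1_atMost_eq)
qed

text \<open>For even p > 0 the two block traces agree and the ratio n/m produces the factor
  \<open>c\<close>; p = 0 stands apart because the lower mean is then 1.\<close>

lemma mean_limit:
  assumes \<omega>: "regular \<omega>"
  shows "(\<lambda>n. \<alpha> / real n * Re (ptr {..<n} (dil n (m n) (X n \<omega>) ^\<^sub>m p)) + 
      \<beta> / real (m n) * Re (ptr {n..<n + m n} (dil n (m n) (X n \<omega>) ^\<^sub>m p))) 
    \<longlonglongrightarrow> \<alpha> * mom1 muX p + \<beta> * mom2 c muX p"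
proof -
  interpret mu: prob_space muX by (rule muX_prob)
  note tr = trace_dil_pow[OF X_carrier[OF regular_space[OF \<omega>]]]
  define s where "s n = (\<Sum>i<n. (sval (X n \<omega>) (Suc i)) ^ p) / real n" for n
  have s: "s \<longlonglongrightarrow> (\<integral>t. t ^ p \<partial>muX)" using moment_limit[OF \<omega>] unfolding s_def .
  have pos: "\<forall>\<^sub>F n in sequentially. 1 \<le> n" by (rule eventually_ge_at_top)
  consider "p = 0" | "p \<noteq> 0" "even p" | "odd p" by blast
  then show ?thesis
  proof cases
    case 1
    have "(\<lambda>_. \<alpha> + \<beta>) \<longlonglongrightarrow> \<alpha> * mom1 muX p + \<beta> * mom2 c muX p"
      using 1 by (simp add: mom1_def mom2_def mu.prob_space)
    then show ?thesis
    proof (rule Lim_transform_eventually)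
      show "\<forall>\<^sub>F n in sequentially. \<alpha> + \<beta> = \<alpha> / real n * Re (ptr {..<n} (dil n (m n) (X n \<omega>) ^\<^sub>m p)) + 
        \<beta> / real (m n) * Re (ptr {n..<n + m n} (dil n (m n) (X n \<omega>) ^\<^sub>m p))"
        using pos by eventually_elim (use 1 m_ge in \<open>auto simp: tr simp del: pow_mat.simps dest: le_trans\<close>)
    qed
  next
    case 2
    have "(\<lambda>n. \<alpha> * s n + \<beta> * (real n / real (m n) * s n)) 
        \<longlonglongrightarrow> \<alpha> * (\<integral>t. t ^ p \<partial>muX) + \<beta> * (c * (\<integral>t. t ^ p \<partial>muX))"
      by (intro tendsto_intros s ratio)
    then have "(\<lambda>n. \<alpha> * s n + \<beta> * (real n / real (m n) * s n)) \<longlonglongrightarrow> \<alpha> * mom1 muX p + \<beta> * mom2 c muX p"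
      using 2 by (simp add: mom1_def mom2_def)
    then show ?thesis
    proof (rule Lim_transform_eventually)
      show "\<forall>\<^sub>F n in sequentially. \<alpha> * s n + \<beta> * (real n / real (m n) * s n) = 
        \<alpha> / real n * Re (ptr {..<n} (dil n (m n) (X n \<omega>) ^\<^sub>m p)) + 
        \<beta> / real (m n) * Re (ptr {n..<n + m n} (dil n (m n) (X n \<omega>) ^\<^sub>m p))"
        using pos by eventually_elim (use 2 in \<open>simp add: tr s_def field_simps\<close>)
    qed
  next
    case 3
    then have "p \<noteq> 0" by (metis even_zero)
    with 3 show ?thesis by (simp add: tr mom1_def mom2_def)
  qed
qed

lemma trace_bound:
  assumes \<omega>: "regular \<omega>" and p: "1 \<le> p"
  shows "\<forall>\<^sub>F n in sequentially. Re (ptr {..<n} (dil n (m n) (X n \<omega>) ^\<^sub>m (2 * p))) + 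
    Re (ptr {n..<n + m n} (dil n (m n) (X n \<omega>) ^\<^sub>m (2 * p))) \<le> 2 * (b + 1) ^ (2 * p) * real n"
proof -
  note tr = trace_dil_pow[OF X_carrier[OF regular_space[OF \<omega>]]]
  have "\<forall>\<^sub>F n in sequentially. \<forall>i\<in>{1..n}. sval (X n \<omega>) i \<le> b + 1"
    by (rule eventually_sval_le[OF \<omega>]) simp
  then show ?thesis
  proof eventually_elim
    case (elim n)
    have "(\<Sum>i<n. (sval (X n \<omega>) (Suc i)) ^ (2 * p)) \<le> (\<Sum>i<n. (b + 1) ^ (2 * p))"
      using elim sval_X_nonneg[OF \<omega>] by (intro sum_mono power_mono) auto
    then show ?case using p by (simp add: tr mult.commute del: pow_mat.simps)
  qed
qed

text \<open>For p = 0 the form is a constant squared norm; the case is split off because the lower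
  trace m n need not be O(n) when c = 0. For p > 0 the truncation level K n turns the moment bound
  into O(1/n^2).\<close>

lemma quadratic_form_limit:
  assumes r0: "1 \<le> r0"
    and x: "\<And>n. r0 \<le> n \<Longrightarrow> nsq n (x n) = \<alpha>" "\<And>n. r0 \<le> n \<Longrightarrow> realK \<Longrightarrow> \<forall>i<n. Im (x n i) = 0"
    and y: "\<And>n. r0 \<le> n \<Longrightarrow> nsq (m n) (y n) = \<beta>" "\<And>n. r0 \<le> n \<Longrightarrow> realK \<Longrightarrow> \<forall>i<m n. Im (y n i) = 0"
  shows "AE \<omega> in M. (\<lambda>n. Re (ip (n + m n) (join n (x n) (y n)) (mv (n + m n) (dil n (m n) (X n \<omega>) ^\<^sub>m p) (join n (x n) (y n)))))
     \<longlonglongrightarrow> \<alpha> * mom1 muX p + \<beta> * mom2 c muX p"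
proof (cases "p = 0")
  case True
  interpret mu: prob_space muX by (rule muX_prob)
  have "(\<lambda>n. Re (ip (n + m n) (join n (x n) (y n)) (mv (n + m n) (dil n (m n) (X n \<omega>) ^\<^sub>m p) (join n (x n) (y n)))))
     \<longlonglongrightarrow> \<alpha> * mom1 muX p + \<beta> * mom2 c muX p" for \<omega>
  proof (rule tendsto_eventually)
    show "\<forall>\<^sub>F n in sequentially. Re (ip (n + m n) (join n (x n) (y n)) (mv (n + m n) (dil n (m n) (X n \<omega>) ^\<^sub>m p) (join n (x n) (y n))))
      = \<alpha> * mom1 muX p + \<beta> * mom2 c muX p"
      using eventually_ge_at_top[of r0]
    proof eventually_elim
      case (elim n)
      have "ip (n + m n) (join n (x n) (y n)) (mv (n + m n) (dil n (m n) (X n \<omega>) ^\<^sub>m p) (join n (x n) (y n)))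
         = ip (n + m n) (join n (x n) (y n)) (join n (x n) (y n))"
        by (rule ip_cong) (auto simp: True mv_one carrier_matD[OF dil_carrier])
      also have "\<dots> = of_real (nsq n (x n)) + of_real (nsq (m n) (y n))"
        by (simp add: ip_def sum_join join_def of_real_nsq)
      finally show ?case using x(1)[OF elim] y(1)[OF elim] True
        by (simp add: mom1_def mom2_def mu.prob_space)
    qed
  qed
  then show ?thesis by simp
next
  case False
  then have p: "1 \<le> p" by simp
  let ?w = "\<lambda>n. join n (x n) (y n)"
  let ?H = "\<lambda>n \<omega>. dil n (m n) (X n \<omega>)"
  let ?T = "\<lambda>n \<omega>. \<alpha> / real n * Re (ptr {..<n} (?H n \<omega> ^\<^sub>m p)) + \<beta> / real (m n) * Re (ptr {n..<n + m n} (?H n \<omega> ^\<^sub>m p))"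
  define K where "K = 2 * (b + 1) ^ (2 * p)"
  have K: "0 \<le> K" using b_nonneg by (simp add: K_def)
  \<comment> \<open>Below \<open>r0\<close> the vectors are unconstrained, so these terms are set to
    0.\<close>
  define f where "f n \<omega> = (if r0 \<le> n then dev4 n (m n) p (?w n) \<alpha> \<beta> (K * real n) (X n \<omega>) else 0)" for n \<omega>
  have f: "AE \<omega> in M. (\<lambda>n. f n \<omega>) \<longlonglongrightarrow> 0"
  proof (rule AE_tendsto_zero_of_summable[where g = "\<lambda>n. 1296 * (\<alpha> + \<beta>) ^ 4 * K\<^sup>2 * inverse (real n ^ 2)"])
    fix n
    have "(\<lambda>\<omega>. dev4 n (m n) p (?w n) \<alpha> \<beta> (K * real n) (X n \<omega>)) \<in> borel_measurable M \<longleftrightarrow>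
        (\<lambda>\<omega>. dev4 n (m n) p (?w n) \<alpha> \<beta> (K * real n) (mat n (m n) (entries n (m n) (X n \<omega>)))) \<in> borel_measurable M"
      by (rule measurable_cong) (simp only: mat_entries[OF X_carrier])
    then have "(\<lambda>\<omega>. dev4 n (m n) p (?w n) \<alpha> \<beta> (K * real n) (X n \<omega>)) \<in> borel_measurable M"
      using measurable_compose[OF entries_measurable[OF X_meas] dev4_measurable[of n "m n" p "?w n" \<alpha> \<beta> "K * real n"]] by blast
    then show "f n \<in> borel_measurable M" unfolding f_def by auto
    show "0 \<le> f n \<omega>" for \<omega> by (simp add: f_def dev4_nonneg)
    show "(\<integral>\<^sup>+\<omega>. ennreal (f n \<omega>) \<partial>M) \<le> ennreal (1296 * (\<alpha> + \<beta>) ^ 4 * K\<^sup>2 * inverse (real n ^ 2))"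
    proof (cases "r0 \<le> n")
      case True
      then have n: "1 \<le> n" using r0 by simp
      have "(\<integral>\<^sup>+\<omega>. ennreal (f n \<omega>) \<partial>M) \<le> ennreal (1296 * (\<alpha> + \<beta>) ^ 4 * (K * real n)\<^sup>2 / real n ^ 4)"
        unfolding f_def using True
        by (simp only: if_True) (rule dev4_expectation[OF n m_ge _ X_carrier X_meas X_invariant x(1,2)[OF True] y(1,2)[OF True] prob_space_axioms],
           use K in auto)
      also have "1296 * (\<alpha> + \<beta>) ^ 4 * (K * real n)\<^sup>2 / real n ^ 4 = 1296 * (\<alpha> + \<beta>) ^ 4 * K\<^sup>2 * inverse (real n ^ 2)"
        using n by (simp add: field_simps power2_eq_square power4_eq_xxxx)
      finally show ?thesis .
    qed (simp add: f_def)
    show "summable (\<lambda>n. 1296 * (\<alpha> + \<beta>) ^ 4 * K\<^sup>2 * inverse (real n ^ 2))"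
      by (intro summable_mult inverse_power_summable) auto
  qed simp
  show ?thesis using f AE_regular
  proof eventually_elim
    case (elim \<omega>)
    have "(\<lambda>n. (Re (ip (n + m n) (?w n) (mv (n + m n) (?H n \<omega> ^\<^sub>m p) (?w n))) - ?T n \<omega>) ^ 4) \<longlonglongrightarrow> 0"
      using elim(1)
    proof (rule Lim_transform_eventually)
      \<comment> \<open>At a regular sample point \<open>trace_bound\<close> makes the truncation
        eventually inactive.\<close>
      show "\<forall>\<^sub>F n in sequentially. f n \<omega> = (Re (ip (n + m n) (?w n) (mv (n + m n) (?H n \<omega> ^\<^sub>m p) (?w n))) - ?T n \<omega>) ^ 4"
        using trace_bound[OF elim(2) p] eventually_ge_at_top[of r0]
        by eventually_elim (simp add: f_def dev4_def K_def Let_def)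
    qed
    then have "(\<lambda>n. Re (ip (n + m n) (?w n) (mv (n + m n) (?H n \<omega> ^\<^sub>m p) (?w n))) - ?T n \<omega>) \<longlonglongrightarrow> 0"
      by (rule tendsto_zero_of_power4)
    from tendsto_add[OF this mean_limit[OF elim(2), of \<alpha> p \<beta>]] show ?case by simp
  qed
qed

end

section \<open>The signal and its 2r extended singular vectors\<close>

locale spiked_model = invariant_noise +
  fixes r :: nat and \<theta> :: "nat \<Rightarrow> real" and u v :: "nat \<Rightarrow> nat \<Rightarrow> complex Matrix.vec"
  assumes r_pos: "r \<ge> 1"
    and u_vec: "\<And>n i. n \<ge> r \<Longrightarrow> i \<in> {1..r} \<Longrightarrow> u n i \<in> carrier_vec n \<and> K_vec realK (u n i)"
    and v_vec: "\<And>n i. n \<ge> r \<Longrightarrow> i \<in> {1..r} \<Longrightarrow> v n i \<in> carrier_vec (m n) \<and> K_vec realK (v n i)"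
    and u_orth: "\<And>n i j. n \<ge> r \<Longrightarrow> i \<in> {1..r} \<Longrightarrow> j \<in> {1..r} \<Longrightarrow>
          u n i \<bullet>c u n j = (if i = j then 1 else 0)"
    and v_orth: "\<And>n i j. n \<ge> r \<Longrightarrow> i \<in> {1..r} \<Longrightarrow> j \<in> {1..r} \<Longrightarrow>
          v n i \<bullet>c v n j = (if i = j then 1 else 0)"
begin

text \<open>Indices start at 0: a < r stands for the pair (\<open>u n (Suc a)\<close>, 0), and r
  \<le> a < 2 r for (0, \<open>v n (Suc (a - r))\<close>). The missing half is filled with zeros so
  that all 2 r vectors have the one form \<open>join\<close>.\<close>

definition uf :: "nat \<Rightarrow> nat \<Rightarrow> nat \<Rightarrow> complex" where
  "uf n a i = (if a < r then vec_index (u n (Suc a)) i else 0)"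

definition vf :: "nat \<Rightarrow> nat \<Rightarrow> nat \<Rightarrow> complex" where
  "vf n a i = (if a < r then 0 else vec_index (v n (Suc (a - r))) i)"

definition W :: "nat \<Rightarrow> nat \<Rightarrow> nat \<Rightarrow> complex" where
  "W n a = join n (uf n a) (vf n a)"

lemma uf_orth: "r \<le> n \<Longrightarrow> (\<Sum>i<n. cnj (uf n a i) * uf n a' i) = (if a = a' \<and> a < r then 1 else 0)"
proof -
  assume n: "r \<le> n"
  show ?thesis
  proof (cases "a < r \<and> a' < r")
    case True
    then have "u n (Suc a') \<bullet>c u n (Suc a) = (\<Sum>i<n. cnj (uf n a i) * uf n a' i)"
      using u_vec[OF n, of "Suc a"] by (auto simp: scalar_prod_def uf_def lessThan_atLeast0 mult.commute intro!: sum.cong)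
    then show ?thesis using u_orth[OF n, of "Suc a'" "Suc a"] True by auto
  qed (auto simp: uf_def)
qed

lemma vf_orth: "r \<le> n \<Longrightarrow> a < 2 * r \<Longrightarrow> a' < 2 * r \<Longrightarrow> 
  (\<Sum>i<m n. cnj (vf n a i) * vf n a' i) = (if a = a' \<and> \<not> a < r then 1 else 0)"
proof -
  assume n: "r \<le> n" "a < 2 * r" "a' < 2 * r"
  show ?thesis
  proof (cases "\<not> a < r \<and> \<not> a' < r")
    case True
    then have "Suc (a - r) \<in> {1..r}" using n by auto
    from v_vec[OF n(1) this] True have "v n (Suc (a' - r)) \<bullet>c v n (Suc (a - r)) = (\<Sum>i<m n. cnj (vf n a i) * vf n a' i)"
      by (auto simp: scalar_prod_def vf_def lessThan_atLeast0 mult.commute intro!: sum.cong)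
    moreover have "a' - r = a - r \<longleftrightarrow> a' = a" using True by auto
    ultimately show ?thesis using v_orth[OF n(1), of "Suc (a' - r)" "Suc (a - r)"] True n by auto
  qed (auto simp: vf_def)
qed

lemma uf_real: "realK \<Longrightarrow> r \<le> n \<Longrightarrow> i < n \<Longrightarrow> Im (uf n a i) = 0"
  using u_vec[of n "Suc a"] by (auto simp: uf_def K_vec_def)

lemma vf_real: "realK \<Longrightarrow> r \<le> n \<Longrightarrow> a < 2 * r \<Longrightarrow> i < m n \<Longrightarrow> Im (vf n a i) = 0"
proof (cases "a < r")
  case False
  assume *: "realK" "r \<le> n" "a < 2 * r" "i < m n"
  with False have "Suc (a - r) \<in> {1..r}" by auto
  from v_vec[OF *(2) this] * show ?thesis by (auto simp: vf_def K_vec_def)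
qed (simp add: vf_def)

definition mom :: "nat \<Rightarrow> nat \<Rightarrow> real" where
  "mom p a = (if a < r then mom1 muX p else mom2 c muX p)"

lemma W_ip: "r \<le> n \<Longrightarrow> a < 2 * r \<Longrightarrow> a' < 2 * r \<Longrightarrow> ip (n + m n) (W n a) (W n a') = (if a = a' then 1 else 0)"
  using uf_orth[of n a a'] vf_orth[of n a a'] by (simp add: ip_def W_def sum_join join_def)

lemma nsq_combination:
  assumes "(\<Sum>i<n. cnj (x i) * y i) = 0" "cmod \<zeta> = 1"
  shows "nsq n (\<lambda>i. x i + \<zeta> * y i) = nsq n x + nsq n y"
proof -
  have "(\<Sum>i<n. cnj (y i) * x i) = cnj (\<Sum>i<n. cnj (x i) * y i)" by (simp add: mult.commute)
  then have z: "(\<Sum>i<n. cnj (y i) * x i) = 0" using assms by simp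
  have zz: "cnj \<zeta> * \<zeta> = 1" using complex_norm_square[of \<zeta>] assms(2) by (simp add: mult.commute)
  have "cnj (x i + \<zeta> * y i) * (x i + \<zeta> * y i) = cnj (x i) * x i + (cnj \<zeta> * \<zeta>) * (cnj (y i) * y i) + 
     \<zeta> * (cnj (x i) * y i) + cnj \<zeta> * (cnj (y i) * x i)" for i
    by (simp add: algebra_simps)
  then have "complex_of_real (nsq n (\<lambda>i. x i + \<zeta> * y i)) = of_real (nsq n x + nsq n y)"
    using assms z by (simp add: of_real_nsq sum.distrib zz flip: sum_distrib_left)
  then show ?thesis using of_real_eq_iff by blast
qed

lemma nsq_uf: "r \<le> n \<Longrightarrow> nsq n (uf n a) = (if a < r then 1 else 0)"
  using uf_orth[of n a a] by (simp add: of_real_nsq[symmetric] split: if_splits)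

lemma nsq_vf: "r \<le> n \<Longrightarrow> a < 2 * r \<Longrightarrow> nsq (m n) (vf n a) = (if a < r then 0 else 1)"
  using vf_orth[of n a a] by (simp add: of_real_nsq[symmetric] split: if_splits)

lemma entry_limit:
  assumes a: "a < 2 * r" and a': "a' < 2 * r"
  shows "AE \<omega> in M. (\<lambda>n. ip (n + m n) (W n a) (mv (n + m n) (dil n (m n) (X n \<omega>) ^\<^sub>m p) (W n a'))) 
    \<longlonglongrightarrow> complex_of_real (if a = a' then mom p a else 0)"
proof -
  let ?P = "\<lambda>n \<omega>. dil n (m n) (X n \<omega>) ^\<^sub>m p"
  let ?S = "\<lambda>n \<omega> a a'. ip (n + m n) (W n a) (mv (n + m n) (?P n \<omega>) (W n a'))"
  have P: "?P n \<omega> \<in> carrier_mat (n + m n) (n + m n)" "adj (?P n \<omega>) = ?P n \<omega>" if "\<omega> \<in> space M" for n \<omega>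
    using adj_pow[OF dil_carrier dil_adj[OF X_carrier[OF that]]] by auto
  have diag: "AE \<omega> in M. (\<lambda>n. Re (?S n \<omega> a a)) \<longlonglongrightarrow> mom p a" if a: "a < 2 * r" for a
  proof -
    have "AE \<omega> in M. (\<lambda>n. Re (?S n \<omega> a a)) \<longlonglongrightarrow> (if a < r then 1 else 0) * mom1 muX p + (if a < r then 0 else 1) * mom2 c muX p"
      unfolding W_def
      by (rule quadratic_form_limit[OF r_pos]) (use nsq_uf nsq_vf uf_real vf_real a in auto)
    then show ?thesis unfolding mom_def by (cases "a < r") auto
  qed
  show ?thesis
  proof (cases "a = a'")
    case True
    show ?thesis using diag[OF a] AE_space
    proof eventually_elim
      case (elim \<omega>)
      have "(\<lambda>n. ?S n \<omega> a a') = (\<lambda>n. of_real (Re (?S n \<omega> a a)))"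
        using Im_ip_hermitian[OF P[OF elim(2)]] True by (auto simp: complex_eq_iff fun_eq_iff)
      then show ?case using tendsto_of_real[OF elim(1), where 'a = complex] True by (simp only: if_True refl)
    qed
  next
    case False
    \<comment> \<open>By orthonormality the combination has block norms independent of n, so its
      form tends to the sum of the two diagonal limits and polarization leaves 0 for the cross term.
      Over the reals only real \<zeta> keeps the vector in K.\<close>
    have comb: "AE \<omega> in M. (\<lambda>n. Re (\<zeta> * ?S n \<omega> a a')) \<longlonglongrightarrow> 0" if z: "cmod \<zeta> = 1" "realK \<Longrightarrow> Im \<zeta> = 0" for \<zeta>
    proof -
      let ?x = "\<lambda>n i. uf n a i + \<zeta> * uf n a' i" and ?y = "\<lambda>n i. vf n a i + \<zeta> * vf n a' i"
      let ?al = "(if a < r then 1 else 0) + (if a' < r then 1 else 0) :: real"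
      let ?be = "(if a < r then 0 else 1) + (if a' < r then 0 else 1) :: real"
      have "AE \<omega> in M. (\<lambda>n. Re (ip (n + m n) (join n (?x n) (?y n)) (mv (n + m n) (?P n \<omega>) (join n (?x n) (?y n)))))
        \<longlonglongrightarrow> ?al * mom1 muX p + ?be * mom2 c muX p"
      proof (rule quadratic_form_limit[OF r_pos])
        fix n assume n: "r \<le> n"
        show "nsq n (?x n) = ?al"
          using nsq_combination[OF _ z(1), of "uf n a" "uf n a'"] uf_orth[OF n, of a a'] False nsq_uf[OF n] by simp
        show "nsq (m n) (?y n) = ?be"
          using nsq_combination[OF _ z(1), of "vf n a" "vf n a'"] vf_orth[OF n a a'] False nsq_vf[OF n] a a' by simp
        show "\<forall>i<n. Im (?x n i) = 0" if realK using uf_real[OF that n] z(2)[OF that] by simp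
        show "\<forall>i<m n. Im (?y n i) = 0" if realK using vf_real[OF that n] z(2)[OF that] a a' by simp
      qed
      with diag[OF a] diag[OF a'] AE_space show ?thesis
      proof eventually_elim
        case (elim \<omega>)
        have j: "join n (?x n) (?y n) = (\<lambda>i. W n a i + \<zeta> * W n a' i)" for n
          by (auto simp: W_def join_def)
        have eq: "Re (\<zeta> * ?S n \<omega> a a') = 
          (Re (ip (n + m n) (join n (?x n) (?y n)) (mv (n + m n) (?P n \<omega>) (join n (?x n) (?y n)))) 
            - Re (?S n \<omega> a a) - Re (?S n \<omega> a' a')) / 2" for n
          unfolding j polarization[OF P[OF elim(3)]] z(1) by simp
        have "(\<lambda>n. Re (\<zeta> * ?S n \<omega> a a')) \<longlonglongrightarrow> (?al * mom1 muX p + ?be * mom2 c muX p - mom p a - mom p a') / 2"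
          unfolding eq by (intro tendsto_intros elim) auto
        then show ?case by (simp add: mom_def split: if_splits)
      qed
    qed
    have re: "AE \<omega> in M. (\<lambda>n. Re (?S n \<omega> a a')) \<longlonglongrightarrow> 0" using comb[of 1] by simp
    \<comment> \<open>Over the reals the imaginary unit is excluded as \<zeta>, but there the entry
      itself is real.\<close>
    have im: "AE \<omega> in M. (\<lambda>n. Im (?S n \<omega> a a')) \<longlonglongrightarrow> 0"
    proof (cases realK)
      case False
      then have "AE \<omega> in M. (\<lambda>n. - Im (?S n \<omega> a a')) \<longlonglongrightarrow> 0" using comb[of \<i>] by simp
      then show ?thesis
      proof eventually_elim
        case (elim \<omega>)
        show ?case using tendsto_minus[OF elim] by simp
      qed
    next
      case True
      show ?thesis using AE_space
      proof eventually_elim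
        case (elim \<omega>)
        show ?case
        proof (rule tendsto_eventually)
          show "\<forall>\<^sub>F n in sequentially. Im (?S n \<omega> a a') = 0"
            using eventually_ge_at_top[of r]
          proof eventually_elim
            case (elim n)
            have "X n \<omega> $$ (i,j) \<in> \<real>" if "i < n" "j < m n" for i j
              using X_dim[OF \<open>\<omega> \<in> space M\<close>, of n] that True by (auto simp: K_mat_def complex_is_Real_iff)
            then have Pr: "?P n \<omega> $$ (i,j) \<in> \<real>" if "i < n + m n" "j < n + m n" for i j
              using dil_pow_real[OF X_carrier[OF \<open>\<omega> \<in> space M\<close>]] that by blast
            have Wr: "W n e i \<in> \<real>" if "i < n + m n" "e < 2 * r" for e i
              using uf_real[OF True elim, of i e] vf_real[OF True elim that(2), of "i - n"] that
              by (auto simp: W_def join_def complex_is_Real_iff)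
            have "?S n \<omega> a a' \<in> \<real>" unfolding ip_def mv_def
              using Pr Wr a a' by (intro sum_in_Reals Reals_mult) (auto simp: Reals_cnj_iff)
            then show ?case by (simp add: complex_is_Real_iff)
          qed
        qed
      qed
    qed
    show ?thesis using re im
    proof eventually_elim
      case (elim \<omega>)
      then show ?case using False by (simp add: tendsto_complex_iff)
    qed
  qed
qed

text \<open>One event for all powers and index pairs: countably many conditions, hence still almost
  sure. The later limit arguments are deterministic at a good sample point.\<close>

definition good :: "'a \<Rightarrow> bool" where
  "good \<omega> \<longleftrightarrow> regular \<omega> \<and> (\<forall>p. \<forall>a<2*r. \<forall>a'<2*r. 
    (\<lambda>n. ip (n + m n) (W n a) (mv (n + m n) (dil n (m n) (X n \<omega>) ^\<^sub>m p) (W n a'))) 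
    \<longlonglongrightarrow> complex_of_real (if a = a' then mom p a else 0))"

lemma AE_good: "AE \<omega> in M. good \<omega>"
proof -
  have "AE \<omega> in M. \<forall>p. \<forall>a\<in>{..<2*r}. \<forall>a'\<in>{..<2*r}. 
    (\<lambda>n. ip (n + m n) (W n a) (mv (n + m n) (dil n (m n) (X n \<omega>) ^\<^sub>m p) (W n a'))) 
    \<longlonglongrightarrow> complex_of_real (if a = a' then mom p a else 0)"
    unfolding AE_all_countable by (intro allI AE_finite_allI entry_limit) auto
  with AE_regular show ?thesis by eventually_elim (auto simp: good_def)
qed

end

section \<open>Resolvents of the dilation\<close>

lemma nsq_join: "nsq (n + k) x = nsq n x + nsq k (\<lambda>j. x (n + j))"
  by (simp add: nsq_def sum_join)

lemma two_Re_le: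
  assumes "0 < s"
  shows "2 * Re (cnj x * y) \<le> s * (cmod x)\<^sup>2 + (cmod y)\<^sup>2 / s"
proof -
  have "Re (cnj x * y) \<le> cmod x * cmod y" by (metis complex_Re_le_cmod complex_mod_cnj norm_mult)
  moreover have "0 \<le> (s * cmod x - cmod y)\<^sup>2 / s" using assms by simp
  moreover have "(s * cmod x - cmod y)\<^sup>2 / s = s * (cmod x)\<^sup>2 + (cmod y)\<^sup>2 / s - 2 * (cmod x * cmod y)"
    using assms by (simp add: power2_eq_square field_simps)
  ultimately show ?thesis by linarith
qed

lemma two_Re_sum_le:
  assumes "0 < s"
  shows "2 * Re (\<Sum>j<k. cnj (x j) * y j) \<le> s * nsq k x + nsq k y / s"
proof -
  have "2 * Re (\<Sum>j<k. cnj (x j) * y j) = (\<Sum>j<k. 2 * Re (cnj (x j) * y j))" by (simp add: sum_distrib_left)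
  also have "\<dots> \<le> (\<Sum>j<k. s * (cmod (x j))\<^sup>2 + (cmod (y j))\<^sup>2 / s)" by (intro sum_mono two_Re_le assms)
  also have "\<dots> = s * nsq k x + nsq k y / s" by (simp add: nsq_def sum.distrib sum_distrib_left sum_divide_distrib)
  finally show ?thesis .
qed

lemma cmod_ip_le: "cmod (ip N x y) \<le> sqrt (nsq N x) * sqrt (nsq N y)"
proof -
  have "cmod (ip N x y) \<le> (\<Sum>i<N. \<bar>cmod (x i)\<bar> * \<bar>cmod (y i)\<bar>)"
    unfolding ip_def by (rule order_trans[OF norm_sum]) (simp add: norm_mult)
  also have "\<dots> \<le> sqrt (nsq N x) * sqrt (nsq N y)"
    using L2_set_mult_ineq[of "\<lambda>i. cmod (x i)" "\<lambda>i. cmod (y i)" "{..<N}"] by (simp add: L2_set_def nsq_def)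
  finally show ?thesis .
qed

lemma dil_form:
  assumes A: "A \<in> carrier_mat n k"
  shows "Re (ip (n + k) x (mv (n + k) (dil n k A) x)) = 2 * Re (\<Sum>j<k. cnj (x (n + j)) * adj_app n A x j)"
proof -
  have up: "mv (n + k) (dil n k A) x i = (\<Sum>j<k. A $$ (i,j) * x (n + j))" if "i < n" for i
    unfolding mv_def sum_join using that by (simp add: dil_index[OF A])
  have lo: "mv (n + k) (dil n k A) x (n + j) = adj_app n A x j" if "j < k" for j
    unfolding mv_def sum_join adj_app_def using that by (simp add: dil_index[OF A])
  have "(\<Sum>i<n. cnj (x i) * mv (n + k) (dil n k A) x i) = (\<Sum>i<n. \<Sum>j<k. cnj (x i) * (A $$ (i,j) * x (n + j)))"
    by (simp add: up sum_distrib_left)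
  also have "\<dots> = (\<Sum>j<k. \<Sum>i<n. cnj (x i) * (A $$ (i,j) * x (n + j)))" by (rule sum.swap)
  also have "\<dots> = cnj (\<Sum>j<k. cnj (x (n + j)) * adj_app n A x j)"
    unfolding adj_app_def by (simp add: sum_distrib_left mult_ac)
  finally show ?thesis unfolding ip_def sum_join by (simp add: lo)
qed

lemma dil_form_le:
  assumes A: "A \<in> carrier_mat n k" and s: "0 < s" and le: "nsq k (adj_app n A x) \<le> s\<^sup>2 * nsq n x"
  shows "Re (ip (n + k) x (mv (n + k) (dil n k A) x)) \<le> s * nsq (n + k) x"
proof -
  have "Re (ip (n + k) x (mv (n + k) (dil n k A) x)) \<le> s * nsq k (\<lambda>j. x (n + j)) + nsq k (adj_app n A x) / s"
    unfolding dil_form[OF A] by (rule two_Re_sum_le[OF s])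
  also have "nsq k (adj_app n A x) / s \<le> s * nsq n x"
    using le s by (simp add: divide_le_eq power2_eq_square mult_ac)
  finally show ?thesis unfolding nsq_join distrib_left by linarith
qed

text \<open>The two directions in which \<open>z I - H\<close> controls \<open>z\<^sup>2 I - A A\<^sup>H\<close>, its Schur complement up to
  the factor \<open>z\<close>.\<close>

lemma adj_app_gt_of_form:
  assumes A: "A \<in> carrier_mat n k" and z: "0 < z"
    and neg: "z * nsq (n + k) x < Re (ip (n + k) x (mv (n + k) (dil n k A) x))"
  shows "z\<^sup>2 * nsq n x < nsq k (adj_app n A x)"
proof -
  have "Re (ip (n + k) x (mv (n + k) (dil n k A) x)) \<le> z * nsq k (\<lambda>j. x (n + j)) + nsq k (adj_app n A x) / z"
    unfolding dil_form[OF A] by (rule two_Re_sum_le[OF z])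
  with neg have "z * nsq n x < nsq k (adj_app n A x) / z" unfolding nsq_join distrib_left by linarith
  then show ?thesis using z by (simp add: less_divide_eq power2_eq_square mult_ac)
qed

lemma adj_app_le_of_form:
  assumes A: "A \<in> carrier_mat n k" and z: "0 < z"
    and x: "x = join n y (\<lambda>j. adj_app n A y j / of_real z)"
    and nonneg: "Re (ip (n + k) x (mv (n + k) (dil n k A) x)) \<le> z * nsq (n + k) x"
  shows "nsq k (adj_app n A y) \<le> z\<^sup>2 * nsq n y"
proof -
  have ax: "adj_app n A x j = adj_app n A y j" for j by (simp add: adj_app_def x join_def)
  have n1: "nsq n x = nsq n y" by (simp add: nsq_def x join_def)
  have n2: "nsq k (\<lambda>j. x (n + j)) = nsq k (adj_app n A y) / z\<^sup>2"
    using z by (simp add: nsq_def x join_def norm_divide power_divide sum_divide_distrib)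
  \<comment> \<open>The lower half A^H y / z minimises the form of z I - H for the given upper half
    y, so nonnegativity there is the sharp information about y.\<close>
  have "(\<Sum>j<k. cnj (x (n + j)) * adj_app n A x j) = of_real (nsq k (adj_app n A y) / z)"
    unfolding ax of_real_divide of_real_nsq sum_divide_distrib by (simp add: x join_def)
  then have "2 * (nsq k (adj_app n A y) / z) \<le> z * (nsq n y + nsq k (adj_app n A y) / z\<^sup>2)"
    using nonneg unfolding dil_form[OF A] nsq_join n1 n2 by simp
  then show ?thesis using z by (simp add: field_simps power2_eq_square)
qed

text \<open>A nonzero kernel vector of z I - H would have form value z |x|^2 > s |x|^2, so the
  determinant is nonzero and the adjugate gives the solution.\<close>

lemma resolvent_exists:
  assumes H: "H \<in> carrier_mat N N" and le: "\<And>x. Re (ip N x (mv N H x)) \<le> s * nsq N x" and z: "s < z"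
  shows "\<exists>g. \<forall>i<N. of_real z * g i - mv N H g i = w i"
proof -
  define F where "F = complex_of_real z \<cdot>\<^sub>m 1\<^sub>m N - H"
  have F: "F \<in> carrier_mat N N" unfolding F_def by (rule minus_carrier_mat[OF H])
  have mvF: "mv N F x i = of_real z * x i - mv N H x i" if "i < N" for x i
  proof -
    have "mv N F x i = (\<Sum>j<N. (if i = j then of_real z * x j else 0) - H $$ (i,j) * x j)"
      unfolding mv_def by (intro sum.cong refl) (use that H in \<open>auto simp: F_def algebra_simps\<close>)
    then show ?thesis using that by (simp add: sum_subtractf mv_def)
  qed
  have "det F \<noteq> 0"
  proof
    assume "det F = 0"
    then obtain vv where vv: "vv \<in> carrier_vec N" "vv \<noteq> 0\<^sub>v N" "F *\<^sub>v vv = 0\<^sub>v N"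
      using det_0_iff_vec_prod_zero_field[OF F] by auto
    define x where "x = vec_index vv"
    have "mv N F x i = 0" if "i < N" for i
    proof -
      have "vec_index (F *\<^sub>v vv) i = mv N F x i" using that vv(1) F
        by (auto simp: scalar_prod_def lessThan_atLeast0 mv_def x_def intro!: sum.cong)
      then show ?thesis using vv that by simp
    qed
    then have "ip N x (mv N H x) = ip N x (\<lambda>i. of_real z * x i)"
      using mvF by (intro ip_cong) auto
    also have "\<dots> = of_real (z * nsq N x)" by (simp add: ip_def of_real_nsq sum_distrib_left mult_ac)
    finally have "z * nsq N x \<le> s * nsq N x" using le[of x] by simp
    then have "nsq N x = 0" using z nsq_nonneg[of N x] by (smt (verit) mult_right_mono mult_strict_right_mono)
    then have "vv = 0\<^sub>v N" using vv(1) by (auto simp: nsq_eq_0 x_def intro!: eq_vecI)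
    then show False using vv by simp
  qed
  define g where "g i = (\<Sum>j<N. adj_mat F $$ (i,j) * w j) / det F" for i
  have aF: "adj_mat F \<in> carrier_mat N N" and FF: "F * adj_mat F = det F \<cdot>\<^sub>m 1\<^sub>m N" using adj_mat[OF F] by auto
  have "mv N F g i = w i" if i: "i < N" for i
  proof -
    have "mv N F g i = mv N F (mv N (adj_mat F) w) i / det F"
      by (simp add: mv_def g_def flip: sum_divide_distrib)
    also have "mv N F (mv N (adj_mat F) w) i = mv N (det F \<cdot>\<^sub>m 1\<^sub>m N) w i"
      using mv_mult[OF F aF i] FF by simp
    also have "\<dots> = det F * w i"
    proof -
      have "mv N (det F \<cdot>\<^sub>m 1\<^sub>m N) w i = (\<Sum>j<N. if i = j then det F * w j else 0)"
        unfolding mv_def by (intro sum.cong refl) (use i in auto)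
      then show ?thesis using i by simp
    qed
    finally show ?thesis using \<open>det F \<noteq> 0\<close> by simp
  qed
  then have "\<forall>i<N. of_real z * g i - mv N H g i = w i" by (simp add: mvF)
  then show ?thesis by blast
qed

lemma resolvent_form:
  assumes g: "\<And>i. i < N \<Longrightarrow> of_real z * g i - mv N H g i = w i"
  shows "ip N x w = of_real z * ip N x g - ip N x (mv N H g)"
proof -
  have "ip N x w = ip N x (\<lambda>i. of_real z * g i - mv N H g i)" by (rule ip_cong) (simp_all add: g)
  also have "\<dots> = of_real z * ip N x g - ip N x (mv N H g)"
    by (simp add: ip_def sum_subtractf sum_distrib_left algebra_simps)
  finally show ?thesis .
qed

lemma ip_self: "ip N x x = of_real (nsq N x)"
  by (simp add: ip_def of_real_nsq)

text \<open>Coercivity: the form of z I - H at g is at least (z - s) |g|^2, and the pairing of g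
  with w is split by Young's inequality with weight z - s.\<close>

lemma resolvent_norm:
  assumes le: "\<And>x. Re (ip N x (mv N H x)) \<le> s * nsq N x" and z: "s < z"
    and g: "\<And>i. i < N \<Longrightarrow> of_real z * g i - mv N H g i = w i"
  shows "(z - s)\<^sup>2 * nsq N g \<le> nsq N w"
proof -
  have "(z - s) * nsq N g \<le> Re (ip N g w)"
    using le[of g] by (simp add: resolvent_form[OF g] ip_self algebra_simps)
  moreover have "2 * Re (ip N g w) \<le> (z - s) * nsq N g + nsq N w / (z - s)"
    unfolding ip_def using z by (intro two_Re_sum_le) simp
  ultimately have "(z - s) * nsq N g \<le> nsq N w / (z - s)" by linarith
  then show ?thesis using z by (simp add: le_divide_eq power2_eq_square mult_ac)
qed

text \<open>An exact identity with remainder H^L g / z^L; convergence is discussed only where the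
  remainder is estimated.\<close>

lemma neumann_expansion:
  assumes H: "H \<in> carrier_mat N N" and z: "z \<noteq> (0 :: complex)"
    and g: "\<And>i. i < N \<Longrightarrow> z * g i - mv N H g i = w i"
  shows "ip N x g = (\<Sum>p<L. ip N x (mv N (H ^\<^sub>m p) w) / z ^ Suc p) + ip N x (mv N (H ^\<^sub>m L) g) / z ^ L"
proof (induction L)
  case 0
  have "ip N x (mv N (H ^\<^sub>m 0) g) = ip N x g" using H by (intro ip_cong) (auto simp: mv_one)
  then show ?case by simp
next
  case (Suc L)
  have PL: "H ^\<^sub>m L \<in> carrier_mat N N" using H by simp
  have "mv N (H ^\<^sub>m L) w = mv N (H ^\<^sub>m L) (\<lambda>i. z * g i - mv N H g i)"
    by (rule mv_cong) (simp add: g)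
  also have "\<dots> = (\<lambda>i. z * mv N (H ^\<^sub>m L) g i - mv N (H ^\<^sub>m L) (mv N H g) i)"
    by (auto simp: fun_eq_iff mv_def[of N "H ^\<^sub>m L"] algebra_simps sum_subtractf sum_distrib_left)
  finally have "ip N x (mv N (H ^\<^sub>m L) w) = z * ip N x (mv N (H ^\<^sub>m L) g) - ip N x (mv N (H ^\<^sub>m L) (mv N H g))"
    by (simp add: ip_def algebra_simps sum_subtractf sum_distrib_left)
  also have "ip N x (mv N (H ^\<^sub>m L) (mv N H g)) = ip N x (mv N (H ^\<^sub>m Suc L) g)"
    by (rule ip_cong) (simp_all add: mv_mult[OF PL H])
  finally have "ip N x (mv N (H ^\<^sub>m L) g) / z ^ L = 
     ip N x (mv N (H ^\<^sub>m L) w) / z ^ Suc L + ip N x (mv N (H ^\<^sub>m Suc L) g) / z ^ Suc L"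
    using z by (simp add: field_simps)
  then show ?case using Suc by simp
qed

lemma nsq_mv_hermitian:
  assumes P: "P \<in> carrier_mat N N" "adj P = P"
  shows "nsq N (mv N P x) = Re (ip N x (mv N (P * P) x))"
proof -
  have "ip N x (mv N (P * P) x) = ip N x (mv N P (mv N P x))"
    by (rule ip_cong) (simp_all add: mv_mult[OF P(1) P(1)])
  also have "\<dots> = ip N (mv N P x) (mv N P x)" by (subst ip_mv_adj[OF P(1)]) (simp add: P(2))
  finally show ?thesis by (simp add: ip_self)
qed

text \<open>Interchange of limits: \<open>e L\<close> bounds the error for all large n, so n may
  grow for a fixed L chosen beforehand.\<close>

lemma tendsto_of_approximations:
  fixes G :: "nat \<Rightarrow> 'a :: real_normed_vector"
  assumes ap: "\<And>L. 1 \<le> L \<Longrightarrow> \<forall>\<^sub>F n in sequentially. norm (G n - A L n) \<le> e L"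
    and A: "\<And>L. A L \<longlonglongrightarrow> a L" and a: "a \<longlonglongrightarrow> K" and e: "e \<longlonglongrightarrow> 0"
  shows "G \<longlonglongrightarrow> K"
proof (rule tendstoI)
  fix d :: real assume d: "0 < d"
  have "\<forall>\<^sub>F L in sequentially. 1 \<le> L \<and> e L < d / 3 \<and> dist (a L) K < d / 3"
    using eventually_ge_at_top[of 1] order_tendstoD(2)[OF e, of "d / 3"] tendstoD[OF a, of "d / 3"] d
    by (auto simp: eventually_conj_iff)
  then obtain L where L: "1 \<le> L" "e L < d / 3" "dist (a L) K < d / 3"
    by (auto dest!: eventually_happens'[rotated])
  have "\<forall>\<^sub>F n in sequentially. dist (A L n) (a L) < d / 3" by (rule tendstoD[OF A]) (use d in simp)
  with ap[OF L(1)] show "\<forall>\<^sub>F n in sequentially. dist (G n) K < d"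
  proof eventually_elim
    case (elim n)
    have "dist (G n) K \<le> dist (G n) (A L n) + (dist (A L n) (a L) + dist (a L) K)"
      using dist_triangle[of "G n" K "A L n"] dist_triangle[of "A L n" K "a L"] by linarith
    then show ?case using elim L by (simp add: dist_norm)
  qed
qed

section \<open>Generating series of the two sequences of block means\<close>

context invariant_noise
begin

lemma integrable_of_bound:
  fixes f :: "real \<Rightarrow> real"
  assumes "f \<in> borel_measurable borel" "\<And>t. 0 \<le> t \<Longrightarrow> t \<le> b \<Longrightarrow> \<bar>f t\<bar> \<le> C"
  shows "integrable muX f"
proof -
  interpret mu: prob_space muX by (rule muX_prob)
  show ?thesis
  proof (rule mu.integrable_const_bound[of _ C])
    show "AE t in muX. norm (f t) \<le> C" using AE_muX by eventually_elim (use assms in auto)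
  qed (use assms in \<open>simp add: muX_measurable\<close>)
qed

lemma integral_le_bound:
  fixes f :: "real \<Rightarrow> real"
  assumes "f \<in> borel_measurable borel" "\<And>t. 0 \<le> t \<Longrightarrow> t \<le> b \<Longrightarrow> 0 \<le> f t \<and> f t \<le> C"
  shows "0 \<le> (\<integral>t. f t \<partial>muX)" "(\<integral>t. f t \<partial>muX) \<le> C"
proof -
  interpret mu: prob_space muX by (rule muX_prob)
  have i: "integrable muX f" using assms by (intro integrable_of_bound[of _ C]) auto
  show "0 \<le> (\<integral>t. f t \<partial>muX)"
  proof (rule integral_nonneg_AE)
    show "AE t in muX. 0 \<le> f t" using AE_muX by eventually_elim (use assms in auto)
  qed
  have "(\<integral>t. f t \<partial>muX) \<le> (\<integral>t. C \<partial>muX)"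
  proof (rule integral_mono_AE)
    show "AE t in muX. f t \<le> C" using AE_muX by eventually_elim (use assms in auto)
  qed (use i in auto)
  then show "(\<integral>t. f t \<partial>muX) \<le> C" by (simp add: mu.prob_space)
qed

lemma mom1_bound: "0 \<le> mom1 muX p" "mom1 muX p \<le> b ^ p"
  unfolding mom1_def using integral_le_bound[of "\<lambda>t. t ^ p" "b ^ p"] b_nonneg by (auto intro: power_mono)

text \<open>z / (z^2 - t^2) is the even part in t of 1 / (z - t). Its geometric series is dominated
  on [0, b] by that of b/z, so it may be integrated term by term.\<close>

lemma mom1_sums:
  assumes z: "b < z"
  shows "(\<lambda>p. mom1 muX p / z ^ Suc p) sums phi_tr muX z"
proof -
  have z0: "0 < z" using z b_nonneg by simp
  define f where "f p t = (if even p then t ^ p else 0) / z ^ Suc p" for p and t :: real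
  have fm: "f p \<in> borel_measurable borel" for p unfolding f_def by (cases "even p") auto
  have sf: "(\<lambda>p. f p t) sums (z / (z\<^sup>2 - t\<^sup>2))" if t: "0 \<le> t" "t \<le> b" for t
  proof -
    have "\<bar>t / z\<bar> < 1" "\<bar>- t / z\<bar> < 1" using t z z0 by auto
    then have "(\<lambda>p. (t / z) ^ p) sums (1 / (1 - t / z))" "(\<lambda>p. (- t / z) ^ p) sums (1 / (1 - (- t / z)))"
      by (intro geometric_sums; simp)+
    then have "(\<lambda>p. ((t / z) ^ p + (- t / z) ^ p) * (1 / (2 * z))) sums ((1 / (1 - t / z) + 1 / (1 - (- t / z))) * (1 / (2 * z)))"
      by (intro sums_mult2 sums_add)
    moreover have "((t / z) ^ p + (- t / z) ^ p) * (1 / (2 * z)) = f p t" for p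
      using z0 by (auto simp: f_def power_divide power_minus_odd)
    moreover have "(1 / (1 - t / z) + 1 / (1 - (- t / z))) * (1 / (2 * z)) = z / (z\<^sup>2 - t\<^sup>2)"
    proof -
      have "z - t \<noteq> 0" "z + t \<noteq> 0" using t z z0 by auto
      moreover have "z\<^sup>2 - t\<^sup>2 = (z - t) * (z + t)" by (simp add: power2_eq_square algebra_simps)
      ultimately show ?thesis using z0 by (simp add: divide_simps) (simp add: algebra_simps)
    qed
    ultimately show ?thesis by simp
  qed
  have fb: "0 \<le> f p t \<and> f p t \<le> b ^ p / z ^ Suc p" if "0 \<le> t" "t \<le> b" for p t
    using that z0 b_nonneg by (auto simp: f_def intro!: divide_right_mono power_mono)
  have sb: "summable (\<lambda>p. b ^ p / z ^ Suc p)"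
  proof -
    have "summable (\<lambda>p. (b / z) ^ p * (1 / z))" using z z0 b_nonneg by (intro summable_mult2 summable_geometric) auto
    then show ?thesis using z0 by (simp add: power_divide mult_ac)
  qed
  have "(\<lambda>p. \<integral>t. f p t \<partial>muX) sums (\<integral>t. (\<Sum>p. f p t) \<partial>muX)"
  proof (rule sums_integral)
    show "integrable muX (f p)" for p
      using fm fb by (intro integrable_of_bound[of _ "b ^ p / z ^ Suc p"]) auto
    show "AE t in muX. summable (\<lambda>p. norm (f p t))"
      using AE_muX
    proof eventually_elim
      case (elim t)
      then have "norm (f p t) = f p t" for p using fb by simp
      then show ?case using sf[of t] elim by (simp add: sums_iff)
    qed
    show "summable (\<lambda>p. \<integral>t. norm (f p t) \<partial>muX)"
    proof (rule summable_comparison_test'[OF sb, of 0])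
      fix p
      show "norm (\<integral>t. norm (f p t) \<partial>muX) \<le> b ^ p / z ^ Suc p"
        using integral_le_bound[of "\<lambda>t. norm (f p t)" "b ^ p / z ^ Suc p"] fb fm[of p] by auto
    qed
  qed
  moreover have "(\<integral>t. (\<Sum>p. f p t) \<partial>muX) = phi_tr muX z"
    unfolding phi_tr_def
  proof (rule integral_cong_AE)
    show "AE t in muX. (\<Sum>p. f p t) = z / (z\<^sup>2 - t\<^sup>2)" using AE_muX by eventually_elim (use sf in \<open>auto simp: sums_iff\<close>)
    show "(\<lambda>t. \<Sum>p. f p t) \<in> borel_measurable muX" using fm by (intro borel_measurable_suminf) (simp add: muX_measurable)
  qed (simp add: muX_measurable)
  moreover have "(\<integral>t. f p t \<partial>muX) = mom1 muX p / z ^ Suc p" for p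
    by (simp add: f_def mom1_def)
  ultimately show ?thesis by simp
qed

text \<open>At p = 0 the second sequence has 1 = c + (1 - c), so the series is \<open>c\<close>
  times the first one plus the single term (1 - c)/z.\<close>

lemma mom2_sums:
  assumes z: "b < z"
  shows "(\<lambda>p. mom2 c muX p / z ^ Suc p) sums (c * phi_tr muX z + (1 - c) / z)"
proof -
  interpret mu: prob_space muX by (rule muX_prob)
  have "(\<lambda>p. (if p \<in> {0} then (1 - c) / z else 0)) sums (\<Sum>p\<in>{0::nat}. (1 - c) / z)"
    by (rule sums_If_finite_set) simp
  from sums_add[OF sums_mult[OF mom1_sums[OF z], of c] this]
  have "(\<lambda>p. c * (mom1 muX p / z ^ Suc p) + (if p \<in> {0} then (1 - c) / z else 0)) sums (c * phi_tr muX z + (1 - c) / z)" by simp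
  moreover have "c * (mom1 muX p / z ^ Suc p) + (if p \<in> {0} then (1 - c) / z else 0) = mom2 c muX p / z ^ Suc p" for p
    by (auto simp: mom2_def mom1_def mu.prob_space add_divide_distrib[symmetric])
  ultimately show ?thesis by simp
qed

text \<open>The bound 1/z carries over to the companion factor, a mixture of \<open>phi_tr\<close>
  and 1/z with weights c and 1 - c, so both factors of \<open>D_tr\<close> are positive.\<close>

lemma phi_tr_ge: "b < z \<Longrightarrow> 1 / z \<le> phi_tr muX z"
proof -
  assume z: "b < z"
  interpret mu: prob_space muX by (rule muX_prob)
  have z0: "0 < z" using z b_nonneg by simp
  have "(\<integral>t. 1 / z \<partial>muX) \<le> phi_tr muX z" unfolding phi_tr_def
  proof (rule integral_mono_AE)
    have bz: "z\<^sup>2 - t\<^sup>2 \<ge> z\<^sup>2 - b\<^sup>2" "z\<^sup>2 - b\<^sup>2 > 0" "z\<^sup>2 - t\<^sup>2 \<le> z\<^sup>2" if "0 \<le> t" "t \<le> b" for t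
      using that z b_nonneg by (auto simp: power_strict_mono power_mono)
    show "integrable muX (\<lambda>t. z / (z\<^sup>2 - t\<^sup>2))"
    proof (rule integrable_of_bound[of _ "z / (z\<^sup>2 - b\<^sup>2)"])
      show "\<bar>z / (z\<^sup>2 - t\<^sup>2)\<bar> \<le> z / (z\<^sup>2 - b\<^sup>2)" if "0 \<le> t" "t \<le> b" for t
        using bz[OF that] z0 by (auto intro!: divide_left_mono)
    qed simp
    show "AE t in muX. 1 / z \<le> z / (z\<^sup>2 - t\<^sup>2)" using AE_muX
    proof eventually_elim
      case (elim t)
      have "0 < z\<^sup>2 - t\<^sup>2" using bz[of t] elim by linarith
      then show ?case using z0 by (simp add: divide_simps) (simp add: power2_eq_square)
    qed
  qed simp
  then show ?thesis by (simp add: mu.prob_space)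
qed

lemma phi_tr_pos: "b < z \<Longrightarrow> 0 < phi_tr muX z"
  using phi_tr_ge[of z] b_nonneg by (smt (verit) zero_less_divide_1_iff)

lemma phi_tr_companion_pos: "b < z \<Longrightarrow> 0 < c * phi_tr muX z + (1 - c) / z"
proof -
  assume z: "b < z"
  then have z0: "0 < z" using b_nonneg by simp
  have "c * (1 / z) \<le> c * phi_tr muX z" using phi_tr_ge[OF z] c_nonneg by (intro mult_left_mono)
  then have "1 / z \<le> c * phi_tr muX z + (1 - c) / z" by (simp add: diff_divide_distrib)
  then show ?thesis using z0 by (smt (verit) zero_less_divide_1_iff)
qed

end

section \<open>The compressed resolvent\<close>

lemma form_bound:
  "cmod (\<Sum>i<p. \<Sum>j<p. cnj (c i) * c j * E i j) \<le> (\<Sum>i<p. \<Sum>j<p. cmod (E i j)) * nsq p c"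
proof -
  have c: "cmod (c i) * cmod (c j) \<le> nsq p c" if "i < p" "j < p" for i j
  proof -
    have "(cmod (c i))\<^sup>2 \<le> nsq p c" if "i < p" for i
      unfolding nsq_def using that by (intro member_le_sum) auto
    then have "(cmod (c i))\<^sup>2 \<le> nsq p c" "(cmod (c j))\<^sup>2 \<le> nsq p c" using that by auto
    then show ?thesis using sum_squares_bound[of "cmod (c i)" "cmod (c j)"] by linarith
  qed
  have "cmod (\<Sum>i<p. \<Sum>j<p. cnj (c i) * c j * E i j) \<le> (\<Sum>i<p. \<Sum>j<p. cmod (cnj (c i) * c j * E i j))"
    by (intro order_trans[OF norm_sum] sum_mono norm_sum)
  also have "\<dots> \<le> (\<Sum>i<p. \<Sum>j<p. nsq p c * cmod (E i j))"
    by (intro sum_mono) (simp add: norm_mult, intro mult_right_mono, use c in auto)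
  finally show ?thesis by (simp add: sum_distrib_left mult.commute)
qed

text \<open>Convergence of finitely many entries gives negativity for all coefficients at once: the
  perturbation is at most the sum of the entry errors times \<open>nsq p c\<close>, set against the
  smallest \<open>d i\<close>.\<close>

lemma eventually_form_negative:
  fixes p :: nat
  assumes E: "\<And>i j. i < p \<Longrightarrow> j < p \<Longrightarrow> (\<lambda>n. E n i j) \<longlonglongrightarrow> complex_of_real (if i = j then - d i else 0)"
    and d: "\<And>i. i < p \<Longrightarrow> 0 < d i"
  shows "\<forall>\<^sub>F n in sequentially. \<forall>c. (\<exists>i<p. c i \<noteq> 0) \<longrightarrow> Re (\<Sum>i<p. \<Sum>j<p. cnj (c i) * c j * E n i j) < 0"
proof (cases "p = 0")
  case False
  define d0 where "d0 = Min (d ` {..<p})"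
  have ne: "d ` {..<p} \<noteq> {}" using False by (auto simp: lessThan_empty_iff)
  have "d0 \<in> d ` {..<p}" unfolding d0_def by (rule Min_in[OF _ ne]) simp
  then have d0: "0 < d0" using d by auto
  have d0le: "d0 \<le> d i" if "i < p" for i unfolding d0_def by (rule Min_le) (use that in auto)
  define K where "K i j = complex_of_real (if i = j then - d i else 0)" for i j
  have "(\<lambda>n. \<Sum>i<p. \<Sum>j<p. cmod (E n i j - K i j)) \<longlonglongrightarrow> (\<Sum>i<p. \<Sum>j<p. cmod (K i j - K i j))"
    by (intro tendsto_sum tendsto_norm tendsto_diff tendsto_const) (use E in \<open>auto simp: K_def\<close>)
  then have "\<forall>\<^sub>F n in sequentially. (\<Sum>i<p. \<Sum>j<p. cmod (E n i j - K i j)) < d0"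
    using d0 by (intro order_tendstoD(2)) auto
  then show ?thesis
  proof eventually_elim
    case (elim n)
    show ?case
    proof (intro allI impI)
      fix c :: "nat \<Rightarrow> complex" assume c: "\<exists>i<p. c i \<noteq> 0"
      then have "nsq p c \<noteq> 0" by (auto simp: nsq_eq_0)
      then have npos: "0 < nsq p c" by (simp add: less_le)
      have "(\<Sum>i<p. \<Sum>j<p. cnj (c i) * c j * E n i j) = (\<Sum>i<p. \<Sum>j<p. cnj (c i) * c j * K i j) + 
          (\<Sum>i<p. \<Sum>j<p. cnj (c i) * c j * (E n i j - K i j))"
        by (simp add: sum.distrib[symmetric] algebra_simps)
      moreover have "Re (\<Sum>i<p. \<Sum>j<p. cnj (c i) * c j * K i j) \<le> - d0 * nsq p c"
      proof -
        have "(\<Sum>i<p. \<Sum>j<p. cnj (c i) * c j * K i j) = (\<Sum>i<p. of_real (- d i * (cmod (c i))\<^sup>2))"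
        proof (intro sum.cong refl)
          fix i assume i: "i \<in> {..<p}"
          have "(\<Sum>j<p. cnj (c i) * c j * K i j) = (\<Sum>j<p. if i = j then cnj (c i) * c i * of_real (- d i) else 0)"
            by (intro sum.cong refl) (simp add: K_def)
          also have "\<dots> = of_real (- d i * (cmod (c i))\<^sup>2)"
            using i complex_norm_square[of "c i"] by (simp add: mult_ac)
          finally show "(\<Sum>j<p. cnj (c i) * c j * K i j) = of_real (- d i * (cmod (c i))\<^sup>2)" .
        qed
        then have "Re (\<Sum>i<p. \<Sum>j<p. cnj (c i) * c j * K i j) = (\<Sum>i<p. - d i * (cmod (c i))\<^sup>2)"
          by (simp del: of_real_mult)
        also have "\<dots> \<le> (\<Sum>i<p. - d0 * (cmod (c i))\<^sup>2)" using d0le by (intro sum_mono mult_right_mono) auto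
        finally show ?thesis by (simp add: nsq_def sum_distrib_left)
      qed
      moreover have "Re (\<Sum>i<p. \<Sum>j<p. cnj (c i) * c j * (E n i j - K i j)) < d0 * nsq p c"
      proof -
        have "Re (\<Sum>i<p. \<Sum>j<p. cnj (c i) * c j * (E n i j - K i j)) \<le> (\<Sum>i<p. \<Sum>j<p. cmod (E n i j - K i j)) * nsq p c"
          by (rule order_trans[OF complex_Re_le_cmod form_bound])
        also have "\<dots> < d0 * nsq p c" using elim npos by (rule mult_strict_right_mono)
        finally show ?thesis .
      qed
      ultimately show "Re (\<Sum>i<p. \<Sum>j<p. cnj (c i) * c j * E n i j) < 0" by simp
    qed
  qed
qed simp

lemma mv_sum: "mv N P (\<lambda>j. \<Sum>i<p. c i * x i j) k = (\<Sum>i<p. c i * mv N P (x i) k)"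
proof -
  have "mv N P (\<lambda>j. \<Sum>i<p. c i * x i j) k = (\<Sum>j<N. \<Sum>i<p. c i * (P $$ (k,j) * x i j))"
    by (simp add: mv_def sum_distrib_left mult_ac)
  also have "\<dots> = (\<Sum>i<p. \<Sum>j<N. c i * (P $$ (k,j) * x i j))" by (rule sum.swap)
  finally show ?thesis by (simp add: mv_def sum_distrib_left)
qed

lemma ip_sum_right: "ip N y (\<lambda>j. \<Sum>i<p. c i * x i j) = (\<Sum>i<p. c i * ip N y (x i))"
proof -
  have "ip N y (\<lambda>j. \<Sum>i<p. c i * x i j) = (\<Sum>j<N. \<Sum>i<p. c i * (cnj (y j) * x i j))"
    by (simp add: ip_def sum_distrib_left mult_ac)
  also have "\<dots> = (\<Sum>i<p. \<Sum>j<N. c i * (cnj (y j) * x i j))" by (rule sum.swap)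
  finally show ?thesis by (simp add: ip_def sum_distrib_left)
qed

lemma cnj_ip: "cnj (ip N x y) = ip N y x"
  by (simp add: ip_def mult.commute)

context spiked_model
begin

definition H :: "nat \<Rightarrow> 'a \<Rightarrow> complex mat" where
  "H n \<omega> = dil n (m n) (X n \<omega>)"

text \<open>Limits of the diagonal entries of the compressed resolvent: \<open>phi_tr\<close> on the
  u side, its companion for the right Gram matrix on the v side. Their product is
  \<open>D_tr\<close>.\<close>

definition kap :: "real \<Rightarrow> nat \<Rightarrow> real" where
  "kap z a = (if a < r then phi_tr muX z else c * phi_tr muX z + (1 - c) / z)"

text \<open>The columns \<open>(z I - H)\<^sup>-\<^sup>1 W\<^sub>a\<close> of the resolvent; they exist once \<open>z\<close> exceeds the largest singular value.\<close>

definition res :: "real \<Rightarrow> nat \<Rightarrow> 'a \<Rightarrow> nat \<Rightarrow> nat \<Rightarrow> complex" where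
  "res z n \<omega> a = (SOME g. \<forall>i<n + m n. of_real z * g i - mv (n + m n) (H n \<omega>) g i = W n a i)"

definition Gam :: "real \<Rightarrow> nat \<Rightarrow> 'a \<Rightarrow> nat \<Rightarrow> nat \<Rightarrow> complex" where
  "Gam z n \<omega> a a' = ip (n + m n) (W n a) (res z n \<omega> a')"

lemma H_carrier [simp]: "H n \<omega> \<in> carrier_mat (n + m n) (n + m n)"
  by (simp add: H_def)

lemma H_adj: "\<omega> \<in> space M \<Longrightarrow> adj (H n \<omega>) = H n \<omega>"
  unfolding H_def by (rule dil_adj[OF X_carrier])

lemma good_regular: "good \<omega> \<Longrightarrow> regular \<omega>" and good_space: "good \<omega> \<Longrightarrow> \<omega> \<in> space M"
  by (auto simp: good_def regular_space)

lemma eventually_form_le: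
  assumes \<omega>: "regular \<omega>" and s: "b < s"
  shows "\<forall>\<^sub>F n in sequentially. \<forall>x. Re (ip (n + m n) x (mv (n + m n) (H n \<omega>) x)) \<le> s * nsq (n + m n) x"
  using eventually_sval_le[OF \<omega> s] eventually_ge_at_top[of 1]
proof eventually_elim
  case (elim n)
  have A: "X n \<omega> \<in> carrier_mat n (m n)" using X_carrier[OF regular_space[OF \<omega>]] .
  have s0: "0 < s" using s b_nonneg by simp
  show ?case
  proof
    fix x
    have "nsq (m n) (adj_app n (X n \<omega>) x) \<le> (sval (X n \<omega>) 1)\<^sup>2 * nsq n x"
      by (rule adj_app_bound[OF A]) (use elim in simp)
    also have "\<dots> \<le> s\<^sup>2 * nsq n x"
      using elim sval_X_nonneg[OF \<omega>, of 1 n] by (intro mult_right_mono power_mono) auto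
    finally show "Re (ip (n + m n) x (mv (n + m n) (H n \<omega>) x)) \<le> s * nsq (n + m n) x"
      unfolding H_def by (rule dil_form_le[OF A s0])
  qed
qed

lemma res_eq:
  assumes "\<forall>x. Re (ip (n + m n) x (mv (n + m n) (H n \<omega>) x)) \<le> s * nsq (n + m n) x" "s < z" "i < n + m n"
  shows "of_real z * res z n \<omega> a i - mv (n + m n) (H n \<omega>) (res z n \<omega> a) i = W n a i"
proof -
  have "\<exists>g. \<forall>i<n + m n. of_real z * g i - mv (n + m n) (H n \<omega>) g i = W n a i"
    using assms(1,2) by (intro resolvent_exists[OF H_carrier]) auto
  from someI_ex[OF this] show ?thesis using assms(3) unfolding res_def by blast
qed

lemma mom_sums: "b < z \<Longrightarrow> (\<lambda>p. mom p a / z ^ Suc p) sums kap z a"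
  unfolding mom_def kap_def using mom1_sums[of z] mom2_sums[of z] by (cases "a < r") auto

lemma mom_bound: "1 \<le> p \<Longrightarrow> mom p a \<le> b ^ p"
proof -
  assume p: "1 \<le> p"
  have "c * mom1 muX p \<le> 1 * mom1 muX p" using c_le_1 mom1_bound by (intro mult_right_mono) auto
  then show ?thesis using p mom1_bound[of p] unfolding mom_def mom2_def by auto
qed

text \<open>For fixed L the Neumann sum converges as n grows and the remainder is eventually at most
  (s/z)^L / (z - s); L is sent to infinity last. The midpoint s leaves room on both sides.\<close>

lemma Gam_limit:
  assumes \<omega>: "good \<omega>" and z: "b < z" and a: "a < 2 * r" and a': "a' < 2 * r"
  shows "(\<lambda>n. Gam z n \<omega> a a') \<longlonglongrightarrow> complex_of_real (if a = a' then kap z a else 0)"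
proof -
  define s where "s = (b + z) / 2"
  have s: "b < s" "s < z" "0 < s" "0 < z" using z b_nonneg by (auto simp: s_def)
  let ?S = "\<lambda>p n a a'. ip (n + m n) (W n a) (mv (n + m n) (H n \<omega> ^\<^sub>m p) (W n a'))"
  have Slim: "(\<lambda>n. ?S p n a a') \<longlonglongrightarrow> complex_of_real (if a = a' then mom p a else 0)" if "a < 2 * r" "a' < 2 * r" for p a a'
    using \<omega> that unfolding good_def H_def by blast
  let ?A = "\<lambda>L n. \<Sum>p<L. ?S p n a a' / of_real z ^ Suc p"
  show ?thesis
  proof (rule tendsto_of_approximations[where A = ?A and e = "\<lambda>L. (s / z) ^ L / (z - s)" and
        a = "\<lambda>L. \<Sum>p<L. complex_of_real (if a = a' then mom p a else 0) / of_real z ^ Suc p"])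
    show "?A L \<longlonglongrightarrow> (\<Sum>p<L. complex_of_real (if a = a' then mom p a else 0) / of_real z ^ Suc p)" for L
      using s by (intro tendsto_intros Slim a a') auto
    show "(\<lambda>L. \<Sum>p<L. complex_of_real (if a = a' then mom p a else 0) / of_real z ^ Suc p) 
        \<longlonglongrightarrow> complex_of_real (if a = a' then kap z a else 0)"
    proof (cases "a = a'")
      case True
      have "(\<lambda>L. \<Sum>p<L. mom p a / z ^ Suc p) \<longlonglongrightarrow> kap z a" using mom_sums[OF z] unfolding sums_def .
      from tendsto_of_real[OF this, where 'a = complex] True show ?thesis by simp
    qed simp
    show "(\<lambda>L. (s / z) ^ L / (z - s)) \<longlonglongrightarrow> 0"
      using s by (intro tendsto_divide_zero LIMSEQ_power_zero) auto
    fix L :: nat assume L: "1 \<le> L"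
    \<comment> \<open>The remainder only involves the norm of H^L W_a, whose square is the form of
      H^(2L) and tends to a number below s^(2L). Thus the one-sided bound on H from
      \<open>eventually_form_le\<close> is enough.\<close>
    have "mom (2 * L) a \<le> b ^ (2 * L)" by (rule mom_bound) (use L in simp)
    also have "\<dots> < s ^ (2 * L)" using s b_nonneg L by (intro power_strict_mono) auto
    finally have "\<forall>\<^sub>F n in sequentially. Re (?S (2 * L) n a a) < s ^ (2 * L)"
      using tendsto_Re[OF Slim[OF a a, of "2 * L"]] by (intro order_tendstoD(2)) auto
    with eventually_form_le[OF good_regular[OF \<omega>] s(1)] eventually_ge_at_top[of r]
    show "\<forall>\<^sub>F n in sequentially. norm (Gam z n \<omega> a a' - ?A L n) \<le> (s / z) ^ L / (z - s)"
    proof eventually_elim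
      case (elim n)
      let ?g = "res z n \<omega> a'" and ?P = "H n \<omega> ^\<^sub>m L"
      have P: "?P \<in> carrier_mat (n + m n) (n + m n)" "adj ?P = ?P"
        using adj_pow[OF H_carrier H_adj[OF good_space[OF \<omega>]]] by auto
      note g = res_eq[OF elim(1) s(2), of _ a']
      have "Gam z n \<omega> a a' - ?A L n = ip (n + m n) (W n a) (mv (n + m n) ?P ?g) / of_real z ^ L"
        unfolding Gam_def by (subst neumann_expansion[OF H_carrier _ g, of _ L]) (use s in auto)
      also have "ip (n + m n) (W n a) (mv (n + m n) ?P ?g) = ip (n + m n) (mv (n + m n) ?P (W n a)) ?g"
        by (subst ip_mv_adj[OF P(1)]) (simp add: P(2))
      finally have "norm (Gam z n \<omega> a a' - ?A L n) = cmod (ip (n + m n) (mv (n + m n) ?P (W n a)) ?g) / z ^ L"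
        using s by (simp add: norm_divide norm_power)
      also have "\<dots> \<le> s ^ L * (1 / (z - s)) / z ^ L"
      proof (intro divide_right_mono)
        have "sqrt (nsq (n + m n) (mv (n + m n) ?P (W n a))) \<le> s ^ L"
        proof (rule real_le_lsqrt)
          show "nsq (n + m n) (mv (n + m n) ?P (W n a)) \<le> (s ^ L)\<^sup>2"
            unfolding nsq_mv_hermitian[OF P] pow_add[OF H_carrier] mult_2[symmetric] power_mult[symmetric]
            using elim(3) by (simp add: mult.commute)
        qed (use s in auto)
        moreover have "sqrt (nsq (n + m n) ?g) \<le> 1 / (z - s)"
        proof (rule real_le_lsqrt)
          have "(z - s)\<^sup>2 * nsq (n + m n) ?g \<le> nsq (n + m n) (W n a')"
            by (rule resolvent_norm[OF _ s(2) g]) (use elim(1) in auto)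
          also have "\<dots> = 1" using W_ip[OF elim(2) a' a'] by (simp add: ip_self)
          finally show "nsq (n + m n) ?g \<le> (1 / (z - s))\<^sup>2" unfolding power_divide using s
            by (intro mult_imp_le_div_pos) (simp_all add: mult.commute[of _ "(z - s)\<^sup>2"])
        qed (use s in auto)
        ultimately have "sqrt (nsq (n + m n) (mv (n + m n) ?P (W n a))) * sqrt (nsq (n + m n) ?g) \<le> s ^ L * (1 / (z - s))"
          using s by (intro mult_mono) auto
        then show "cmod (ip (n + m n) (mv (n + m n) ?P (W n a)) ?g) \<le> s ^ L * (1 / (z - s))"
          by (rule order_trans[OF cmod_ip_le])
      qed (use s in auto)
      also have "\<dots> = (s / z) ^ L / (z - s)" by (simp add: power_divide)
      finally show ?case .
    qed
  qed
qed

section \<open>The signal as a perturbation of the quadratic form\<close>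

definition Xt :: "nat \<Rightarrow> 'a \<Rightarrow> complex mat" where
  "Xt n \<omega> = signal n (m n) r \<theta> (u n) (v n) + X n \<omega>"

lemma Xt_carrier: "\<omega> \<in> space M \<Longrightarrow> Xt n \<omega> \<in> carrier_mat n (m n)"
  using X_carrier by (simp add: Xt_def signal_def)

lemma ip_W_left: "a < r \<Longrightarrow> ip (n + m n) (W n a) x = (\<Sum>i<n. cnj (uf n a i) * x i)"
  by (simp add: ip_def sum_join W_def join_def vf_def)

lemma ip_W_right: "ip (n + m n) (W n (r + a)) x = (\<Sum>j<m n. cnj (vf n (r + a) j) * x (n + j))"
  by (simp add: ip_def sum_join W_def join_def uf_def)

lemma adj_app_Xt:
  assumes \<omega>: "\<omega> \<in> space M" and j: "j < m n"
  shows "adj_app n (Xt n \<omega>) x j = adj_app n (X n \<omega>) x j + 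
    (\<Sum>l<r. of_real (\<theta> (Suc l)) * vf n (r + l) j * (\<Sum>i<n. cnj (uf n l i) * x i))"
proof -
  have "adj_app n (Xt n \<omega>) x j = (\<Sum>i<n. cnj (X n \<omega> $$ (i,j)) * x i + 
     (\<Sum>l<r. of_real (\<theta> (Suc l)) * vf n (r + l) j * (cnj (uf n l i) * x i)))"
    unfolding adj_app_def
  proof (intro sum.cong refl)
    fix i assume "i \<in> {..<n}"
    then have i: "i < n" by simp
    have "Xt n \<omega> $$ (i,j) = (\<Sum>l<r. of_real (\<theta> (Suc l)) * uf n l i * cnj (vf n (r + l) j)) + X n \<omega> $$ (i,j)"
      using i j X_carrier[OF \<omega>, of n] unfolding Xt_def signal_def
      by (subst index_add_mat) (auto simp: sum.atLeast1_atMost_eq uf_def vf_def)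
    then show "cnj (Xt n \<omega> $$ (i,j)) * x i = cnj (X n \<omega> $$ (i,j)) * x i + 
     (\<Sum>l<r. of_real (\<theta> (Suc l)) * vf n (r + l) j * (cnj (uf n l i) * x i))"
      by (simp add: algebra_simps sum_distrib_left)
  qed
  also have "\<dots> = adj_app n (X n \<omega>) x j + (\<Sum>i<n. \<Sum>l<r. of_real (\<theta> (Suc l)) * vf n (r + l) j * (cnj (uf n l i) * x i))"
    by (simp add: sum.distrib adj_app_def)
  also have "(\<Sum>i<n. \<Sum>l<r. of_real (\<theta> (Suc l)) * vf n (r + l) j * (cnj (uf n l i) * x i)) = 
      (\<Sum>l<r. \<Sum>i<n. of_real (\<theta> (Suc l)) * vf n (r + l) j * (cnj (uf n l i) * x i))" by (rule sum.swap)
  finally show ?thesis by (simp add: sum_distrib_left)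
qed

text \<open>The signal enters the form only through inner products with the 2 r vectors
  \<open>W n l\<close>, which is what reduces the problem to the compressed resolvent.\<close>

lemma form_Xt:
  assumes \<omega>: "\<omega> \<in> space M"
  shows "Re (ip (n + m n) x (mv (n + m n) (dil n (m n) (Xt n \<omega>)) x)) = 
    Re (ip (n + m n) x (mv (n + m n) (H n \<omega>) x)) + 
    2 * Re (\<Sum>l<r. of_real (\<theta> (Suc l)) * (cnj (ip (n + m n) (W n (r + l)) x) * ip (n + m n) (W n l) x))"
proof -
  have "(\<Sum>j<m n. cnj (x (n + j)) * adj_app n (Xt n \<omega>) x j) = (\<Sum>j<m n. cnj (x (n + j)) * adj_app n (X n \<omega>) x j) + 
     (\<Sum>j<m n. \<Sum>l<r. of_real (\<theta> (Suc l)) * (cnj (x (n + j)) * vf n (r + l) j * ip (n + m n) (W n l) x))"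
    unfolding sum.distrib[symmetric]
    by (intro sum.cong refl) (simp add: adj_app_Xt[OF \<omega>] ip_W_left algebra_simps sum_distrib_left)
  also have "(\<Sum>j<m n. \<Sum>l<r. of_real (\<theta> (Suc l)) * (cnj (x (n + j)) * vf n (r + l) j * ip (n + m n) (W n l) x)) = 
     (\<Sum>l<r. \<Sum>j<m n. of_real (\<theta> (Suc l)) * (cnj (x (n + j)) * vf n (r + l) j * ip (n + m n) (W n l) x))"
    by (rule sum.swap)
  also have "\<dots> = (\<Sum>l<r. of_real (\<theta> (Suc l)) * (cnj (ip (n + m n) (W n (r + l)) x) * ip (n + m n) (W n l) x))"
    by (simp add: ip_W_right sum_distrib_left sum_distrib_right mult_ac)
  finally show ?thesis unfolding dil_form[OF Xt_carrier[OF \<omega>]] H_def dil_form[OF X_carrier[OF \<omega>]] by simp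
qed

end

section \<open>Location of the outliers\<close>

lemma mv_diff: "mv N P (\<lambda>i. x i - y i) = (\<lambda>i. mv N P x i - mv N P y i)"
  by (simp add: mv_def fun_eq_iff right_diff_distrib sum_subtractf)

lemma ip_diff:
  "ip N (\<lambda>i. x i - y i) w = ip N x w - ip N y w" "ip N w (\<lambda>i. x i - y i) = ip N w x - ip N w y"
  by (simp_all add: ip_def left_diff_distrib right_diff_distrib sum_subtractf)

context spiked_model
begin

lemma kap_pos: "b < z \<Longrightarrow> 0 < kap z a"
  using phi_tr_pos phi_tr_companion_pos by (auto simp: kap_def)

lemma D_tr_kap: "a < r \<Longrightarrow> D_tr c muX z = kap z a * kap z (r + a)"
  by (simp add: D_tr_def kap_def)

text \<open>One trial vector per spike: the resolvent applied to a mixture of \<open>W n i\<close>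
  and \<open>W n (r + i)\<close>. On their span the form of z I minus the dilation of
  \<open>Xt\<close> is eventually negative, and the Schur complement turns this into p singular
  values beyond z.\<close>

lemma eventually_sval_gt:
  assumes \<omega>: "good \<omega>" and z: "b < z" and p: "1 \<le> p" "p \<le> r"
    and th: "\<And>l. l < p \<Longrightarrow> 0 < \<theta> (Suc l) \<and> 1 < (\<theta> (Suc l))\<^sup>2 * D_tr c muX z"
  shows "\<forall>\<^sub>F n in sequentially. z < sval (Xt n \<omega>) p"
proof -
  define s where "s = (b + z) / 2"
  have s: "b < s" "s < z" "0 < z" using z b_nonneg by (auto simp: s_def)
  define \<phi> where "\<phi> = kap z 0"
  define \<psi> where "\<psi> = kap z r"
  have pos: "0 < \<phi>" "0 < \<psi>" using kap_pos[OF z] by (auto simp: \<phi>_def \<psi>_def)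
  have kl: "kap z l = \<phi>" "kap z (r + l) = \<psi>" if "l < r" for l using that r_pos by (auto simp: kap_def \<phi>_def \<psi>_def)
  have D: "D_tr c muX z = \<phi> * \<psi>" using D_tr_kap[of 0 z] r_pos by (simp add: \<phi>_def \<psi>_def)
  \<comment> \<open>Chosen so that \<alpha>^2 \<phi> = \<beta>^2 \<psi> = \<phi> \<psi>. At this
    balance \<alpha>^2 \<phi> + \<beta>^2 \<psi> - 2 \<theta> (\<alpha> \<phi>)(\<beta> \<psi>) is
    negative as soon as \<theta>^2 \<phi> \<psi> > 1.\<close>
  define \<alpha> where "\<alpha> = sqrt \<psi>"
  define \<beta> where "\<beta> = sqrt \<phi>"
  have ab: "\<alpha>\<^sup>2 = \<psi>" "\<beta>\<^sup>2 = \<phi>" "0 < \<alpha>" "0 < \<beta>" using pos by (auto simp: \<alpha>_def \<beta>_def)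
  define x where "x n i j = of_real \<alpha> * res z n \<omega> i j + of_real \<beta> * res z n \<omega> (r + i) j" for n i j
  define \<zeta> where "\<zeta> n l i = of_real \<alpha> * Gam z n \<omega> l i + of_real \<beta> * Gam z n \<omega> l (r + i)" for n l i
  \<comment> \<open>The real part of the form with matrix E is the form of z I minus the dilation of
    \<open>Xt\<close> on the trial span; the cross term is left unsymmetrised.\<close>
  define E where "E n i j = of_real \<alpha> * cnj (\<zeta> n j i) + of_real \<beta> * cnj (\<zeta> n (r + j) i) - 
      2 * (\<Sum>l<r. of_real (\<theta> (Suc l)) * (cnj (\<zeta> n (r + l) i) * \<zeta> n l j))" for n i j
  have \<zeta>1: "(\<lambda>n. \<zeta> n l i) \<longlonglongrightarrow> of_real (if l = i then \<alpha> * \<phi> else 0)" if "l < r" "i < r" for l i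
  proof -
    have "(\<lambda>n. \<zeta> n l i) \<longlonglongrightarrow> of_real \<alpha> * of_real (if l = i then kap z l else 0) + of_real \<beta> * of_real (if l = r + i then kap z l else 0)"
      unfolding \<zeta>_def using that by (intro tendsto_intros Gam_limit[OF \<omega> z]) auto
    then show ?thesis using that kl by (cases "l = i") auto
  qed
  have \<zeta>2: "(\<lambda>n. \<zeta> n (r + l) i) \<longlonglongrightarrow> of_real (if l = i then \<beta> * \<psi> else 0)" if "l < r" "i < r" for l i
  proof -
    have "(\<lambda>n. \<zeta> n (r + l) i) \<longlonglongrightarrow> of_real \<alpha> * of_real (if r + l = i then kap z (r + l) else 0) + 
        of_real \<beta> * of_real (if r + l = r + i then kap z (r + l) else 0)"
      unfolding \<zeta>_def using that by (intro tendsto_intros Gam_limit[OF \<omega> z]) auto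
    then show ?thesis using that kl by (cases "l = i") auto
  qed
  \<comment> \<open>Equal to 2 \<phi> \<psi> (\<theta> sqrt(\<phi> \<psi>) - 1), which is positive
    exactly above the threshold.\<close>
  define d where "d i = 2 * (\<theta> (Suc i) * (\<beta> * \<psi>) * (\<alpha> * \<phi>)) - 2 * (\<phi> * \<psi>)" for i
  have dpos: "0 < d i" if "i < p" for i
  proof -
    have "1 < (\<theta> (Suc i) * (\<alpha> * \<beta>))\<^sup>2"
      using th[OF that] by (simp add: D power_mult_distrib ab mult_ac)
    then have "1\<^sup>2 < (\<theta> (Suc i) * (\<alpha> * \<beta>))\<^sup>2" by simp
    then have "1 < \<theta> (Suc i) * (\<alpha> * \<beta>)" by (rule power_less_imp_less_base) (use th[OF that] ab in auto)
    then have "\<phi> * \<psi> * 1 < \<phi> * \<psi> * (\<theta> (Suc i) * (\<alpha> * \<beta>))" using pos by (intro mult_strict_left_mono) auto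
    then show ?thesis by (simp add: d_def mult_ac)
  qed
  have Elim: "(\<lambda>n. E n i j) \<longlonglongrightarrow> complex_of_real (if i = j then - d i else 0)" if ij: "i < p" "j < p" for i j
  proof -
    have ir: "i < r" "j < r" using ij p by auto
    have "(\<lambda>n. E n i j) \<longlonglongrightarrow> of_real \<alpha> * cnj (of_real (if j = i then \<alpha> * \<phi> else 0)) + of_real \<beta> * cnj (of_real (if j = i then \<beta> * \<psi> else 0))
       - 2 * (\<Sum>l<r. of_real (\<theta> (Suc l)) * (cnj (of_real (if l = i then \<beta> * \<psi> else 0)) * of_real (if l = j then \<alpha> * \<phi> else 0)))"
      unfolding E_def using ir by (intro tendsto_intros \<zeta>1 \<zeta>2) auto
    also have "(\<Sum>l<r. of_real (\<theta> (Suc l)) * (cnj (of_real (if l = i then \<beta> * \<psi> else 0)) * complex_of_real (if l = j then \<alpha> * \<phi> else 0)))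
       = (\<Sum>l<r. if l = i then complex_of_real (if i = j then \<theta> (Suc i) * (\<beta> * \<psi>) * (\<alpha> * \<phi>) else 0) else 0)"
      by (intro sum.cong refl) auto
    also have "\<dots> = complex_of_real (if i = j then \<theta> (Suc i) * (\<beta> * \<psi>) * (\<alpha> * \<phi>) else 0)" using ir by simp
    also have "of_real \<alpha> * cnj (of_real (if j = i then \<alpha> * \<phi> else 0)) + of_real \<beta> * cnj (of_real (if j = i then \<beta> * \<psi> else 0))
       - 2 * complex_of_real (if i = j then \<theta> (Suc i) * (\<beta> * \<psi>) * (\<alpha> * \<phi>) else 0) = complex_of_real (if i = j then - d i else 0)"
    proof (cases "i = j")
      case True
      have "\<alpha> * (\<alpha> * \<phi>) + \<beta> * (\<beta> * \<psi>) = 2 * (\<phi> * \<psi>)" using ab by (simp add: power2_eq_square mult.assoc[symmetric])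
      then have "complex_of_real (\<alpha> * (\<alpha> * \<phi>) + \<beta> * (\<beta> * \<psi>)) = of_real (2 * (\<phi> * \<psi>))" by simp
      then show ?thesis using True by (simp add: d_def)
    qed auto
    finally show ?thesis .
  qed
  have "\<forall>\<^sub>F n in sequentially. \<forall>c. (\<exists>i<p. c i \<noteq> 0) \<longrightarrow> Re (\<Sum>i<p. \<Sum>j<p. cnj (c i) * c j * E n i j) < 0"
    by (rule eventually_form_negative[OF Elim dpos])
  with eventually_form_le[OF good_regular[OF \<omega>] s(1)] eventually_ge_at_top[of r]
  show ?thesis
  proof eventually_elim
    case (elim n)
    let ?N = "n + m n"
    note space = good_space[OF \<omega>]
    note g = res_eq[OF elim(1) s(2)]
    show ?case
    proof (rule sval_gt_if[OF Xt_carrier[OF space] p(1)])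
      show "p \<le> n" using p elim by simp
      show "0 \<le> z" using s by simp
      fix c :: "nat \<Rightarrow> complex" assume c: "\<exists>i<p. c i \<noteq> 0"
      define y where "y = (\<lambda>j. \<Sum>i<p. c i * x n i j)"
      have Wx: "ip ?N (W n l) (x n i) = \<zeta> n l i" for l i
        by (simp add: x_def \<zeta>_def Gam_def ip_def sum.distrib sum_distrib_left algebra_simps)
      have Wy: "ip ?N (W n l) y = (\<Sum>i<p. c i * \<zeta> n l i)" for l
        unfolding y_def ip_sum_right Wx ..
      have gx: "of_real z * x n i k - mv ?N (H n \<omega>) (x n i) k = of_real \<alpha> * W n i k + of_real \<beta> * W n (r + i) k"
        if "k < ?N" for i k
        unfolding g[OF that, symmetric] x_def[abs_def]
        by (simp add: mv_def sum.distrib sum_distrib_left algebra_simps)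
      have gy: "of_real z * y k - mv ?N (H n \<omega>) y k = (\<Sum>j<p. c j * (of_real \<alpha> * W n j k + of_real \<beta> * W n (r + j) k))"
        if "k < ?N" for k
        unfolding y_def mv_sum gx[OF that, symmetric] by (simp add: sum_subtractf sum_distrib_left algebra_simps)
      have "of_real (z * nsq ?N y) - ip ?N y (mv ?N (H n \<omega>) y) 
         = ip ?N y (\<lambda>k. \<Sum>j<p. c j * (of_real \<alpha> * W n j k + of_real \<beta> * W n (r + j) k))"
        using resolvent_form[OF gy] by (simp add: ip_self)
      also have "\<dots> = (\<Sum>j<p. c j * (of_real \<alpha> * cnj (ip ?N (W n j) y) + of_real \<beta> * cnj (ip ?N (W n (r + j)) y)))"
        unfolding ip_sum_right cnj_ip
        by (intro sum.cong refl arg_cong2[of _ _ _ _ "(*)"]) (simp add: ip_def sum.distrib sum_distrib_left algebra_simps)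
      also have "\<dots> = (\<Sum>j<p. \<Sum>i<p. cnj (c i) * c j * (of_real \<alpha> * cnj (\<zeta> n j i) + of_real \<beta> * cnj (\<zeta> n (r + j) i)))"
        unfolding Wy by (intro sum.cong refl) (simp add: sum_distrib_left sum.distrib[symmetric] algebra_simps)
      also have "\<dots> = (\<Sum>i<p. \<Sum>j<p. cnj (c i) * c j * (of_real \<alpha> * cnj (\<zeta> n j i) + of_real \<beta> * cnj (\<zeta> n (r + j) i)))"
        by (rule sum.swap)
      finally have 1: "of_real (z * nsq ?N y) - ip ?N y (mv ?N (H n \<omega>) y) = 
         (\<Sum>i<p. \<Sum>j<p. cnj (c i) * c j * (of_real \<alpha> * cnj (\<zeta> n j i) + of_real \<beta> * cnj (\<zeta> n (r + j) i)))" .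
      have "(\<Sum>l<r. of_real (\<theta> (Suc l)) * (cnj (ip ?N (W n (r + l)) y) * ip ?N (W n l) y))
         = (\<Sum>l<r. \<Sum>i<p. \<Sum>j<p. cnj (c i) * c j * (of_real (\<theta> (Suc l)) * (cnj (\<zeta> n (r + l) i) * \<zeta> n l j)))"
        unfolding Wy cnj_sum sum_product by (intro sum.cong refl) (simp add: sum_distrib_left mult_ac)
      also have "\<dots> = (\<Sum>i<p. \<Sum>l<r. \<Sum>j<p. cnj (c i) * c j * (of_real (\<theta> (Suc l)) * (cnj (\<zeta> n (r + l) i) * \<zeta> n l j)))"
        by (rule sum.swap)
      also have "\<dots> = (\<Sum>i<p. \<Sum>j<p. \<Sum>l<r. cnj (c i) * c j * (of_real (\<theta> (Suc l)) * (cnj (\<zeta> n (r + l) i) * \<zeta> n l j)))"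
        by (intro sum.cong refl sum.swap)
      finally have 2: "(\<Sum>l<r. of_real (\<theta> (Suc l)) * (cnj (ip ?N (W n (r + l)) y) * ip ?N (W n l) y)) = 
         (\<Sum>i<p. \<Sum>j<p. cnj (c i) * c j * (\<Sum>l<r. of_real (\<theta> (Suc l)) * (cnj (\<zeta> n (r + l) i) * \<zeta> n l j)))"
        by (simp add: sum_distrib_left)
      have 3: "(\<Sum>i<p. \<Sum>j<p. cnj (c i) * c j * E n i j) = 
        (of_real (z * nsq ?N y) - ip ?N y (mv ?N (H n \<omega>) y)) - 
        2 * (\<Sum>l<r. of_real (\<theta> (Suc l)) * (cnj (ip ?N (W n (r + l)) y) * ip ?N (W n l) y))"
      proof -
        have "(\<Sum>i<p. \<Sum>j<p. cnj (c i) * c j * (A i j - 2 * B i j)) = (\<Sum>i<p. \<Sum>j<p. cnj (c i) * c j * A i j) - 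
          2 * (\<Sum>i<p. \<Sum>j<p. cnj (c i) * c j * B i j)" for A B :: "nat \<Rightarrow> nat \<Rightarrow> complex"
          by (simp add: sum_distrib_left sum_subtractf[symmetric] algebra_simps)
        then show ?thesis unfolding 1 2 E_def .
      qed
      have "Re (\<Sum>i<p. \<Sum>j<p. cnj (c i) * c j * E n i j) < 0" using elim(3) c by blast
      then have "z * nsq ?N y < Re (ip ?N y (mv ?N (dil n (m n) (Xt n \<omega>)) y))"
        unfolding 3 form_Xt[OF space] by simp
      then show "z\<^sup>2 * nsq n (\<lambda>j. \<Sum>i<p. c i * x n i j) < nsq (m n) (adj_app n (Xt n \<omega>) (\<lambda>j. \<Sum>i<p. c i * x n i j))"
        unfolding y_def by (rule adj_app_gt_of_form[OF Xt_carrier[OF space] s(3)])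
    qed
  qed
qed

text \<open>The weight sqrt(\<phi>/\<psi>) in the arithmetic-geometric mean makes t sqrt(\<phi>
  \<psi>) the common factor of both squares.\<close>

lemma two_Re_le_weighted:
  fixes x y :: complex
  assumes pos: "0 < \<phi>" "0 < \<psi>" and t: "0 \<le> t" "t * sqrt (\<phi> * \<psi>) \<le> 1 - \<delta>"
  shows "2 * (t * Re (cnj y * x)) \<le> (1 - \<delta>) * ((cmod x)\<^sup>2 / \<phi> + (cmod y)\<^sup>2 / \<psi>)"
proof -
  define w where "w = sqrt (\<phi> * \<psi>)"
  have w: "0 < w" "w * w = \<phi> * \<psi>" using pos by (auto simp: w_def)
  have "2 * Re (cnj y * x) \<le> (w / \<psi>) * (cmod y)\<^sup>2 + (cmod x)\<^sup>2 / (w / \<psi>)"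
    using w pos by (intro two_Re_le) auto
  also have "(cmod x)\<^sup>2 / (w / \<psi>) = w * ((cmod x)\<^sup>2 / \<phi>)" using w pos by (simp add: field_simps)
  finally have "2 * Re (cnj y * x) \<le> w * ((cmod x)\<^sup>2 / \<phi> + (cmod y)\<^sup>2 / \<psi>)" by (simp add: algebra_simps)
  then have "t * (2 * Re (cnj y * x)) \<le> t * (w * ((cmod x)\<^sup>2 / \<phi> + (cmod y)\<^sup>2 / \<psi>))" using t by (intro mult_left_mono)
  also have "\<dots> = (t * w) * ((cmod x)\<^sup>2 / \<phi> + (cmod y)\<^sup>2 / \<psi>)" by simp
  also have "\<dots> \<le> (1 - \<delta>) * ((cmod x)\<^sup>2 / \<phi> + (cmod y)\<^sup>2 / \<psi>)"
    using t pos by (intro mult_right_mono) (auto simp: w_def)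
  finally show ?thesis by (simp only: mult.left_commute[of 2 t])
qed

text \<open>Bessel's inequality for the form of z I - H: removing the component q in the span of the
  resolvent columns leaves a nonnegative rest, so the form at x is at least about the sum of |<W_l,
  x>|^2 / kap_l. Subcritical spikes are absorbed with margin \<delta>. For l < p a single condition
  ties the u and v coordinates with opposite signs and makes their cross term nonpositive; one
  condition per spike instead of two is what gives the count p.\<close>

lemma eventually_sval_le_threshold:
  assumes \<omega>: "good \<omega>" and z: "b < z" and p: "p \<le> r"
    and th: "\<And>l. l < r \<Longrightarrow> 0 < \<theta> (Suc l)" "\<And>l. p \<le> l \<Longrightarrow> l < r \<Longrightarrow> (\<theta> (Suc l))\<^sup>2 * D_tr c muX z < 1"
  shows "\<forall>\<^sub>F n in sequentially. sval (Xt n \<omega>) (Suc p) \<le> z"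
proof -
  define s where "s = (b + z) / 2"
  have s: "b < s" "s < z" "0 < z" using z b_nonneg by (auto simp: s_def)
  define \<phi> where "\<phi> = kap z 0"
  define \<psi> where "\<psi> = kap z r"
  have pos: "0 < \<phi>" "0 < \<psi>" using kap_pos[OF z] by (auto simp: \<phi>_def \<psi>_def)
  have kl: "kap z l = \<phi>" "kap z (r + l) = \<psi>" if "l < r" for l using that r_pos by (auto simp: kap_def \<phi>_def \<psi>_def)
  have D: "D_tr c muX z = \<phi> * \<psi>" using D_tr_kap[of 0 z] r_pos by (simp add: \<phi>_def \<psi>_def)
  obtain \<delta> where \<delta>: "0 < \<delta>" "\<delta> \<le> 1" "\<And>l. p \<le> l \<Longrightarrow> l < r \<Longrightarrow> \<theta> (Suc l) * sqrt (\<phi> * \<psi>) \<le> 1 - \<delta>"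
  proof -
    \<comment> \<open>Including 0 keeps the maximum defined when p = r and yields \<delta> \<le>
      1.\<close>
    define T where "T = insert 0 ((\<lambda>l. \<theta> (Suc l) * sqrt (\<phi> * \<psi>)) ` {p..<r})"
    have fin: "finite T" "T \<noteq> {}" by (auto simp: T_def)
    have lt: "t < 1" if t: "t \<in> T" for t
    proof (cases "t = 0")
      case False
      then obtain l where l: "p \<le> l" "l < r" "t = \<theta> (Suc l) * sqrt (\<phi> * \<psi>)" using t by (auto simp: T_def)
      have "t\<^sup>2 < 1\<^sup>2" using th(2)[OF l(1,2)] pos by (simp add: l power_mult_distrib D)
      then show ?thesis by (rule power_less_imp_less_base) simp
    qed simp
    have "Max T < 1" using fin lt by (simp add: Max_less_iff)
    moreover have "0 \<le> Max T" using fin by (intro Max_ge) (auto simp: T_def)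
    moreover have "\<theta> (Suc l) * sqrt (\<phi> * \<psi>) \<le> Max T" if "p \<le> l" "l < r" for l
      using fin that by (intro Max_ge) (auto simp: T_def)
    ultimately show ?thesis using that[of "1 - Max T"] by simp
  qed
  define K where "K a a' = complex_of_real (if a = a' then kap z a else 0)" for a a'
  define err where "err n = (\<Sum>i<2*r. \<Sum>j<2*r. cmod (cnj (Gam z n \<omega> j i) - K i j))" for n
  \<comment> \<open>The entry error that the margin \<delta> can absorb:
    \<open>nsq (2 * r) \<eta>\<close> is at most the limiting form divided by
    \<open>min \<phi> \<psi>\<close>.\<close>
  define \<mu> where "\<mu> = \<delta> * min \<phi> \<psi>"
  have \<mu>: "0 < \<mu>" using \<delta> pos by (simp add: \<mu>_def)
  have "err \<longlonglongrightarrow> (\<Sum>i<2*r. \<Sum>j<2*r. cmod (cnj (K j i) - K i j))"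
    unfolding err_def K_def by (intro tendsto_intros Gam_limit[OF \<omega> z]) auto
  also have "(\<Sum>i<2*r. \<Sum>j<2*r. cmod (cnj (K j i) - K i j)) = 0" by (intro sum.neutral ballI) (auto simp: K_def)
  finally have "\<forall>\<^sub>F n in sequentially. err n < \<mu>" using \<mu> by (intro order_tendstoD(2)) auto
  with eventually_form_le[OF good_regular[OF \<omega>] s(1)] eventually_ge_at_top[of "Suc r"]
  show ?thesis
  proof eventually_elim
    case (elim n)
    let ?N = "n + m n"
    note space = good_space[OF \<omega>]
    note g = res_eq[OF elim(1) s(2)]
    have rn: "r \<le> n" using elim by simp
    define x where "x y = join n y (\<lambda>j. adj_app n (Xt n \<omega>) y j / of_real z)" for y
    \<comment> \<open>\<open>x y\<close> is linear in y, so the condition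
      \<open>sqrt \<psi> * a e + sqrt \<phi> * a (r + e) = 0\<close> on the coordinates
      \<open>a\<close> introduced below is a single linear functional of y.\<close>
    define f where "f e i = of_real (sqrt \<psi>) * cnj (uf n e i) + of_real (sqrt \<phi> / z) * 
      (\<Sum>j<m n. cnj (vf n (r + e) j) * cnj (Xt n \<omega> $$ (i,j)))" for e i
    have fx: "(\<Sum>i<n. f e i * y i) = of_real (sqrt \<psi>) * ip ?N (W n e) (x y) + of_real (sqrt \<phi>) * ip ?N (W n (r + e)) (x y)"
      if e: "e < r" for e y
    proof -
      have "ip ?N (W n (r + e)) (x y) = (\<Sum>j<m n. \<Sum>i<n. cnj (vf n (r + e) j) * cnj (Xt n \<omega> $$ (i,j)) * y i / of_real z)"
        unfolding ip_W_right by (simp add: x_def join_def adj_app_def sum_divide_distrib sum_distrib_left mult_ac)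
      also have "\<dots> = (\<Sum>i<n. \<Sum>j<m n. cnj (vf n (r + e) j) * cnj (Xt n \<omega> $$ (i,j)) * y i / of_real z)" by (rule sum.swap)
      finally have 1: "ip ?N (W n (r + e)) (x y) = (\<Sum>i<n. (\<Sum>j<m n. cnj (vf n (r + e) j) * cnj (Xt n \<omega> $$ (i,j))) * y i / of_real z)"
        by (simp add: sum_distrib_right sum_divide_distrib)
      have 2: "ip ?N (W n e) (x y) = (\<Sum>i<n. cnj (uf n e i) * y i)"
        unfolding ip_W_left[OF e] by (simp add: x_def join_def)
      show ?thesis unfolding 1 2 f_def
        by (simp add: sum_distrib_left sum.distrib[symmetric] sum_divide_distrib algebra_simps)
    qed
    show ?case
    proof (rule sval_le_if[OF Xt_carrier[OF space], where f = f])
      show "p < n" using p elim by simp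
      show "0 \<le> z" using s by simp
      fix y :: "nat \<Rightarrow> complex" assume y: "\<And>e. e < p \<Longrightarrow> (\<Sum>i<n. f e i * y i) = 0"
      define a where "a l = ip ?N (W n l) (x y)" for l
      \<comment> \<open>The resolvent columns have the compressed resolvent as Gram matrix in the
        form of z I - H. Its limit is diagonal with entries \<open>kap\<close>, so these
        coefficients give the projection up to an error controlled by \<open>err\<close>.\<close>
      define \<eta> where "\<eta> l = a l / of_real (kap z l)" for l
      define q where "q = (\<lambda>j. \<Sum>l<2*r. \<eta> l * res z n \<omega> l j)"
      have kp: "0 < kap z l" for l by (rule kap_pos[OF z])
      have gq: "of_real z * q k - mv ?N (H n \<omega>) q k = (\<Sum>l<2*r. \<eta> l * W n l k)" if "k < ?N" for k
        unfolding q_def mv_sum g[OF that, symmetric] by (simp add: sum_subtractf sum_distrib_left algebra_simps)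
      let ?F = "\<lambda>x y. of_real z * ip ?N x y - ip ?N x (mv ?N (H n \<omega>) y)"
      have Fxq: "?F x' q = (\<Sum>l<2*r. \<eta> l * cnj (ip ?N (W n l) x'))" for x'
        using resolvent_form[OF gq, of x'] by (simp add: ip_sum_right cnj_ip)
      have Fqx: "?F q x' = cnj (?F x' q)" for x'
      proof -
        have "ip ?N q (mv ?N (H n \<omega>) x') = cnj (ip ?N x' (mv ?N (H n \<omega>) q))"
          unfolding cnj_ip by (subst ip_mv_adj[OF H_carrier]) (simp add: H_adj[OF space])
        then show ?thesis using cnj_ip[of ?N x' q] by simp
      qed
      have Fge: "0 \<le> Re (?F w w)" for w
      proof -
        have "Re (ip ?N w (mv ?N (H n \<omega>) w)) \<le> s * nsq ?N w" using elim(1) by blast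
        also have "\<dots> \<le> z * nsq ?N w" using s by (intro mult_right_mono) auto
        finally show ?thesis by (simp add: ip_self)
      qed
      have exp: "?F (\<lambda>i. x y i - q i) (\<lambda>i. x y i - q i) = ?F (x y) (x y) - ?F (x y) q - ?F q (x y) + ?F q q"
        by (simp add: mv_diff ip_diff algebra_simps)
      have "0 \<le> Re (?F (x y) (x y)) - 2 * Re (?F (x y) q) + Re (?F q q)"
        using Fge[of "\<lambda>i. x y i - q i"] unfolding exp Fqx[of "x y"] by simp
      moreover have "Re (?F (x y) q) = (\<Sum>l<2*r. (cmod (a l))\<^sup>2 / kap z l)"
      proof -
        have "?F (x y) q = (\<Sum>l<2*r. of_real ((cmod (a l))\<^sup>2 / kap z l))"
          unfolding Fxq by (intro sum.cong refl) (simp add: \<eta>_def a_def[symmetric] complex_norm_square del: of_real_power)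
        then show ?thesis by (simp del: of_real_divide)
      qed
      moreover have "Re (?F q q) \<le> (\<Sum>l<2*r. (cmod (a l))\<^sup>2 / kap z l) + err n * nsq (2 * r) \<eta>"
      proof -
        have "ip ?N (W n l) q = (\<Sum>j<2*r. \<eta> j * Gam z n \<omega> l j)" for l
          unfolding q_def ip_sum_right Gam_def ..
        then have "?F q q = (\<Sum>l<2*r. \<Sum>j<2*r. cnj (\<eta> j) * \<eta> l * cnj (Gam z n \<omega> l j))"
          unfolding Fxq by (simp add: sum_distrib_left mult_ac)
        also have "\<dots> = (\<Sum>j<2*r. \<Sum>l<2*r. cnj (\<eta> j) * \<eta> l * cnj (Gam z n \<omega> l j))" by (rule sum.swap)
        also have "\<dots> = (\<Sum>j<2*r. \<Sum>l<2*r. cnj (\<eta> j) * \<eta> l * K j l) + 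
            (\<Sum>j<2*r. \<Sum>l<2*r. cnj (\<eta> j) * \<eta> l * (cnj (Gam z n \<omega> l j) - K j l))"
          by (simp add: sum.distrib[symmetric] algebra_simps)
        finally have Fqq: "?F q q = (\<Sum>j<2*r. \<Sum>l<2*r. cnj (\<eta> j) * \<eta> l * K j l) + 
            (\<Sum>j<2*r. \<Sum>l<2*r. cnj (\<eta> j) * \<eta> l * (cnj (Gam z n \<omega> l j) - K j l))" .
        have "(\<Sum>j<2*r. \<Sum>l<2*r. cnj (\<eta> j) * \<eta> l * K j l) = (\<Sum>j<2*r. of_real ((cmod (a j))\<^sup>2 / kap z j))"
        proof (intro sum.cong refl)
          fix j assume j: "j \<in> {..<2*r}"
          have "(\<Sum>l<2*r. cnj (\<eta> j) * \<eta> l * K j l) = (\<Sum>l<2*r. if j = l then cnj (\<eta> j) * \<eta> j * of_real (kap z j) else 0)"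
            by (intro sum.cong refl) (simp add: K_def)
          also have "\<dots> = cnj (\<eta> j) * \<eta> j * of_real (kap z j)" using j by simp
          also have "\<dots> = of_real ((cmod (a j))\<^sup>2 / kap z j)"
            using kp[of j] complex_norm_square[of "a j"] by (simp add: \<eta>_def field_simps)
          finally show "(\<Sum>l<2*r. cnj (\<eta> j) * \<eta> l * K j l) = of_real ((cmod (a j))\<^sup>2 / kap z j)" .
        qed
        then have "Re (\<Sum>j<2*r. \<Sum>l<2*r. cnj (\<eta> j) * \<eta> l * K j l) = (\<Sum>j<2*r. (cmod (a j))\<^sup>2 / kap z j)"
          by (simp del: of_real_divide)
        moreover have "Re (\<Sum>j<2*r. \<Sum>l<2*r. cnj (\<eta> j) * \<eta> l * (cnj (Gam z n \<omega> l j) - K j l)) \<le> err n * nsq (2 * r) \<eta>"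
          unfolding err_def by (rule order_trans[OF complex_Re_le_cmod form_bound])
        ultimately show ?thesis unfolding Fqq by simp
      qed
      ultimately have lower: "(\<Sum>l<2*r. (cmod (a l))\<^sup>2 / kap z l) - err n * nsq (2 * r) \<eta> \<le> Re (?F (x y) (x y))" by linarith
      have split: "(\<Sum>l<2*r. h l) = (\<Sum>l<r. h l) + (\<Sum>l<r. h (r + l))" for h :: "nat \<Rightarrow> real"
        using sum_join[of h r r] by (simp add: mult_2)
      define A where "A l = (cmod (a l))\<^sup>2 / \<phi> + (cmod (a (r + l)))\<^sup>2 / \<psi>" for l
      have A0: "0 \<le> A l" for l using pos by (simp add: A_def)
      have sumA: "(\<Sum>l<2*r. (cmod (a l))\<^sup>2 / kap z l) = (\<Sum>l<r. A l)"
        unfolding split A_def by (simp add: kl sum.distrib[symmetric])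
      have cross: "2 * (\<theta> (Suc l) * Re (cnj (a (r + l)) * a l)) \<le> (1 - \<delta>) * A l" if l: "l < r" for l
      proof (cases "l < p")
        case True
        then have "of_real (sqrt \<psi>) * a l + of_real (sqrt \<phi>) * a (r + l) = 0"
          using fx[OF l, of y] y[OF True] by (simp add: a_def)
        then have "a l = - of_real (sqrt \<phi> / sqrt \<psi>) * a (r + l)"
          using pos by (simp add: field_simps eq_neg_iff_add_eq_0)
        then have "cnj (a (r + l)) * a l = - of_real (sqrt \<phi> / sqrt \<psi>) * (a (r + l) * cnj (a (r + l)))" by simp
        also have "\<dots> = of_real (- (sqrt \<phi> / sqrt \<psi>) * (cmod (a (r + l)))\<^sup>2)"
          unfolding complex_norm_square[symmetric] by simp
        finally have "Re (cnj (a (r + l)) * a l) = - (sqrt \<phi> / sqrt \<psi>) * (cmod (a (r + l)))\<^sup>2" by (simp del: of_real_mult)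
        moreover have "0 \<le> (sqrt \<phi> / sqrt \<psi>) * (cmod (a (r + l)))\<^sup>2" using pos by simp
        ultimately have "\<theta> (Suc l) * Re (cnj (a (r + l)) * a l) \<le> 0"
          using th(1)[OF l] by (intro mult_nonneg_nonpos) auto
        moreover have "0 \<le> (1 - \<delta>) * A l" using \<delta> A0 by simp
        ultimately show ?thesis using \<open>0 \<le> (1 - \<delta>) * A l\<close> by linarith
      next
        case False
        show ?thesis unfolding A_def
          by (rule two_Re_le_weighted[OF pos]) (use th(1)[OF l] \<delta>(3)[of l] False l in auto)
      qed
      have \<eta>A: "nsq (2 * r) \<eta> \<le> (\<Sum>l<r. A l) / min \<phi> \<psi>"
      proof -
        have "nsq (2 * r) \<eta> = (\<Sum>l<2*r. (cmod (a l))\<^sup>2 / kap z l / kap z l)"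
          unfolding nsq_def \<eta>_def using kp by (simp add: norm_divide power_divide power2_eq_square less_imp_le)
        also have "\<dots> \<le> (\<Sum>l<2*r. (cmod (a l))\<^sup>2 / kap z l / min \<phi> \<psi>)"
        proof (rule sum_mono)
          fix l
          have "min \<phi> \<psi> \<le> kap z l" using kl[of 0] r_pos by (auto simp: kap_def \<phi>_def \<psi>_def)
          then show "(cmod (a l))\<^sup>2 / kap z l / kap z l \<le> (cmod (a l))\<^sup>2 / kap z l / min \<phi> \<psi>"
            using kp[of l] pos by (intro divide_left_mono) auto
        qed
        also have "\<dots> = (\<Sum>l<r. A l) / min \<phi> \<psi>" unfolding sumA[symmetric] sum_divide_distrib ..
        finally show ?thesis .
      qed
      have "err n * nsq (2 * r) \<eta> \<le> \<mu> * ((\<Sum>l<r. A l) / min \<phi> \<psi>)"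
        using elim(3) \<eta>A \<mu> by (intro mult_mono) auto
      also have "\<dots> = \<delta> * (\<Sum>l<r. A l)" using pos by (simp add: \<mu>_def)
      finally have e: "err n * nsq (2 * r) \<eta> \<le> \<delta> * (\<Sum>l<r. A l)" .
      have "2 * Re (\<Sum>l<r. of_real (\<theta> (Suc l)) * (cnj (a (r + l)) * a l)) = 
          (\<Sum>l<r. 2 * (\<theta> (Suc l) * Re (cnj (a (r + l)) * a l)))"
        by (simp add: sum_distrib_left)
      also have "\<dots> \<le> (\<Sum>l<r. (1 - \<delta>) * A l)" using cross by (intro sum_mono) auto
      also have "\<dots> = (\<Sum>l<r. A l) - \<delta> * (\<Sum>l<r. A l)" by (simp add: sum_distrib_left left_diff_distrib sum_subtractf)
      also have "\<dots> \<le> Re (?F (x y) (x y))" using lower e unfolding sumA by linarith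
      finally have "Re (ip ?N (x y) (mv ?N (dil n (m n) (Xt n \<omega>)) (x y))) \<le> z * nsq ?N (x y)"
        unfolding form_Xt[OF space] a_def by (simp add: ip_self)
      then show "nsq (m n) (adj_app n (Xt n \<omega>) y) \<le> z\<^sup>2 * nsq n y"
        by (rule adj_app_le_of_form[OF Xt_carrier[OF space] s(3) x_def])
    qed
  qed
qed

end

section \<open>The D-transform\<close>

text \<open>\<open>phi_tr\<close> is z times the mean of this kernel, its derivative involves the
  squared kernel, and the traces in \<open>Dhat\<close> and \<open>Dhat'\<close> are sums of the
  same two functions.\<close>

definition cauchy_ker :: "real \<Rightarrow> real \<Rightarrow> real" where
  "cauchy_ker z t = 1 / (z\<^sup>2 - t\<^sup>2)"

lemma cauchy_ker_bounds:
  assumes "0 \<le> t" "t \<le> B" "B < B'" "B' \<le> z"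
  shows "0 < cauchy_ker z t" "cauchy_ker z t \<le> 1 / (B'\<^sup>2 - B\<^sup>2)"
proof -
  have "t\<^sup>2 \<le> B\<^sup>2" "B\<^sup>2 < B'\<^sup>2" "B'\<^sup>2 \<le> z\<^sup>2" using assms by (auto intro: power_mono power_strict_mono)
  then have "0 < B'\<^sup>2 - B\<^sup>2" "B'\<^sup>2 - B\<^sup>2 \<le> z\<^sup>2 - t\<^sup>2" by auto
  then show "0 < cauchy_ker z t" "cauchy_ker z t \<le> 1 / (B'\<^sup>2 - B\<^sup>2)" by (auto simp: cauchy_ker_def frac_le)
qed

lemma cauchy_ker_diff:
  assumes "0 \<le> t" "t < w" "t < z"
  shows "cauchy_ker w t - cauchy_ker z t = (z\<^sup>2 - w\<^sup>2) * (cauchy_ker w t * cauchy_ker z t)"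
proof -
  have "t\<^sup>2 < w\<^sup>2" "t\<^sup>2 < z\<^sup>2" using assms by (auto intro: power_strict_mono)
  then have "w\<^sup>2 - t\<^sup>2 \<noteq> 0" "z\<^sup>2 - t\<^sup>2 \<noteq> 0" by auto
  then show ?thesis by (simp add: cauchy_ker_def diff_frac_eq)
qed

text \<open>Uniformity in t serves twice: for the derivative of \<open>J 1\<close> and for replacing
  a moving evaluation point by its limit.\<close>

lemma cauchy_ker_lipschitz:
  assumes t: "0 \<le> t" "t \<le> B" and B: "B < B'" "B' \<le> w" "B' \<le> z"
  shows "\<bar>cauchy_ker w t - cauchy_ker z t\<bar> \<le> \<bar>z\<^sup>2 - w\<^sup>2\<bar> / (B'\<^sup>2 - B\<^sup>2)\<^sup>2"
    "\<bar>(cauchy_ker w t)\<^sup>2 - (cauchy_ker z t)\<^sup>2\<bar> \<le> 2 * \<bar>z\<^sup>2 - w\<^sup>2\<bar> / (B'\<^sup>2 - B\<^sup>2) ^ 3"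
proof -
  define k where "k = B'\<^sup>2 - B\<^sup>2"
  have k: "0 < k" using t B by (auto simp: k_def power_strict_mono)
  note bw = cauchy_ker_bounds[OF t B(1,2), folded k_def] and bz = cauchy_ker_bounds[OF t B(1,3), folded k_def]
  have "cauchy_ker w t * cauchy_ker z t \<le> 1 / k * (1 / k)" using bw bz k by (intro mult_mono) auto
  then have "\<bar>z\<^sup>2 - w\<^sup>2\<bar> * (cauchy_ker w t * cauchy_ker z t) \<le> \<bar>z\<^sup>2 - w\<^sup>2\<bar> * (1 / k * (1 / k))"
    by (rule mult_left_mono) simp
  moreover have "\<bar>cauchy_ker w t - cauchy_ker z t\<bar> = \<bar>z\<^sup>2 - w\<^sup>2\<bar> * (cauchy_ker w t * cauchy_ker z t)"
    using cauchy_ker_diff[of t w z] t B bw bz by (simp add: abs_mult)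
  ultimately have 1: "\<bar>cauchy_ker w t - cauchy_ker z t\<bar> \<le> \<bar>z\<^sup>2 - w\<^sup>2\<bar> / k\<^sup>2" by (simp add: power2_eq_square)
  then show "\<bar>cauchy_ker w t - cauchy_ker z t\<bar> \<le> \<bar>z\<^sup>2 - w\<^sup>2\<bar> / (B'\<^sup>2 - B\<^sup>2)\<^sup>2" by (simp add: k_def)
  have "\<bar>(cauchy_ker w t)\<^sup>2 - (cauchy_ker z t)\<^sup>2\<bar> = \<bar>cauchy_ker w t - cauchy_ker z t\<bar> * (cauchy_ker w t + cauchy_ker z t)"
    using bw bz by (simp add: power2_eq_square square_diff_square_factored abs_mult)
  also have "\<dots> \<le> \<bar>z\<^sup>2 - w\<^sup>2\<bar> / k\<^sup>2 * (1 / k + 1 / k)"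
    using 1 bw bz k by (intro mult_mono) auto
  also have "\<dots> = 2 * \<bar>z\<^sup>2 - w\<^sup>2\<bar> / k ^ 3" by (simp add: power2_eq_square power3_eq_cube)
  finally show "\<bar>(cauchy_ker w t)\<^sup>2 - (cauchy_ker z t)\<^sup>2\<bar> \<le> 2 * \<bar>z\<^sup>2 - w\<^sup>2\<bar> / (B'\<^sup>2 - B\<^sup>2) ^ 3" by (simp add: k_def)
qed

lemma cauchy_ker_measurable [measurable]: "cauchy_ker z \<in> borel_measurable borel"
  unfolding cauchy_ker_def by measurable

lemma cauchy_ker_mono: "0 \<le> s \<Longrightarrow> s \<le> t \<Longrightarrow> t < z \<Longrightarrow> cauchy_ker z s \<le> cauchy_ker z t"
  unfolding cauchy_ker_def by (intro divide_left_mono mult_pos_pos) (auto simp: power_strict_mono power_mono)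

lemma continuous_on_cauchy_ker: "B < z \<Longrightarrow> continuous_on {0..B} (cauchy_ker z)"
proof -
  assume B: "B < z"
  have "z\<^sup>2 - t\<^sup>2 \<noteq> 0" if "t \<in> {0..B}" for t
    using that B power_strict_mono[of t z 2] by auto
  then show ?thesis unfolding cauchy_ker_def by (intro continuous_intros) auto
qed

section \<open>Derivative, monotonicity and inverse of D\<close>

context invariant_noise
begin

definition J :: "nat \<Rightarrow> real \<Rightarrow> real" where
  "J p z = (\<integral>t. (cauchy_ker z t) ^ p \<partial>muX)"

lemma integrable_cauchy_ker: "b < z \<Longrightarrow> integrable muX (\<lambda>t. (cauchy_ker z t) ^ p)"
proof -
  assume z: "b < z"
  show ?thesis
  proof (rule integrable_of_bound)
    fix t :: real assume t: "0 \<le> t" "t \<le> b"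
    show "\<bar>cauchy_ker z t ^ p\<bar> \<le> (1 / (z\<^sup>2 - b\<^sup>2)) ^ p"
      unfolding power_abs using cauchy_ker_bounds[OF t z order_refl]
      by (intro power_mono) auto
  qed measurable
qed

lemma phi_tr_J: "phi_tr muX z = z * J 1 z"
  unfolding phi_tr_def J_def cauchy_ker_def by (simp flip: integral_mult_right_zero)

text \<open>\<open>cauchy_ker_diff\<close> turns the difference quotient into -(w + z) times the
  mean of a product of kernels, and the uniform Lipschitz bound gives its limit as w tends to
  z.\<close>

lemma J1_deriv:
  assumes z: "b < z"
  shows "(J 1 has_real_derivative (- 2 * z * J 2 z)) (at z)"
proof -
  interpret mu: prob_space muX by (rule muX_prob)
  define s where "s = (b + z) / 2"
  have s: "b < s" "s < z" using z by (auto simp: s_def)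
  define k where "k = s\<^sup>2 - b\<^sup>2"
  have k: "0 < k" using s b_nonneg by (auto simp: k_def power_strict_mono)
  define G where "G w = (\<integral>t. cauchy_ker w t * cauchy_ker z t \<partial>muX)" for w
  have int: "integrable muX (\<lambda>t. cauchy_ker w t * cauchy_ker z t)" if "s < w" for w
  proof (rule integrable_of_bound)
    fix t :: real assume t: "0 \<le> t" "t \<le> b"
    show "\<bar>cauchy_ker w t * cauchy_ker z t\<bar> \<le> 1 / k * (1 / k)"
      unfolding abs_mult using cauchy_ker_bounds[OF t s(1), of w] cauchy_ker_bounds[OF t s(1), of z] that s k
      by (intro mult_mono) (auto simp: k_def)
  qed measurable
  have near: "\<forall>\<^sub>F w in at z. s < w" using s by (intro order_tendstoD(1)[OF tendsto_ident_at]) auto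
  have quot: "(J 1 w - J 1 z) / (w - z) = - (w + z) * G w" if w: "s < w" "w \<noteq> z" for w
  proof -
    have "J 1 w - J 1 z = (\<integral>t. cauchy_ker w t - cauchy_ker z t \<partial>muX)"
      unfolding J_def using integrable_cauchy_ker[of w 1] integrable_cauchy_ker[of z 1] w s by simp
    also have "\<dots> = (\<integral>t. (z\<^sup>2 - w\<^sup>2) * (cauchy_ker w t * cauchy_ker z t) \<partial>muX)"
    proof (rule integral_cong_AE)
      show "AE t in muX. cauchy_ker w t - cauchy_ker z t = (z\<^sup>2 - w\<^sup>2) * (cauchy_ker w t * cauchy_ker z t)"
        using AE_muX by eventually_elim (rule cauchy_ker_diff, use w s in auto)
    qed (simp_all add: muX_measurable)
    also have "\<dots> = (z\<^sup>2 - w\<^sup>2) * G w" unfolding G_def by (rule integral_mult_right_zero)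
    also have "\<dots> = (w - z) * (- (w + z) * G w)" by (simp add: power2_eq_square algebra_simps)
    finally show ?thesis using w by simp
  qed
  have G: "(G \<longlongrightarrow> J 2 z) (at z)"
  proof (rule Lim_null[THEN iffD2], rule Lim_null_comparison)
    show "\<forall>\<^sub>F w in at z. norm (G w - J 2 z) \<le> \<bar>z\<^sup>2 - w\<^sup>2\<bar> / k\<^sup>2 * (1 / k)"
      using near
    proof eventually_elim
      case (elim w)
      have "G w - J 2 z = (\<integral>t. (cauchy_ker w t - cauchy_ker z t) * cauchy_ker z t \<partial>muX)"
        unfolding G_def J_def using int[OF elim] int[of z] s
        by (simp add: power2_eq_square left_diff_distrib flip: Bochner_Integration.integral_diff)
      also have "norm \<dots> \<le> (\<integral>t. norm ((cauchy_ker w t - cauchy_ker z t) * cauchy_ker z t) \<partial>muX)"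
        by (rule integral_norm_bound)
      also have "\<dots> \<le> \<bar>z\<^sup>2 - w\<^sup>2\<bar> / k\<^sup>2 * (1 / k)"
      proof (rule integral_le_bound(2))
        fix t :: real assume t: "0 \<le> t" "t \<le> b"
        show "0 \<le> norm ((cauchy_ker w t - cauchy_ker z t) * cauchy_ker z t) \<and> 
            norm ((cauchy_ker w t - cauchy_ker z t) * cauchy_ker z t) \<le> \<bar>z\<^sup>2 - w\<^sup>2\<bar> / k\<^sup>2 * (1 / k)"
          unfolding norm_mult using cauchy_ker_lipschitz(1)[OF t s(1), of w z] cauchy_ker_bounds[OF t s(1), of z] elim s k
          by (intro conjI mult_mono) (auto simp: k_def)
      qed measurable
      finally show ?case .
    qed
    have "((\<lambda>w. \<bar>z\<^sup>2 - w\<^sup>2\<bar> / k\<^sup>2 * (1 / k)) \<longlongrightarrow> \<bar>z\<^sup>2 - z\<^sup>2\<bar> / k\<^sup>2 * (1 / k)) (at z)"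
      using k by (intro tendsto_intros) auto
    then show "((\<lambda>w. \<bar>z\<^sup>2 - w\<^sup>2\<bar> / k\<^sup>2 * (1 / k)) \<longlongrightarrow> 0) (at z)" by simp
  qed
  have "((\<lambda>w. - (w + z) * G w) \<longlongrightarrow> - (z + z) * J 2 z) (at z)"
    by (intro tendsto_intros G)
  then have "((\<lambda>w. - (w + z) * G w) \<longlongrightarrow> - 2 * z * J 2 z) (at z)" by simp
  then have "((\<lambda>w. (J 1 w - J 1 z) / (w - z)) \<longlongrightarrow> - 2 * z * J 2 z) (at z)"
  proof (rule Lim_transform_eventually)
    show "\<forall>\<^sub>F w in at z. - (w + z) * G w = (J 1 w - J 1 z) / (w - z)"
      using near eventually_neq_at_within[of z] by eventually_elim (rule quot[symmetric])
  qed
  then show ?thesis by (simp add: has_field_derivative_iff)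
qed

text \<open>\<open>dphi\<close> and \<open>dD\<close> are the derivatives of \<open>phi_tr\<close>
  and \<open>D_tr\<close>, in the product form in which the limit of \<open>Dhat'\<close>
  arises.\<close>

definition dphi :: "real \<Rightarrow> real" where
  "dphi z = J 1 z - 2 * z\<^sup>2 * J 2 z"

definition dD :: "real \<Rightarrow> real" where
  "dD z = dphi z * (c * phi_tr muX z + (1 - c) / z) + phi_tr muX z * (c * dphi z - (1 - c) / z\<^sup>2)"

lemma D_deriv:
  assumes z: "b < z"
  shows "(D_tr c muX has_real_derivative dD z) (at z)"
proof -
  have z0: "0 < z" using z b_nonneg by simp
  have "((\<lambda>z. z * J 1 z) has_real_derivative dphi z) (at z)"
    by (rule derivative_eq_intros J1_deriv[OF z] refl)+ (simp add: dphi_def power2_eq_square algebra_simps)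
  then have p: "(phi_tr muX has_real_derivative dphi z) (at z)" by (simp add: phi_tr_J[abs_def])
  have "((\<lambda>z. (1 - c) * inverse z) has_real_derivative (1 - c) * (- (inverse z ^ Suc (Suc 0)))) (at z)"
    by (rule DERIV_cmult[OF DERIV_inverse]) (use z0 in simp)
  then have "((\<lambda>z. (1 - c) / z) has_real_derivative - ((1 - c) / z\<^sup>2)) (at z)"
    by (simp add: divide_inverse power2_eq_square)
  from DERIV_add[OF DERIV_cmult[OF p, of c] this]
  have q: "((\<lambda>z. c * phi_tr muX z + (1 - c) / z) has_real_derivative c * dphi z - (1 - c) / z\<^sup>2) (at z)" by simp
  have "dD z = dphi z * (c * phi_tr muX z + (1 - c) / z) + (c * dphi z - (1 - c) / z\<^sup>2) * phi_tr muX z"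
    by (simp only: dD_def mult.commute[of "phi_tr muX z"])
  then show ?thesis unfolding D_tr_def[abs_def] using DERIV_mult[OF p q] by simp
qed

text \<open>A kernel value k satisfies z^2 k \<ge> 1, hence k - 2 z^2 k^2 \<le> -k \<le> -1/z^2
  pointwise.\<close>

lemma dphi_neg:
  assumes z: "b < z"
  shows "dphi z < 0"
proof -
  interpret mu: prob_space muX by (rule muX_prob)
  have z0: "0 < z" using z b_nonneg by simp
  have i: "integrable muX (\<lambda>t. cauchy_ker z t)" "integrable muX (\<lambda>t. (cauchy_ker z t)\<^sup>2)"
    using integrable_cauchy_ker[OF z, of 1] integrable_cauchy_ker[OF z, of 2] by auto
  have pt: "cauchy_ker z t - 2 * z\<^sup>2 * (cauchy_ker z t)\<^sup>2 \<le> - 1 / z\<^sup>2" if t: "0 \<le> t" "t \<le> b" for t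
  proof -
    define h where "h = cauchy_ker z t"
    have lt: "t\<^sup>2 < z\<^sup>2" using t z by (intro power_strict_mono) auto
    have h: "0 < h" "1 \<le> z\<^sup>2 * h" using lt by (auto simp: h_def cauchy_ker_def)
    have "h * 1 \<le> h * (z\<^sup>2 * h)" using h by (intro mult_left_mono) auto
    moreover have "1 / z\<^sup>2 \<le> h" using h(2) z0 by (simp add: divide_le_eq mult.commute)
    ultimately have "h - 2 * z\<^sup>2 * h\<^sup>2 \<le> - h" "1 / z\<^sup>2 \<le> h" by (simp_all add: power2_eq_square algebra_simps)
    then show ?thesis by (simp add: h_def)
  qed
  have "dphi z = (\<integral>t. cauchy_ker z t - 2 * z\<^sup>2 * (cauchy_ker z t)\<^sup>2 \<partial>muX)"
    unfolding dphi_def J_def using i by simp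
  also have "\<dots> \<le> (\<integral>t. - 1 / z\<^sup>2 \<partial>muX)"
  proof (rule integral_mono_AE)
    show "AE t in muX. cauchy_ker z t - 2 * z\<^sup>2 * (cauchy_ker z t)\<^sup>2 \<le> - 1 / z\<^sup>2"
      using AE_muX by eventually_elim (use pt in auto)
  qed (use i in auto)
  also have "\<dots> = - 1 / z\<^sup>2" by (simp add: mu.prob_space)
  also have "\<dots> < 0" using z0 by simp
  finally show ?thesis .
qed

text \<open>Strictness comes from the first summand, whose companion factor is positive even for c =
  0 or c = 1. The sign also shows that the limiting weight has a nonzero denominator.\<close>

lemma dD_neg:
  assumes z: "b < z"
  shows "dD z < 0"
proof -
  have "dphi z * (c * phi_tr muX z + (1 - c) / z) < 0"
    by (intro mult_neg_pos dphi_neg z phi_tr_companion_pos)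
  moreover have "phi_tr muX z * (c * dphi z - (1 - c) / z\<^sup>2) \<le> 0"
  proof (rule mult_nonneg_nonpos)
    have "c * dphi z \<le> 0" using c_nonneg dphi_neg[OF z] by (intro mult_nonneg_nonpos) auto
    moreover have "0 \<le> (1 - c) / z\<^sup>2" using c_le_1 by simp
    ultimately show "c * dphi z - (1 - c) / z\<^sup>2 \<le> 0" by linarith
  qed (use phi_tr_pos[OF z] in simp)
  ultimately show ?thesis by (simp add: dD_def)
qed

lemma D_strict_decreasing:
  assumes "b < y" "y < z"
  shows "D_tr c muX z < D_tr c muX y"
proof (rule DERIV_neg_imp_decreasing[OF assms(2)])
  fix x assume "y \<le> x" "x \<le> z"
  then have "b < x" using assms by simp
  then show "\<exists>d. (D_tr c muX has_real_derivative d) (at x) \<and> d < 0"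
    by (intro exI[of _ "dD x"] conjI D_deriv dD_neg)
qed

lemma D_pos: "b < z \<Longrightarrow> 0 < D_tr c muX z"
  unfolding D_tr_def by (intro mult_pos_pos phi_tr_pos phi_tr_companion_pos)

lemma inj_on_D: "inj_on (D_tr c muX) {b<..}"
proof (rule inj_onI)
  fix x y assume "x \<in> {b<..}" "y \<in> {b<..}" "D_tr c muX x = D_tr c muX y"
  then show "x = y" using D_strict_decreasing[of x y] D_strict_decreasing[of y x] by (cases x y rule: linorder_cases) auto
qed

text \<open>Both factors are at most z / (z^2 - b^2), the second because it mixes
  \<open>phi_tr\<close> and 1/z, which obey the same bound.\<close>

lemma D_tendsto_0: "((\<lambda>z. D_tr c muX z) \<longlongrightarrow> 0) at_top"
proof (rule tendsto_sandwich)
  have ev: "\<forall>\<^sub>F z in at_top. b + 1 < z" by (rule eventually_gt_at_top)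
  show "\<forall>\<^sub>F z in at_top. 0 \<le> D_tr c muX z" using ev by eventually_elim (use D_pos in \<open>simp add: less_imp_le\<close>)
  show "((\<lambda>_. 0 :: real) \<longlongrightarrow> 0) at_top" by simp
  show "((\<lambda>z. (z / (z\<^sup>2 - b\<^sup>2))\<^sup>2) \<longlongrightarrow> 0) at_top" by real_asymp
  show "\<forall>\<^sub>F z in at_top. D_tr c muX z \<le> (z / (z\<^sup>2 - b\<^sup>2))\<^sup>2"
    using ev
  proof eventually_elim
    case (elim z)
    then have z: "b < z" "0 < z" using b_nonneg by auto
    have "J 1 z \<le> 1 / (z\<^sup>2 - b\<^sup>2)"
      unfolding J_def using cauchy_ker_bounds[of _ b z z] z
      by (intro integral_le_bound(2)) (auto simp: less_imp_le)
    then have 1: "phi_tr muX z \<le> z / (z\<^sup>2 - b\<^sup>2)" using z mult_left_mono[of "J 1 z" "1 / (z\<^sup>2 - b\<^sup>2)" z] by (simp add: phi_tr_J)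
    have "1 / z \<le> z / (z\<^sup>2 - b\<^sup>2)" using phi_tr_ge[OF z(1)] 1 by linarith
    then have "c * phi_tr muX z + (1 - c) * (1 / z) \<le> c * (z / (z\<^sup>2 - b\<^sup>2)) + (1 - c) * (z / (z\<^sup>2 - b\<^sup>2))"
      using 1 c_nonneg c_le_1 by (intro add_mono mult_left_mono) auto
    also have "\<dots> = z / (z\<^sup>2 - b\<^sup>2)" unfolding distrib_right[symmetric] by simp
    finally have 2: "c * phi_tr muX z + (1 - c) / z \<le> z / (z\<^sup>2 - b\<^sup>2)" by simp
    show ?case unfolding D_tr_def power2_eq_square[of "z / (z\<^sup>2 - b\<^sup>2)"]
      using 1 2 phi_tr_pos[OF z(1)] phi_tr_companion_pos[OF z(1)] by (intro mult_mono) auto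
  qed
qed

lemma D_inverse_exists:
  assumes "b < z" "d < D_tr c muX z" "0 < d"
  shows "\<exists>\<rho>>b. D_tr c muX \<rho> = d"
proof -
  have "\<forall>\<^sub>F y in at_top. D_tr c muX y < d \<and> z < y"
    using order_tendstoD(2)[OF D_tendsto_0 assms(3)] eventually_gt_at_top[of z] by (rule eventually_conj)
  then obtain y where y: "D_tr c muX y < d" "z < y" by (auto simp: eventually_at_top_linorder)
  have "\<exists>x\<ge>z. x \<le> y \<and> D_tr c muX x = d"
  proof (rule IVT2)
    show "\<forall>x. z \<le> x \<and> x \<le> y \<longrightarrow> isCont (D_tr c muX) x"
    proof (intro allI impI)
      fix x assume "z \<le> x \<and> x \<le> y"
      then have "b < x" using assms(1) by simp
      then show "isCont (D_tr c muX) x" by (rule DERIV_isCont[OF D_deriv])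
    qed
  qed (use y assms in auto)
  then obtain x where "z \<le> x" "D_tr c muX x = d" by blast
  then show ?thesis using assms(1) by (intro exI[of _ x]) auto
qed

lemma the_inv_D: "b < \<rho> \<Longrightarrow> D_tr c muX \<rho> = d \<Longrightarrow> the_inv_into {b<..} (D_tr c muX) d = \<rho>"
  using the_inv_into_f_f[OF inj_on_D, of \<rho>] by auto

text \<open>D decreases, so its right limit at b is a supremum, which in the extended reals covers
  the infinite case.\<close>

lemma D_bplus_eq: "D_bplus c muX b = (SUP z\<in>{b<..}. ereal (D_tr c muX z))" (is "_ = ?L")
proof -
  have "((\<lambda>z. ereal (D_tr c muX z)) \<longlongrightarrow> ?L) (at_right b)"
  proof (rule order_tendstoI)
    fix y assume "y < ?L"
    then obtain z where z: "b < z" "y < ereal (D_tr c muX z)" by (auto simp: less_SUP_iff)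
    have "\<forall>\<^sub>F w in at_right b. b < w \<and> w < z" 
      using z by (intro eventually_conj eventually_at_right_less eventually_at_rightI[of b z]) auto
    then show "\<forall>\<^sub>F w in at_right b. y < ereal (D_tr c muX w)"
    proof eventually_elim
      case (elim w)
      have "y < ereal (D_tr c muX z)" by (rule z(2))
      also have "\<dots> \<le> ereal (D_tr c muX w)" using D_strict_decreasing[of w z] elim by simp
      finally show ?case .
    qed
  next
    fix y assume y: "?L < y"
    have "\<forall>\<^sub>F w in at_right b. b < w" by (rule eventually_at_right_less)
    then show "\<forall>\<^sub>F w in at_right b. ereal (D_tr c muX w) < y"
    proof eventually_elim
      case (elim w)
      then have "ereal (D_tr c muX w) \<le> ?L" by (intro SUP_upper) auto
      then show ?case using y by simp
    qed
  qed
  then show ?thesis unfolding D_bplus_def by (intro tendsto_Lim) (auto simp: trivial_limit_at_right_real)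
qed

text \<open>The cases on the supremum settle the extended inverse, including 1/\<infinity> = 0. The
  witness on the right is the point from which the intermediate value theorem later finds
  \<rho>.\<close>

lemma supercritical_iff:
  assumes t: "0 < t"
  shows "inverse (D_bplus c muX b) < ereal t \<longleftrightarrow> (\<exists>z>b. 1 < t * D_tr c muX z)"
proof -
  let ?L = "SUP z\<in>{b<..}. ereal (D_tr c muX z)"
  have up: "ereal (D_tr c muX z) \<le> ?L" if "b < z" for z using that by (intro SUP_upper) auto
  have "0 < ereal (D_tr c muX (b + 1))" using D_pos[of "b + 1"] by simp
  also have "\<dots> \<le> ?L" by (rule up) simp
  finally have Lpos: "0 < ?L" .
  have "inverse ?L < ereal t \<longleftrightarrow> ereal (1 / t) < ?L"
  proof (cases ?L)
    case (real l)
    then have l: "0 < l" using Lpos by simp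
    then have "inverse l < t \<longleftrightarrow> 1 / t < l" using t by (simp add: field_simps)
    then show ?thesis using real l by simp
  next
    case PInf
    then show ?thesis using t by simp
  next
    case MInf
    then show ?thesis using Lpos by simp
  qed
  also have "\<dots> \<longleftrightarrow> (\<exists>z>b. 1 / t < D_tr c muX z)" by (auto simp: less_SUP_iff)
  also have "\<dots> \<longleftrightarrow> (\<exists>z>b. 1 < t * D_tr c muX z)" using t by (simp add: divide_less_eq mult.commute)
  finally show ?thesis by (simp add: D_bplus_eq)
qed

text \<open>Equality of \<theta>^2 and 1/D(b+) counts as subcritical; the weak inequality at a point
  between b and z becomes strict at z by monotonicity.\<close>

lemma subcritical_less:
  assumes t: "0 < t" and n: "\<not> inverse (D_bplus c muX b) < ereal t" and z: "b < z"
  shows "t * D_tr c muX z < 1"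
proof -
  define y where "y = (b + z) / 2"
  have y: "b < y" "y < z" using z by (auto simp: y_def)
  have "t * D_tr c muX z < t * D_tr c muX y" using D_strict_decreasing[OF y] t by simp
  also have "\<dots> \<le> 1"
  proof (rule ccontr)
    assume "\<not> t * D_tr c muX y \<le> 1"
    then have "\<exists>z>b. 1 < t * D_tr c muX z" using y by (intro exI[of _ y]) simp
    then show False using n supercritical_iff[OF t] by simp
  qed
  finally show ?thesis .
qed

end

section \<open>Ordered signal strengths, outlier positions and the bulk\<close>

locale spiked_model_dec = spiked_model +
  assumes theta_dec: "\<And>i. 1 \<le> i \<Longrightarrow> i < r \<Longrightarrow> \<theta> (i + 1) < \<theta> i"
    and theta_pos: "\<theta> r > 0"
begin

lemma theta_antimono:
  assumes "1 \<le> i" "i \<le> j" "j \<le> r"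
  shows "\<theta> j \<le> \<theta> i"
  using assms(2,3)
proof (induction j rule: dec_induct)
  case (step k)
  then show ?case using theta_dec[of k] assms(1) by simp
qed simp

lemma theta_gt_0: "1 \<le> i \<Longrightarrow> i \<le> r \<Longrightarrow> 0 < \<theta> i"
  using theta_antimono[of i r] theta_pos by simp

definition reff :: nat where "reff = r_eff c muX b r \<theta>"

text \<open>The condition is inherited by larger \<theta>, so the set is an initial segment and its
  cardinality is also its last index.\<close>

lemma supercritical_set: "{i \<in> {1..r}. ereal ((\<theta> i)\<^sup>2) > inverse (D_bplus c muX b)} = {1..reff}"
proof -
  define S where "S = {i \<in> {1..r}. ereal ((\<theta> i)\<^sup>2) > inverse (D_bplus c muX b)}"
  have fin: "finite S" by (simp add: S_def)
  have down: "i \<in> S" if "j \<in> S" "1 \<le> i" "i \<le> j" for i j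
  proof -
    have "\<theta> j \<le> \<theta> i" "0 < \<theta> j" using that theta_antimono[of i j] theta_gt_0[of j] by (auto simp: S_def)
    then have "ereal ((\<theta> j)\<^sup>2) \<le> ereal ((\<theta> i)\<^sup>2)" by (simp add: power_mono)
    then show ?thesis using that by (auto simp: S_def intro: less_le_trans)
  qed
  have "S = {1..card S}"
  proof (cases "S = {}")
    case False
    have eq: "S = {1..Max S}"
    proof
      show "S \<subseteq> {1..Max S}" using fin by (auto simp: S_def)
      show "{1..Max S} \<subseteq> S" using down Max_in[OF fin False] by auto
    qed
    from arg_cong[OF eq, of card] have "card S = Max S" by simp
    then show ?thesis using eq by (simp only:)
  qed simp
  then show ?thesis by (simp add: S_def reff_def r_eff_def)
qed

lemma reff_le_r: "reff \<le> r"
proof -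
  have "{1..reff} \<subseteq> {1..r}" using supercritical_set by blast
  then show ?thesis by (cases "reff = 0") auto
qed

definition \<rho> :: "nat \<Rightarrow> real" where
  "\<rho> i = the_inv_into {b<..} (D_tr c muX) (1 / (\<theta> i)\<^sup>2)"

lemma rho:
  assumes i: "i \<in> {1..reff}"
  shows "b < \<rho> i" "D_tr c muX (\<rho> i) = 1 / (\<theta> i)\<^sup>2"
proof -
  have th: "0 < \<theta> i" using i reff_le_r by (intro theta_gt_0) auto
  have "inverse (D_bplus c muX b) < ereal ((\<theta> i)\<^sup>2)" using supercritical_set i by blast
  then obtain z where "b < z" "1 < (\<theta> i)\<^sup>2 * D_tr c muX z" using supercritical_iff[of "(\<theta> i)\<^sup>2"] th by auto
  then obtain y where y: "b < y" "D_tr c muX y = 1 / (\<theta> i)\<^sup>2"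
    using D_inverse_exists[of z "1 / (\<theta> i)\<^sup>2"] th by (auto simp: divide_less_eq mult.commute)
  then have "\<rho> i = y" unfolding \<rho>_def by (intro the_inv_D)
  then show "b < \<rho> i" "D_tr c muX (\<rho> i) = 1 / (\<theta> i)\<^sup>2" using y by auto
qed

text \<open>D decreases through 1 / \<theta>_i^2 at \<rho>_i. Just below \<rho>_i the first i spikes
  are above the threshold, just above it at most the first i - 1 are.\<close>

lemma sval_limit:
  assumes \<omega>: "good \<omega>" and i: "i \<in> {1..reff}"
  shows "(\<lambda>n. sval (Xt n \<omega>) i) \<longlonglongrightarrow> \<rho> i"
proof (rule order_tendstoI)
  have ir: "1 \<le> i" "i \<le> r" using i reff_le_r by auto
  have th: "0 < \<theta> i" by (rule theta_gt_0[OF ir])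
  fix y assume y: "y < \<rho> i"
  obtain z where z: "max y b < z" "z < \<rho> i" using dense[of "max y b" "\<rho> i"] y rho[OF i] by auto
  have D: "1 / (\<theta> i)\<^sup>2 < D_tr c muX z" using D_strict_decreasing[of z "\<rho> i"] z rho[OF i] by simp
  have "\<forall>\<^sub>F n in sequentially. z < sval (Xt n \<omega>) i"
  proof (rule eventually_sval_gt[OF \<omega> _ ir])
    fix l assume l: "l < i"
    have le: "\<theta> i \<le> \<theta> (Suc l)" using l ir by (intro theta_antimono) auto
    have "1 < (\<theta> i)\<^sup>2 * D_tr c muX z" using D th by (simp add: divide_less_eq mult.commute)
    also have "\<dots> \<le> (\<theta> (Suc l))\<^sup>2 * D_tr c muX z" using le th D_pos[of z] z by (intro mult_right_mono power_mono) auto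
    finally show "0 < \<theta> (Suc l) \<and> 1 < (\<theta> (Suc l))\<^sup>2 * D_tr c muX z" using le th by simp
  qed (use z in simp)
  then show "\<forall>\<^sub>F n in sequentially. y < sval (Xt n \<omega>) i" by eventually_elim (use z in simp)
next
  have ir: "1 \<le> i" "i \<le> r" using i reff_le_r by auto
  have th: "0 < \<theta> i" by (rule theta_gt_0[OF ir])
  fix y assume y: "\<rho> i < y"
  obtain z where z: "\<rho> i < z" "z < y" using dense[OF y] by blast
  have bz: "b < z" using z rho[OF i] by simp
  have D: "D_tr c muX z < 1 / (\<theta> i)\<^sup>2" using D_strict_decreasing[of "\<rho> i" z] z rho[OF i] by simp
  have "\<forall>\<^sub>F n in sequentially. sval (Xt n \<omega>) (Suc (i - 1)) \<le> z"
  proof (rule eventually_sval_le_threshold[OF \<omega> bz])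
    fix l assume l: "i - 1 \<le> l" "l < r"
    have "\<theta> (Suc l) \<le> \<theta> i" "0 < \<theta> (Suc l)" using l ir by (auto intro: theta_antimono theta_gt_0)
    then have "(\<theta> (Suc l))\<^sup>2 * D_tr c muX z \<le> (\<theta> i)\<^sup>2 * D_tr c muX z"
      using D_pos[OF bz] by (intro mult_right_mono power_mono) auto
    also have "\<dots> < 1" using D th by (simp add: less_divide_eq mult.commute)
    finally show "(\<theta> (Suc l))\<^sup>2 * D_tr c muX z < 1" .
  qed (use ir theta_gt_0 in auto)
  then show "\<forall>\<^sub>F n in sequentially. sval (Xt n \<omega>) i < y"
    by eventually_elim (use z ir in simp)
qed

text \<open>Spikes beyond \<open>reff\<close> are below the threshold at every z > b, so the bound
  holds at index \<open>reff + 1\<close>, and the ordering extends it to all later ones.\<close>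

lemma eventually_bulk_le:
  assumes \<omega>: "good \<omega>" and z: "b < z"
  shows "\<forall>\<^sub>F n in sequentially. \<forall>q. Suc reff \<le> q \<and> q \<le> n \<longrightarrow> sval (Xt n \<omega>) q \<le> z"
proof -
  have "\<forall>\<^sub>F n in sequentially. sval (Xt n \<omega>) (Suc reff) \<le> z"
  proof (rule eventually_sval_le_threshold[OF \<omega> z reff_le_r])
    fix l assume l: "reff \<le> l" "l < r"
    have "\<not> inverse (D_bplus c muX b) < ereal ((\<theta> (Suc l))\<^sup>2)"
    proof
      assume "inverse (D_bplus c muX b) < ereal ((\<theta> (Suc l))\<^sup>2)"
      then have "Suc l \<in> {i \<in> {1..r}. ereal ((\<theta> i)\<^sup>2) > inverse (D_bplus c muX b)}" using l by simp
      then show False using l unfolding supercritical_set by simp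
    qed
    then show "(\<theta> (Suc l))\<^sup>2 * D_tr c muX z < 1"
      using theta_gt_0[of "Suc l"] l by (intro subcritical_less z) auto
  qed (use theta_gt_0 in auto)
  then show ?thesis
  proof eventually_elim
    case (elim n)
    show ?case
    proof (intro allI impI)
      fix q assume "Suc reff \<le> q \<and> q \<le> n"
      then have "sval (Xt n \<omega>) q \<le> sval (Xt n \<omega>) (Suc reff)"
        by (intro sval_antimono[OF Xt_carrier[OF good_space[OF \<omega>]]]) auto
      then show "sval (Xt n \<omega>) q \<le> z" using elim by simp
    qed
  qed
qed

end

section \<open>Convergence of the weights\<close>

lemma tr_diagm: "tr (diagm n f) = (\<Sum>i<n. f i)"
  by (simp add: tr_def diagm_def)

lemma diagm_mult: "diagm n f * diagm n g = diagm n (\<lambda>i. f i * g i)"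
proof (rule eq_matI)
  fix i j assume "i < dim_row (diagm n (\<lambda>i. f i * g i))" "j < dim_col (diagm n (\<lambda>i. f i * g i))"
  then have ij: "i < n" "j < n" by (auto simp: diagm_def)
  have "(diagm n f * diagm n g) $$ (i,j) = (\<Sum>p<n. if p = i then (if i = j then f i * g i else 0) else 0)"
    unfolding mult_index[OF diagm_carrier diagm_carrier ij]
    by (intro sum.cong refl) (use ij in \<open>auto simp: diagm_def\<close>)
  then show "(diagm n f * diagm n g) $$ (i,j) = diagm n (\<lambda>i. f i * g i) $$ (i,j)" using ij by (simp add: diagm_def)
qed (auto simp: diagm_def)

text \<open>\<open>minv\<close> falls back to the zero matrix when \<open>mat_inverse\<close> fails;
  the explicit inverse excludes that case, and inverses are unique.\<close>

lemma minv_diagm: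
  assumes "\<And>i. i < n \<Longrightarrow> f i \<noteq> 0"
  shows "minv (diagm n f) = diagm n (\<lambda>i. 1 / f i)"
proof -
  have one: "diagm n f * diagm n (\<lambda>i. 1 / f i) = 1\<^sub>m n" "diagm n (\<lambda>i. 1 / f i) * diagm n f = 1\<^sub>m n"
    unfolding diagm_mult using assms by (auto intro!: eq_matI simp: diagm_def)
  show ?thesis
  proof (cases "mat_inverse (diagm n f)")
    case None
    from mat_inverse(1)[OF diagm_carrier None]
    have "diagm n f \<notin> Units (ring_mat TYPE(complex) n ())" .
    moreover have "diagm n f \<in> Units (ring_mat TYPE(complex) n ())"
      unfolding Units_def ring_mat_def using one by (auto intro!: bexI[of _ "diagm n (\<lambda>i. 1 / f i)"])
    ultimately show ?thesis by simp
  next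
    case (Some B)
    from mat_inverse(2)[OF diagm_carrier Some]
    have B: "diagm n f * B = 1\<^sub>m n" "B * diagm n f = 1\<^sub>m n" "B \<in> carrier_mat n n" by auto
    have "B = B * (diagm n f * diagm n (\<lambda>i. 1 / f i))" using B by (simp add: one)
    also have "\<dots> = (B * diagm n f) * diagm n (\<lambda>i. 1 / f i)"
      using B by (intro assoc_square[symmetric]) auto
    also have "\<dots> = diagm n (\<lambda>i. 1 / f i)" unfolding B(2) by (rule left_mult_one_mat[OF diagm_carrier])
    finally show ?thesis using Some by (simp add: minv_def)
  qed
qed

lemma smult_one_minus_diagm: "(w \<cdot>\<^sub>m 1\<^sub>m n) - diagm n f = diagm n (\<lambda>i. w - f i)"
  by (rule eq_matI) (auto simp: diagm_def)

lemma smult_diagm: "w \<cdot>\<^sub>m diagm n f = diagm n (\<lambda>i. w * f i)"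
  by (rule eq_matI) (auto simp: diagm_def)

lemma add_diagm: "diagm n f + diagm n g = diagm n (\<lambda>i. f i + g i)"
  by (rule eq_matI) (auto simp: diagm_def)

lemma sum_pad: "(\<Sum>i<(N + d :: nat). if i < N then f i else g) = (\<Sum>i<N. f i) + of_nat d * (g :: complex)"
proof -
  have "(\<Sum>i<N + d. if i < N then f i else g) = (\<Sum>i<N. f i) + (\<Sum>i<d. g)"
    unfolding sum_join by simp
  then show ?thesis by simp
qed

text \<open>The right Gram matrix has \<open>d\<close> additional zero eigenvalues.\<close>

lemma Dhat_diag:
  assumes Y: "Y = mat N (N + d) (\<lambda>(i,j). if i = j then complex_of_real (s i) else 0)"
    and z: "z \<noteq> 0" "\<And>i. i < N \<Longrightarrow> (s i)\<^sup>2 \<noteq> z\<^sup>2"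
  defines "S1 \<equiv> \<Sum>i<N. cauchy_ker z (s i)" and "S2 \<equiv> \<Sum>i<N. (cauchy_ker z (s i))\<^sup>2"
  shows "Dhat z Y = complex_of_real (z * (S1 / N) * (z * ((S1 + d / z\<^sup>2) / real (N + d))))"
    "Dhat' z Y = complex_of_real (z * (S1 / N) * ((- 2 * z\<^sup>2 * (S2 + d / z ^ 4) + (S1 + d / z\<^sup>2)) / real (N + d))
       + z * ((S1 + d / z\<^sup>2) / real (N + d)) * ((- 2 * z\<^sup>2 * S2 + S1) / N))"
proof -
  define w where "w = complex_of_real z"
  define f where "f i = complex_of_real ((s i)\<^sup>2)" for i
  define g where "g i = (if i < N then f i else 0)" for i
  have Yc: "Y \<in> carrier_mat N (N + d)" by (simp add: Y)
  have aY: "adj Y \<in> carrier_mat (N + d) N" using Yc by simp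
  have dims: "dim_row Y = N" "dim_col Y = N + d" by (auto simp: Y)
  have YY: "Y * adj Y = diagm N f"
  proof (rule eq_matI)
    fix i j assume "i < dim_row (diagm N f)" "j < dim_col (diagm N f)"
    then have ij: "i < N" "j < N" by (auto simp: diagm_def)
    have "(Y * adj Y) $$ (i,j) = (\<Sum>p<N+d. if p = i then (if i = j then f i else 0) else 0)"
      unfolding mult_index[OF Yc aY ij]
      by (intro sum.cong refl) (use ij in \<open>auto simp: Y f_def power2_eq_square adj_def\<close>)
    then show "(Y * adj Y) $$ (i,j) = diagm N f $$ (i,j)" using ij by (simp add: diagm_def)
  qed (auto simp: diagm_def Y)
  have YY': "adj Y * Y = diagm (N + d) g"
  proof (rule eq_matI)
    fix i j assume "i < dim_row (diagm (N + d) g)" "j < dim_col (diagm (N + d) g)"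
    then have ij: "i < N + d" "j < N + d" by (auto simp: diagm_def)
    have "(adj Y * Y) $$ (i,j) = (\<Sum>p<N. if p = i then (if i = j then f i else 0) else 0)"
      unfolding mult_index[OF aY Yc ij]
      by (intro sum.cong refl) (use ij in \<open>auto simp: Y f_def power2_eq_square adj_def\<close>)
    then show "(adj Y * Y) $$ (i,j) = diagm (N + d) g $$ (i,j)" using ij by (simp add: diagm_def g_def)
  qed (auto simp: diagm_def Y)
  have nz: "w\<^sup>2 - f i \<noteq> 0" if "i < N" for i
    using z(2)[OF that] unfolding w_def f_def by (simp flip: of_real_power of_real_diff)
  have nz': "w\<^sup>2 - g i \<noteq> 0" for i
    using nz z by (cases "i < N") (auto simp: g_def w_def)
  have R1: "minv ((w\<^sup>2) \<cdot>\<^sub>m 1\<^sub>m N - Y * adj Y) = diagm N (\<lambda>i. 1 / (w\<^sup>2 - f i))"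
    unfolding YY smult_one_minus_diagm by (rule minv_diagm) (rule nz)
  have R2: "minv ((w\<^sup>2) \<cdot>\<^sub>m 1\<^sub>m (N + d) - adj Y * Y) = diagm (N + d) (\<lambda>i. 1 / (w\<^sup>2 - g i))"
    unfolding YY' smult_one_minus_diagm by (rule minv_diagm) (rule nz')
  have hf: "1 / (w\<^sup>2 - f i) = complex_of_real (cauchy_ker z (s i))" for i
    by (simp add: w_def f_def cauchy_ker_def)
  have hg: "1 / (w\<^sup>2 - g i) = (if i < N then complex_of_real (cauchy_ker z (s i)) else complex_of_real (1 / z\<^sup>2))" for i
    using hf[of i] by (simp add: g_def) (simp add: w_def)
  have T1: "tr (w \<cdot>\<^sub>m diagm N (\<lambda>i. 1 / (w\<^sup>2 - f i))) = complex_of_real (z * S1)"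
    unfolding smult_diagm tr_diagm hf S1_def by (simp add: w_def sum_distrib_left)
  have T2: "tr (w \<cdot>\<^sub>m diagm (N + d) (\<lambda>i. 1 / (w\<^sup>2 - g i))) = complex_of_real (z * (S1 + d / z\<^sup>2))"
    unfolding smult_diagm tr_diagm hg sum_distrib_left[symmetric] sum_pad S1_def by (simp add: w_def)
  have T3: "tr ((- 2 * w\<^sup>2) \<cdot>\<^sub>m (diagm N (\<lambda>i. 1 / (w\<^sup>2 - f i)) * diagm N (\<lambda>i. 1 / (w\<^sup>2 - f i))) + diagm N (\<lambda>i. 1 / (w\<^sup>2 - f i)))
      = complex_of_real (- 2 * z\<^sup>2 * S2 + S1)"
    unfolding diagm_mult smult_diagm add_diagm tr_diagm hf S1_def S2_def sum.distrib sum_distrib_left[symmetric]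
    by (simp add: w_def power2_eq_square)
  have T4: "tr ((- 2 * w\<^sup>2) \<cdot>\<^sub>m (diagm (N + d) (\<lambda>i. 1 / (w\<^sup>2 - g i)) * diagm (N + d) (\<lambda>i. 1 / (w\<^sup>2 - g i))) + diagm (N + d) (\<lambda>i. 1 / (w\<^sup>2 - g i)))
      = complex_of_real (- 2 * z\<^sup>2 * (S2 + d / z ^ 4) + (S1 + d / z\<^sup>2))"
  proof -
    have sq: "(1 / (w\<^sup>2 - g i)) * (1 / (w\<^sup>2 - g i)) = 
       (if i < N then complex_of_real ((cauchy_ker z (s i))\<^sup>2) else complex_of_real (1 / z ^ 4))" for i
      unfolding hg by (simp add: power2_eq_square power4_eq_xxxx)
    show ?thesis
      unfolding diagm_mult smult_diagm add_diagm tr_diagm sq sum.distrib sum_distrib_left[symmetric] 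
      unfolding hg sum_pad S1_def S2_def by (simp add: w_def)
  qed
  show "Dhat z Y = complex_of_real (z * (S1 / N) * (z * ((S1 + d / z\<^sup>2) / real (N + d))))"
    unfolding Dhat_def Let_def dims w_def[symmetric] R1 R2 T1 T2 by simp
  show "Dhat' z Y = complex_of_real (z * (S1 / N) * ((- 2 * z\<^sup>2 * (S2 + d / z ^ 4) + (S1 + d / z\<^sup>2)) / real (N + d))
       + z * ((S1 + d / z\<^sup>2) / real (N + d)) * ((- 2 * z\<^sup>2 * S2 + S1) / N))"
    unfolding Dhat'_def Let_def dims w_def[symmetric] R1 R2 T1 T2 T3 T4 by simp
qed

context spiked_model_dec
begin

text \<open>S^H vanishes on vectors orthogonal to all left singular vectors of the signal, so the
  two adjoints agree on a subspace of codimension at most r, and interlacing holds both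
  ways.\<close>

lemma Xt_X_interlacing:
  assumes \<omega>: "\<omega> \<in> space M" and i: "1 \<le> i" "i + r \<le> n"
  shows "sval (Xt n \<omega>) (i + r) \<le> sval (X n \<omega>) i" "sval (X n \<omega>) (i + r) \<le> sval (Xt n \<omega>) i"
proof -
  have eq: "adj_app n (Xt n \<omega>) y j = adj_app n (X n \<omega>) y j"
    if "\<And>e. e < r \<Longrightarrow> (\<Sum>j<n. cnj (uf n e j) * y j) = 0" "j < m n" for y j
    using adj_app_Xt[OF \<omega> that(2), of y] that(1) by simp
  show "sval (Xt n \<omega>) (i + r) \<le> sval (X n \<omega>) i"
    by (rule sval_interlacing[OF Xt_carrier[OF \<omega>] X_carrier[OF \<omega>] i, where g = "\<lambda>e j. cnj (uf n e j)"]) (rule eq)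
  show "sval (X n \<omega>) (i + r) \<le> sval (Xt n \<omega>) i"
    by (rule sval_interlacing[OF X_carrier[OF \<omega>] Xt_carrier[OF \<omega>] i, where g = "\<lambda>e j. cnj (uf n e j)"]) (rule eq[symmetric])
qed

text \<open>Monotonicity of \<open>g\<close> lets interlacing sandwich the sum between partial sums over the singular
  values of \<open>X\<close>.\<close>

lemma bulk_average_limit:
  assumes \<omega>: "good \<omega>" and B: "b < B"
    and g: "\<And>s t. 0 \<le> s \<Longrightarrow> s \<le> t \<Longrightarrow> t \<le> B \<Longrightarrow> g s \<le> g t" "\<And>t. 0 \<le> t \<Longrightarrow> t \<le> B \<Longrightarrow> 0 \<le> g t"
      "continuous_on {0..B} g" "g \<in> borel_measurable borel"
  shows "(\<lambda>n. (\<Sum>q\<in>{Suc reff..n}. g (sval (Xt n \<omega>) q)) / real n) \<longlonglongrightarrow> (\<integral>t. g t \<partial>muX)"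
proof -
  note reg = good_regular[OF \<omega>] and space = good_space[OF \<omega>]
  have B0: "0 \<le> B" using B b_nonneg by simp
  let ?s = "\<lambda>n. \<Sum>q\<in>{1..n}. g (sval (X n \<omega>) q)"
  \<comment> \<open>In either direction at most 2 r summands are left unmatched by the index shift
    r, each at most g(B).\<close>
  define C where "C = real (2 * r) * g B"
  have lim: "(\<lambda>n. ?s n / real n) \<longlonglongrightarrow> (\<integral>t. g t \<partial>muX)" by (rule esd_limit[OF reg B g(3,4)])
  have Cn: "(\<lambda>n. C / real n) \<longlonglongrightarrow> 0" by (rule lim_const_over_n)
  have bounds: "\<forall>\<^sub>F n in sequentially. ?s n - C \<le> (\<Sum>q\<in>{Suc reff..n}. g (sval (Xt n \<omega>) q)) \<and> 
      (\<Sum>q\<in>{Suc reff..n}. g (sval (Xt n \<omega>) q)) \<le> ?s n + C"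
    using eventually_sval_le[OF reg B] eventually_bulk_le[OF \<omega> B] eventually_ge_at_top[of "2 * r"]
  proof eventually_elim
    case (elim n)
    have X0: "0 \<le> sval (X n \<omega>) q" "sval (X n \<omega>) q \<le> B" if "1 \<le> q" "q \<le> n" for q
      using sval_X_nonneg[OF reg that] elim(1) that by auto
    have T0: "0 \<le> sval (Xt n \<omega>) q" "sval (Xt n \<omega>) q \<le> B" if "Suc reff \<le> q" "q \<le> n" for q
      using sval_nonneg[OF Xt_carrier[OF space], of q n] elim(2) that by auto
    have gC: "g t \<le> g B" if "0 \<le> t" "t \<le> B" for t using g(1)[of t B] that by simp
    have gB: "0 \<le> g B" using g(2) B0 by simp
    note kr = reff_le_r
    have "(\<Sum>q\<in>{Suc reff..n}. g (sval (Xt n \<omega>) q)) = 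
      (\<Sum>q\<in>{Suc reff..r}. g (sval (Xt n \<omega>) q)) + (\<Sum>q\<in>{Suc r..n}. g (sval (Xt n \<omega>) q))"
      by (subst sum.union_disjoint[symmetric]) (use kr elim(3) in \<open>auto intro!: sum.cong\<close>)
    also have "(\<Sum>q\<in>{Suc reff..r}. g (sval (Xt n \<omega>) q)) \<le> (\<Sum>q\<in>{Suc reff..r}. g B)"
      using T0 gC elim(3) by (intro sum_mono) auto
    also have "\<dots> \<le> C" using gB by (simp add: C_def) (intro mult_right_mono, auto)
    also have "(\<Sum>q\<in>{Suc r..n}. g (sval (Xt n \<omega>) q)) = (\<Sum>i\<in>{1..n - r}. g (sval (Xt n \<omega>) (i + r)))"
      by (rule sum.reindex_bij_witness[of _ "\<lambda>i. i + r" "\<lambda>q. q - r"]) auto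
    also have "\<dots> \<le> (\<Sum>i\<in>{1..n - r}. g (sval (X n \<omega>) i))"
    proof (rule sum_mono)
      fix i assume "i \<in> {1..n - r}"
      then have i: "1 \<le> i" "i + r \<le> n" using elim(3) by auto
      show "g (sval (Xt n \<omega>) (i + r)) \<le> g (sval (X n \<omega>) i)"
        using Xt_X_interlacing(1)[OF space i] X0[of i] T0[of "i + r"] i kr by (intro g(1)) auto
    qed
    also have "\<dots> \<le> ?s n" using X0 g(2) by (intro sum_mono2) auto
    finally have up: "(\<Sum>q\<in>{Suc reff..n}. g (sval (Xt n \<omega>) q)) \<le> ?s n + C" by (simp add: add.commute)
    have "?s n = (\<Sum>q\<in>{1..reff + r}. g (sval (X n \<omega>) q)) + (\<Sum>q\<in>{Suc (reff + r)..n}. g (sval (X n \<omega>) q))"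
      by (subst sum.union_disjoint[symmetric]) (use kr elim(3) in \<open>auto intro!: sum.cong\<close>)
    also have "(\<Sum>q\<in>{1..reff + r}. g (sval (X n \<omega>) q)) \<le> (\<Sum>q\<in>{1..reff + r}. g B)"
      using X0 gC elim(3) kr by (intro sum_mono) auto
    also have "\<dots> \<le> C" using gB kr by (simp add: C_def) (intro mult_right_mono, auto)
    also have "(\<Sum>q\<in>{Suc (reff + r)..n}. g (sval (X n \<omega>) q)) = (\<Sum>i\<in>{Suc reff..n - r}. g (sval (X n \<omega>) (i + r)))"
      by (rule sum.reindex_bij_witness[of _ "\<lambda>i. i + r" "\<lambda>q. q - r"]) auto
    also have "\<dots> \<le> (\<Sum>i\<in>{Suc reff..n - r}. g (sval (Xt n \<omega>) i))"
    proof (rule sum_mono)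
      fix i assume "i \<in> {Suc reff..n - r}"
      then have i: "1 \<le> i" "Suc reff \<le> i" "i + r \<le> n" using elim(3) by auto
      show "g (sval (X n \<omega>) (i + r)) \<le> g (sval (Xt n \<omega>) i)"
        using Xt_X_interlacing(2)[OF space i(1,3)] X0[of "i + r"] T0[of i] i by (intro g(1)) auto
    qed
    also have "\<dots> \<le> (\<Sum>q\<in>{Suc reff..n}. g (sval (Xt n \<omega>) q))"
      using T0 g(2) by (intro sum_mono2) auto
    finally show ?case using up by simp
  qed
  show ?thesis
  proof (rule tendsto_sandwich)
    show "\<forall>\<^sub>F n in sequentially. ?s n / real n - C / real n \<le> (\<Sum>q\<in>{Suc reff..n}. g (sval (Xt n \<omega>) q)) / real n"
      using bounds by eventually_elim (simp add: diff_divide_distrib[symmetric] divide_right_mono)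
    show "\<forall>\<^sub>F n in sequentially. (\<Sum>q\<in>{Suc reff..n}. g (sval (Xt n \<omega>) q)) / real n \<le> ?s n / real n + C / real n"
      using bounds by eventually_elim (simp add: add_divide_distrib[symmetric] divide_right_mono)
    show "(\<lambda>n. ?s n / real n - C / real n) \<longlonglongrightarrow> (\<integral>t. g t \<partial>muX)" using tendsto_diff[OF lim Cn] by simp
    show "(\<lambda>n. ?s n / real n + C / real n) \<longlonglongrightarrow> (\<integral>t. g t \<partial>muX)" using tendsto_add[OF lim Cn] by simp
  qed
qed

text \<open>The evaluation point moves with n. It eventually stays above B' while the bulk stays
  below B < B', so the kernels are uniformly Lipschitz there and z may be substituted.\<close>

lemma moving_average_limit:
  assumes \<omega>: "good \<omega>" and z: "b < z" and w: "w \<longlonglongrightarrow> z" and p: "p \<in> {1, 2}"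
  shows "(\<lambda>n. (\<Sum>q\<in>{Suc reff..n}. (cauchy_ker (w n) (sval (Xt n \<omega>) q)) ^ p) / real n) \<longlonglongrightarrow> J p z"
proof -
  obtain B where B: "b < B" "B < z" using dense[OF z] by blast
  obtain B' where B': "B < B'" "B' < z" using dense[OF B(2)] by blast
  have B0: "0 \<le> B" using B b_nonneg by simp
  define \<kappa> where "\<kappa> = B'\<^sup>2 - B\<^sup>2"
  have \<kappa>: "0 < \<kappa>" using B0 B' by (auto simp: \<kappa>_def power_strict_mono)
  \<comment> \<open>The sum of the Lipschitz bounds for p = 1 and p = 2, so that one error serves
    both.\<close>
  define E where "E n = \<bar>z\<^sup>2 - (w n)\<^sup>2\<bar> / \<kappa>\<^sup>2 + 2 * \<bar>z\<^sup>2 - (w n)\<^sup>2\<bar> / \<kappa> ^ 3" for n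
  have "E \<longlonglongrightarrow> \<bar>z\<^sup>2 - z\<^sup>2\<bar> / \<kappa>\<^sup>2 + 2 * \<bar>z\<^sup>2 - z\<^sup>2\<bar> / \<kappa> ^ 3"
    unfolding E_def using \<kappa> by (intro tendsto_intros w) auto
  then have E: "E \<longlonglongrightarrow> 0" by simp
  let ?f = "\<lambda>n. (\<Sum>q\<in>{Suc reff..n}. (cauchy_ker (w n) (sval (Xt n \<omega>) q)) ^ p) / real n"
  let ?g = "\<lambda>n. (\<Sum>q\<in>{Suc reff..n}. (cauchy_ker z (sval (Xt n \<omega>) q)) ^ p) / real n"
  have g: "?g \<longlonglongrightarrow> J p z" unfolding J_def
  proof (rule bulk_average_limit[OF \<omega> B(1)])
    show "cauchy_ker z s ^ p \<le> cauchy_ker z t ^ p" if "0 \<le> s" "s \<le> t" "t \<le> B" for s t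
      using cauchy_ker_mono[of s t z] cauchy_ker_bounds(1)[of s B z z] that B by (intro power_mono) auto
    show "0 \<le> cauchy_ker z t ^ p" if "0 \<le> t" "t \<le> B" for t
      using cauchy_ker_bounds(1)[of t B z z] that B by simp
    show "continuous_on {0..B} (\<lambda>t. cauchy_ker z t ^ p)"
      by (intro continuous_intros continuous_on_cauchy_ker B)
  qed measurable
  have "(\<lambda>n. ?f n - ?g n) \<longlonglongrightarrow> 0"
  proof (rule Lim_null_comparison[OF _ E])
    have "\<forall>\<^sub>F n in sequentially. B' < w n" by (rule order_tendstoD(1)[OF w B'(2)])
    then show "\<forall>\<^sub>F n in sequentially. norm (?f n - ?g n) \<le> E n"
      using eventually_bulk_le[OF \<omega> B(1)] eventually_ge_at_top[of 1]
    proof eventually_elim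
      case (elim n)
      have E0: "0 \<le> E n" using \<kappa> by (simp add: E_def)
      have pt: "\<bar>cauchy_ker (w n) (sval (Xt n \<omega>) q) ^ p - cauchy_ker z (sval (Xt n \<omega>) q) ^ p\<bar> \<le> E n"
        if q: "q \<in> {Suc reff..n}" for q
      proof -
        have t: "0 \<le> sval (Xt n \<omega>) q" "sval (Xt n \<omega>) q \<le> B"
          using sval_nonneg[OF Xt_carrier[OF good_space[OF \<omega>]], of q n] elim(2) q by auto
        have "0 \<le> \<bar>z\<^sup>2 - (w n)\<^sup>2\<bar> / \<kappa>\<^sup>2" "0 \<le> 2 * \<bar>z\<^sup>2 - (w n)\<^sup>2\<bar> / \<kappa> ^ 3" using \<kappa> by auto
        then show ?thesis
          using cauchy_ker_lipschitz[OF t B'(1), of "w n" z, folded \<kappa>_def] elim(1) B' p by (auto simp: E_def)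
      qed
      have "norm (?f n - ?g n) = \<bar>\<Sum>q\<in>{Suc reff..n}. cauchy_ker (w n) (sval (Xt n \<omega>) q) ^ p - cauchy_ker z (sval (Xt n \<omega>) q) ^ p\<bar> / real n"
        by (simp add: sum_subtractf diff_divide_distrib[symmetric])
      also have "\<dots> \<le> (\<Sum>q\<in>{Suc reff..n}. E n) / real n"
        by (intro divide_right_mono order_trans[OF sum_abs] sum_mono pt) auto
      also have "\<dots> \<le> (real n * E n) / real n"
        using E0 by (intro divide_right_mono) (auto intro!: mult_right_mono)
      also have "\<dots> = E n" using elim(3) by simp
      finally show ?case .
    qed
  qed
  from tendsto_add[OF this g] show ?thesis by simp
qed

lemma w_opt_hat_limit:
  assumes \<omega>: "good \<omega>" and i: "i \<in> {1..reff}"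
  shows "(\<lambda>n. w_opt_hat (Xt n \<omega>) reff i) \<longlonglongrightarrow> complex_of_real (- 2 * D_tr c muX (\<rho> i) / dD (\<rho> i))"
proof -
  note space = good_space[OF \<omega>]
  define z where "z = \<rho> i"
  define w where "w n = sval (Xt n \<omega>) i" for n
  have bz: "b < z" using rho(1)[OF i] by (simp add: z_def)
  have z0: "0 < z" using bz b_nonneg by simp
  have w: "w \<longlonglongrightarrow> z" unfolding w_def z_def by (rule sval_limit[OF \<omega> i])
  define s where "s p n = (\<Sum>q\<in>{Suc reff..n}. (cauchy_ker (w n) (sval (Xt n \<omega>) q)) ^ p)" for p n
  define a where "a p n = s p n / real (n - reff)" for p n
  \<comment> \<open>The aspect ratio of the truncated matrix; it stands in for \<open>c\<close> in
    the exact formulas and tends to it.\<close>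
  define e where "e n = real (n - reff) / real (m n - reff)" for n
  have ratio0: "(\<lambda>n. real (n - reff) / real n) \<longlonglongrightarrow> 1"
  proof -
    have "(\<lambda>n. 1 - real reff / real n) \<longlonglongrightarrow> 1 - 0" by (intro tendsto_diff tendsto_const lim_const_over_n)
    then have "(\<lambda>n. 1 - real reff / real n) \<longlonglongrightarrow> 1" by simp
    then show ?thesis
    proof (rule Lim_transform_eventually)
      show "\<forall>\<^sub>F n in sequentially. 1 - real reff / real n = real (n - reff) / real n"
        using eventually_ge_at_top[of "Suc reff"] by eventually_elim (simp add: field_simps)
    qed
  qed
  have ratio1: "(\<lambda>n. real n / real (n - reff)) \<longlonglongrightarrow> 1"
    using tendsto_inverse[OF ratio0] by (simp add: inverse_eq_divide)
  have a: "a p \<longlonglongrightarrow> J p z" if "p \<in> {1,2}" for p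
  proof -
    have "(\<lambda>n. s p n / real n * (real n / real (n - reff))) \<longlonglongrightarrow> J p z * 1"
      unfolding s_def by (intro tendsto_mult moving_average_limit[OF \<omega> bz w that] ratio1)
    then have "(\<lambda>n. s p n / real n * (real n / real (n - reff))) \<longlonglongrightarrow> J p z" by simp
    then show ?thesis
    proof (rule Lim_transform_eventually)
      show "\<forall>\<^sub>F n in sequentially. s p n / real n * (real n / real (n - reff)) = a p n"
        using eventually_ge_at_top[of 1] by eventually_elim (simp add: a_def)
    qed
  qed
  have m_top: "filterlim m at_top sequentially"
    by (rule filterlim_at_top_mono[OF filterlim_ident]) (use m_ge in auto)
  have e: "e \<longlonglongrightarrow> c"
  proof -
    have "(\<lambda>n. real n / real (n - reff)) \<longlonglongrightarrow> 1" by (rule ratio1)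
    then have 2: "(\<lambda>n. real (m n) / real (m n - reff)) \<longlonglongrightarrow> 1" by (rule filterlim_compose[OF _ m_top])
    have "(\<lambda>n. (real (n - reff) / real n) * (real n / real (m n)) * (real (m n) / real (m n - reff))) \<longlonglongrightarrow> 1 * c * 1"
      by (intro tendsto_mult 2 ratio0 ratio)
    then have "(\<lambda>n. (real (n - reff) / real n) * (real n / real (m n)) * (real (m n) / real (m n - reff))) \<longlonglongrightarrow> c" by simp
    then show ?thesis
    proof (rule Lim_transform_eventually)
      show "\<forall>\<^sub>F n in sequentially. (real (n - reff) / real n) * (real n / real (m n)) * (real (m n) / real (m n - reff)) = e n"
        using eventually_ge_at_top[of 1]
      proof eventually_elim
        case (elim n)
        then have "0 < real n" "0 < real (m n)" using m_ge[of n] by auto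
        then show ?case by (simp add: e_def)
      qed
    qed
  qed
  \<comment> \<open>\<open>num\<close> and \<open>den\<close> are \<open>Dhat\<close> and
    \<open>Dhat'\<close> in closed form; \<open>1 - e n\<close> is the proportion of the additional
    zero eigenvalues of the right Gram matrix.\<close>
  define num where "num n = w n * a 1 n * (w n * (e n * a 1 n + (1 - e n) / (w n)\<^sup>2))" for n
  define den where "den n = w n * a 1 n * (- 2 * (w n)\<^sup>2 * (e n * a 2 n + (1 - e n) / (w n) ^ 4) + (e n * a 1 n + (1 - e n) / (w n)\<^sup>2))
      + w n * (e n * a 1 n + (1 - e n) / (w n)\<^sup>2) * (- 2 * (w n)\<^sup>2 * a 2 n + a 1 n)" for n
  have "num \<longlonglongrightarrow> z * J 1 z * (z * (c * J 1 z + (1 - c) / z\<^sup>2))"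
    unfolding num_def using z0 by (intro tendsto_intros a e w) auto
  also have "z * J 1 z * (z * (c * J 1 z + (1 - c) / z\<^sup>2)) = D_tr c muX z"
    unfolding D_tr_def phi_tr_J using z0 by (simp add: power2_eq_square field_simps)
  finally have num: "num \<longlonglongrightarrow> D_tr c muX z" .
  have "den \<longlonglongrightarrow> z * J 1 z * (- 2 * z\<^sup>2 * (c * J 2 z + (1 - c) / z ^ 4) + (c * J 1 z + (1 - c) / z\<^sup>2))
      + z * (c * J 1 z + (1 - c) / z\<^sup>2) * (- 2 * z\<^sup>2 * J 2 z + J 1 z)"
    unfolding den_def using z0 by (intro tendsto_intros a e w) auto
  also have "z * J 1 z * (- 2 * z\<^sup>2 * (c * J 2 z + (1 - c) / z ^ 4) + (c * J 1 z + (1 - c) / z\<^sup>2))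
      + z * (c * J 1 z + (1 - c) / z\<^sup>2) * (- 2 * z\<^sup>2 * J 2 z + J 1 z) = dD z"
  proof -
    have 1: "- 2 * z\<^sup>2 * (c * J 2 z + (1 - c) / z ^ 4) + (c * J 1 z + (1 - c) / z\<^sup>2) = c * dphi z - (1 - c) / z\<^sup>2"
    proof -
      have "z\<^sup>2 * ((1 - c) / z ^ 4) = (1 - c) / z\<^sup>2" using z0 by (simp add: power2_eq_square power4_eq_xxxx)
      then have "- 2 * z\<^sup>2 * (c * J 2 z + (1 - c) / z ^ 4) = - 2 * z\<^sup>2 * (c * J 2 z) - 2 * ((1 - c) / z\<^sup>2)"
        by (simp only: distrib_left mult.assoc)
      then show ?thesis by (simp add: dphi_def algebra_simps)
    qed
    have 2: "z * (c * J 1 z + (1 - c) / z\<^sup>2) = c * phi_tr muX z + (1 - c) / z"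
      using z0 by (simp add: phi_tr_J power2_eq_square distrib_left)
    have 3: "- 2 * z\<^sup>2 * J 2 z + J 1 z = dphi z" by (simp add: dphi_def)
    show ?thesis unfolding 1 2 3 dD_def phi_tr_J by (simp add: mult.commute)
  qed
  finally have den: "den \<longlonglongrightarrow> dD z" .
  have lim: "(\<lambda>n. - 2 * num n / den n) \<longlonglongrightarrow> - 2 * D_tr c muX z / dD z"
    using dD_neg[OF bz] by (intro tendsto_intros num den) auto
  obtain B where B: "b < B" "B < z" using dense[OF bz] by blast
  have "\<forall>\<^sub>F n in sequentially. B < w n" using w B(2) by (rule order_tendstoD(1))
  then have eq: "\<forall>\<^sub>F n in sequentially. complex_of_real (- 2 * num n / den n) = w_opt_hat (Xt n \<omega>) reff i"
    using eventually_bulk_le[OF \<omega> B(1)] eventually_ge_at_top[of "Suc reff"]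
  proof eventually_elim
    case (elim n)
    define N where "N = n - reff"
    \<comment> \<open>Truncation removes \<open>reff\<close> rows and equally many columns, so the
      excess of columns is still m n - n.\<close>
    define d where "d = m n - n"
    have N: "0 < N" "n = N + reff" using elim by (auto simp: N_def)
    have mN: "m n - reff = N + d" "real (m n - reff) = real N + real d" using m_ge[of n] N by (auto simp: d_def)
    have w0: "0 < w n" using elim(1) B b_nonneg by simp
    define Y where "Y = trunc_Sigma (Xt n \<omega>) reff"
    have Y: "Y = mat N (N + d) (\<lambda>(i,j). if i = j then complex_of_real (sval (Xt n \<omega>) (reff + 1 + i)) else 0)"
      unfolding Y_def trunc_Sigma_def carrier_matD[OF Xt_carrier[OF space]] mN(1) N_def ..
    \<comment> \<open>The outlier lies above B and the retained values do not, so both resolvents at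
      \<open>w n\<close> exist.\<close>
    have ne: "(sval (Xt n \<omega>) (reff + 1 + i))\<^sup>2 \<noteq> (w n)\<^sup>2" if "i < N" for i
    proof -
      have q: "Suc reff \<le> reff + 1 + i \<and> reff + 1 + i \<le> n" using that N(2) by simp
      have "sval (Xt n \<omega>) (reff + 1 + i) \<le> B" using elim(2)[rule_format, OF q] .
      moreover have "0 \<le> sval (Xt n \<omega>) (reff + 1 + i)"
        by (rule sval_nonneg[OF Xt_carrier[OF space]]) (use q in auto)
      ultimately have "0 \<le> sval (Xt n \<omega>) (reff + 1 + i)" "sval (Xt n \<omega>) (reff + 1 + i) < w n"
        using elim(1) by auto
      then show ?thesis using power_strict_mono[of "sval (Xt n \<omega>) (reff + 1 + i)" "w n" 2] by simp
    qed
    have reidx: "(\<Sum>i<N. (cauchy_ker (w n) (sval (Xt n \<omega>) (reff + 1 + i))) ^ p) = real N * a p n" for p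
    proof -
      have "(\<Sum>i<N. (cauchy_ker (w n) (sval (Xt n \<omega>) (reff + 1 + i))) ^ p) = s p n"
        unfolding s_def by (rule sum.reindex_bij_witness[of _ "\<lambda>q. q - Suc reff" "\<lambda>i. reff + 1 + i"]) (use N in auto)
      then show ?thesis using N(1) by (simp add: a_def N_def)
    qed
    note D = Dhat_diag[OF Y _ ne, unfolded reidx[of 1, unfolded power_one_right] reidx[of 2]]
    have en: "e n = real N / (real N + real d)" unfolding e_def mN(2) N_def ..
    have en': "1 - e n = real d / (real N + real d)" unfolding en using N(1) by (simp add: field_simps)
    have x1: "(real N * x + real d / y) / real (N + d) = e n * x + (1 - e n) / y" for x y
      unfolding en' unfolding en using N(1) by (simp add: add_divide_distrib mult.commute)
    have x2: "(- 2 * t * (real N * x + real d / y) + (real N * x' + real d / y')) / real (N + d) = 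
       - 2 * t * (e n * x + (1 - e n) / y) + (e n * x' + (1 - e n) / y')" for t x y x' y'
      unfolding x1[symmetric] by (subst add_divide_distrib) (simp only: times_divide_eq_right)
    have x3: "real N * x / real N = x" for x using N(1) by simp
    have x4: "(- 2 * t * (real N * x) + real N * x') / real N = - 2 * t * x + x'" for t x x'
    proof -
      have "- 2 * t * (real N * x) + real N * x' = real N * (- 2 * t * x + x')" by (simp add: algebra_simps)
      then show ?thesis by (simp only: x3)
    qed
    have "Dhat (w n) Y = complex_of_real (num n)"
      using D(1) w0 unfolding x1 x3 num_def by simp
    moreover have "Dhat' (w n) Y = complex_of_real (den n)"
      using D(2) w0 unfolding x1 x2 x3 x4 den_def by simp
    ultimately show ?case unfolding w_opt_hat_def w_def[symmetric] Y_def[symmetric] by simp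
  qed
  have "(\<lambda>n. complex_of_real (- 2 * num n / den n)) \<longlonglongrightarrow> complex_of_real (- 2 * D_tr c muX z / dD z)"
    by (rule tendsto_of_real[OF lim])
  then show ?thesis unfolding z_def[symmetric] by (rule Lim_transform_eventually[OF _ eq])
qed

end

theorem theorem2p6:
  fixes M :: "'w measure"
    and realK :: bool
    and m :: "nat \<Rightarrow> nat" and c :: real
    and X :: "nat \<Rightarrow> 'w \<Rightarrow> complex mat"
    and muX :: "real measure" and a b :: real
    and r :: nat and \<theta> :: "nat \<Rightarrow> real"
    and u v :: "nat \<Rightarrow> nat \<Rightarrow> complex vec"
  assumes M: "prob_space M"
    and m_ge: "\<And>n. m n \<ge> n"
    and ratio: "(\<lambda>n. real n / real (m n)) \<longlonglongrightarrow> c"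
    and X_dim: "\<And>n \<omega>. \<omega> \<in> space M \<Longrightarrow> X n \<omega> \<in> carrier_mat n (m n) \<and> K_mat realK (X n \<omega>)"
    and X_meas: "\<And>n i j. i < n \<Longrightarrow> j < m n \<Longrightarrow> (\<lambda>\<omega>. X n \<omega> $$ (i, j)) \<in> borel_measurable M"
    and X_invariant: "\<And>n U V. K_unitary realK n U \<Longrightarrow> K_unitary realK (m n) V \<Longrightarrow>
          distr M (mat_space n (m n)) (\<lambda>\<omega>. entries n (m n) (U * X n \<omega> * V))
        = distr M (mat_space n (m n)) (\<lambda>\<omega>. entries n (m n) (X n \<omega>))"
    and muX_prob: "prob_space muX" and muX_sets: "sets muX = sets borel"
    and ab: "a \<le> b"
    and muX_supp: "emeasure muX (UNIV - {a..b}) = 0"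
    and b_endpoint: "\<And>\<epsilon>. \<epsilon> > 0 \<Longrightarrow> emeasure muX {b - \<epsilon><..b} > 0"
    and esd_conv: "AE \<omega> in M. \<forall>f :: real \<Rightarrow> real. continuous_on UNIV f \<and> bounded (range f) \<longrightarrow>
          (\<lambda>n. (1 / real n) * (\<Sum>i\<in>{1..n}. f (sval (X n \<omega>) i))) \<longlonglongrightarrow> (\<integral>t. f t \<partial>muX)"
    and top_sv: "AE \<omega> in M. (\<lambda>n. sval (X n \<omega>) 1) \<longlonglongrightarrow> b"
    and r_pos: "r \<ge> 1"
    and theta_dec: "\<And>i. 1 \<le> i \<Longrightarrow> i < r \<Longrightarrow> \<theta> (i + 1) < \<theta> i"
    and theta_pos: "\<theta> r > 0"
    and u_vec: "\<And>n i. n \<ge> r \<Longrightarrow> i \<in> {1..r} \<Longrightarrow> u n i \<in> carrier_vec n \<and> K_vec realK (u n i)"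
    and v_vec: "\<And>n i. n \<ge> r \<Longrightarrow> i \<in> {1..r} \<Longrightarrow> v n i \<in> carrier_vec (m n) \<and> K_vec realK (v n i)"
    and u_orth: "\<And>n i j. n \<ge> r \<Longrightarrow> i \<in> {1..r} \<Longrightarrow> j \<in> {1..r} \<Longrightarrow>
          u n i \<bullet>c u n j = (if i = j then 1 else 0)"
    and v_orth: "\<And>n i j. n \<ge> r \<Longrightarrow> i \<in> {1..r} \<Longrightarrow> j \<in> {1..r} \<Longrightarrow>
          v n i \<bullet>c v n j = (if i = j then 1 else 0)"
  shows "\<forall>i \<in> {1..r_eff c muX b r \<theta>}.
           AE \<omega> in M.
             (\<lambda>n. w_opt_hat (signal n (m n) r \<theta> (u n) (v n) + X n \<omega>) (r_eff c muX b r \<theta>) i)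
               \<longlonglongrightarrow> complex_of_real
                    (let \<rho> = the_inv_into {b<..} (D_tr c muX) (1 / (\<theta> i)^2)
                     in - 2 * D_tr c muX \<rho> / deriv (D_tr c muX) \<rho>)"
proof -
  interpret spiked_model_dec M realK m c X muX a b r \<theta> u v
    by (intro spiked_model_dec.intro spiked_model.intro invariant_noise.intro spiked_model_dec_axioms.intro
        spiked_model_axioms.intro invariant_noise_axioms.intro) (fact assms)+
  show ?thesis
  proof
    fix i assume "i \<in> {1..r_eff c muX b r \<theta>}"
    then have i: "i \<in> {1..reff}" by (simp add: reff_def)
    have d: "deriv (D_tr c muX) (\<rho> i) = dD (\<rho> i)" by (rule DERIV_imp_deriv[OF D_deriv[OF rho(1)[OF i]]])
    show "AE \<omega> in M.
        (\<lambda>n. w_opt_hat (signal n (m n) r \<theta> (u n) (v n) + X n \<omega>) (r_eff c muX b r \<theta>) i)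
          \<longlonglongrightarrow> complex_of_real
               (let \<rho> = the_inv_into {b<..} (D_tr c muX) (1 / (\<theta> i)^2)
                in - 2 * D_tr c muX \<rho> / deriv (D_tr c muX) \<rho>)"
      unfolding Let_def \<rho>_def[symmetric] d reff_def[symmetric] Xt_def[symmetric]
      using AE_good by eventually_elim (rule w_opt_hat_limit[OF _ i])
  qed
qed

end
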